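(* Let $n\ge3$, let $\Omega\subset\mathbb{R}^n$ be a smooth bounded domain which is star-shaped (with respect to the origin), and let $p\ge\frac{n+2}{n-2}$. Then for every $m>0$, problem (P) has no nontrivial weak solution $u$ with $u\in L^\infty(\Omega)$.
   Context: Let $\{\lambda_i,\phi_i\}_{i\ge1}$ be the $L^2(\Omega)$-orthonormal system of Dirichlet eigenvalues and eigenfunctions of $-\Delta$ on $\Omega$, $0<\lambda_1\le\lambda_2\le\cdots$. Every $u\in L^2(\Omega)$ is written $u=\sum_i c_i\phi_i$. Set $H^1_0(\Omega)=\{u:\sum_i c_i^2\lambda_i<\infty\}$ and $H^{1/2}_0(\Omega)=\{u:\sum_i c_i^2\lambda_i^{1/2}<\infty\}$. For $m\ge0$ define spectrally $\sqrt{-\Delta+m^2}\,u=\sum_i c_i\sqrt{\lambda_i+m^2}\,\phi_i$, $(-\Delta+m^2)^{1/4}u=\sum_i c_i(\lambda_i+m^2)^{1/4}\phi_i$, and $\mathcal{P}_m=\sqrt{-\Delta+m^2}-m$. Problem (P) is: $\mathcal{P}_m u=|u|^{p-1}u$ in $\Omega$, $u=0$ on $\partial\Omega$. A weak solution of (P) is $u\in H^{1/2}_0(\Omega)$ with $|u|^{p-1}u\in L^{2n/(n+1)}(\Omega)$ such that $\int_\Omega (-\Delta+m^2)^{1/4}u\,(-\Delta+m^2)^{1/4}v-muv-|u|^{p-1}uv\,dx=0$ for all $v\in H^{1/2}_0(\Omega)$. *)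

theory Defs
  imports "HOL-Analysis.Analysis"
begin

fun Ck_on :: "nat \<Rightarrow> 'a::euclidean_space set \<Rightarrow> ('a \<Rightarrow> real) \<Rightarrow> bool" where
  "Ck_on 0 S f = continuous_on S f"
| "Ck_on (Suc k) S f =
     (\<exists>D :: 'a \<Rightarrow> 'a \<Rightarrow> real.
        (\<forall>x\<in>S. (f has_derivative (\<lambda>h. \<Sum>b\<in>Basis. (h \<bullet> b) * D b x)) (at x))
        \<and> (\<forall>b\<in>Basis. Ck_on k S (D b)))"

definition smooth_fun :: "('a::euclidean_space \<Rightarrow> real) \<Rightarrow> bool" where
  "smooth_fun f \<longleftrightarrow> (\<forall>k. Ck_on k UNIV f)"

definition smooth_bounded_domain :: "'a::euclidean_space set \<Rightarrow> bool" where
  "smooth_bounded_domain \<Omega> \<longleftrightarrow> open \<Omega> \<and> connected \<Omega> \<and> bounded \<Omega> \<and> \<Omega> \<noteq> {} \<and>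
     (\<exists>\<rho>. smooth_fun \<rho> \<and> \<Omega> = {x. \<rho> x < 0} \<and>
        (\<forall>x. \<rho> x = 0 \<longrightarrow> \<not> (\<rho> has_derivative (\<lambda>h. 0)) (at x)))"

definition star_shaped_origin :: "'a::euclidean_space set \<Rightarrow> bool" where
  "star_shaped_origin \<Omega> \<longleftrightarrow> (\<forall>x\<in>\<Omega>. closed_segment 0 x \<subseteq> \<Omega>)"

definition memLp :: "'a::euclidean_space set \<Rightarrow> real \<Rightarrow> ('a \<Rightarrow> real) \<Rightarrow> bool" where
  "memLp \<Omega> q f \<longleftrightarrow> f \<in> borel_measurable (lebesgue_on \<Omega>) \<and>
      integrable (lebesgue_on \<Omega>) (\<lambda>x. \<bar>f x\<bar> powr q)"

definition memLinf :: "'a::euclidean_space set \<Rightarrow> ('a \<Rightarrow> real) \<Rightarrow> bool" where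
  "memLinf \<Omega> f \<longleftrightarrow> f \<in> borel_measurable (lebesgue_on \<Omega>) \<and>
      (\<exists>C. AE x in lebesgue_on \<Omega>. \<bar>f x\<bar> \<le> C)"

definition L2int :: "'a::euclidean_space set \<Rightarrow> ('a \<Rightarrow> real) \<Rightarrow> ('a \<Rightarrow> real) \<Rightarrow> real" where
  "L2int \<Omega> f g = (\<integral>x. f x * g x \<partial>lebesgue_on \<Omega>)"

definition dirichlet_eigenpair :: "'a::euclidean_space set \<Rightarrow> real \<Rightarrow> ('a \<Rightarrow> real) \<Rightarrow> bool" where
  "dirichlet_eigenpair \<Omega> lam \<phi> \<longleftrightarrow>
     continuous_on (closure \<Omega>) \<phi> \<and> (\<forall>x\<in>frontier \<Omega>. \<phi> x = 0) \<and>
     (\<exists>D :: 'a \<Rightarrow> 'a \<Rightarrow> real. \<exists>D2 :: 'a \<Rightarrow> 'a \<Rightarrow> 'a \<Rightarrow> real.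
        (\<forall>x\<in>\<Omega>. (\<phi> has_derivative (\<lambda>h. \<Sum>b\<in>Basis. (h \<bullet> b) * D b x)) (at x)) \<and>
        (\<forall>b\<in>Basis. \<forall>x\<in>\<Omega>. (D b has_derivative (\<lambda>h. \<Sum>c\<in>Basis. (h \<bullet> c) * D2 b c x)) (at x)) \<and>
        (\<forall>b\<in>Basis. \<forall>c\<in>Basis. continuous_on \<Omega> (D2 b c)) \<and>
        (\<forall>x\<in>\<Omega>. - (\<Sum>b\<in>Basis. D2 b b x) = lam * \<phi> x))"

definition L2_series_limit :: "'a::euclidean_space set \<Rightarrow> (nat \<Rightarrow> 'a \<Rightarrow> real) \<Rightarrow> (nat \<Rightarrow> real)
      \<Rightarrow> ('a \<Rightarrow> real) \<Rightarrow> bool" where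
  "L2_series_limit \<Omega> \<phi> a w \<longleftrightarrow> memLp \<Omega> 2 w \<and>
     ((\<lambda>N. \<integral>x. ((\<Sum>i<N. a i * \<phi> i x) - w x)\<^sup>2 \<partial>lebesgue_on \<Omega>) \<longlonglongrightarrow> 0)"

(* {\<lambda>_i, \<phi>_i} is the L^2-orthonormal (complete) system of Dirichlet eigenpairs, nondecreasing;
   indices start at 0 instead of 1 *)
definition dirichlet_eigensystem :: "'a::euclidean_space set \<Rightarrow> (nat \<Rightarrow> real) \<Rightarrow> (nat \<Rightarrow> 'a \<Rightarrow> real) \<Rightarrow> bool" where
  "dirichlet_eigensystem \<Omega> lam \<phi> \<longleftrightarrow>
     mono lam \<and>
     (\<forall>i. dirichlet_eigenpair \<Omega> (lam i) (\<phi> i) \<and> memLp \<Omega> 2 (\<phi> i)) \<and>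
     (\<forall>i j. L2int \<Omega> (\<phi> i) (\<phi> j) = (if i = j then 1 else 0)) \<and>
     (\<forall>u. memLp \<Omega> 2 u \<longrightarrow> L2_series_limit \<Omega> \<phi> (\<lambda>i. L2int \<Omega> u (\<phi> i)) u)"

definition H12_0 :: "'a::euclidean_space set \<Rightarrow> (nat \<Rightarrow> real) \<Rightarrow> (nat \<Rightarrow> 'a \<Rightarrow> real) \<Rightarrow> ('a \<Rightarrow> real) set" where
  "H12_0 \<Omega> lam \<phi> = {u. memLp \<Omega> 2 u \<and>
      summable (\<lambda>i. (L2int \<Omega> u (\<phi> i))\<^sup>2 * sqrt (lam i))}"

(* (-\<Delta>+m^2)^{1/4} u = \<Sum> c_i (\<lambda>_i+m^2)^{1/4} \<phi>_i, an L^2 limit (a representative) *)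
definition quarter_op :: "'a::euclidean_space set \<Rightarrow> (nat \<Rightarrow> real) \<Rightarrow> (nat \<Rightarrow> 'a \<Rightarrow> real) \<Rightarrow> real
      \<Rightarrow> ('a \<Rightarrow> real) \<Rightarrow> ('a \<Rightarrow> real)" where
  "quarter_op \<Omega> lam \<phi> m u = (SOME w. L2_series_limit \<Omega> \<phi>
      (\<lambda>i. L2int \<Omega> u (\<phi> i) * (lam i + m\<^sup>2) powr (1/4)) w)"

definition weak_solution_P :: "'a::euclidean_space set \<Rightarrow> (nat \<Rightarrow> real) \<Rightarrow> (nat \<Rightarrow> 'a \<Rightarrow> real) \<Rightarrow> real
      \<Rightarrow> real \<Rightarrow> ('a \<Rightarrow> real) \<Rightarrow> bool" where
  "weak_solution_P \<Omega> lam \<phi> m p u \<longleftrightarrow>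
     u \<in> H12_0 \<Omega> lam \<phi> \<and>
     memLp \<Omega> (2 * real DIM('a) / (real DIM('a) + 1)) (\<lambda>x. \<bar>u x\<bar> powr (p - 1) * u x) \<and>
     (\<forall>v \<in> H12_0 \<Omega> lam \<phi>.
        (\<integral>x. quarter_op \<Omega> lam \<phi> m u x * quarter_op \<Omega> lam \<phi> m v x - m * u x * v x
              - \<bar>u x\<bar> powr (p - 1) * u x * v x \<partial>lebesgue_on \<Omega>) = 0)"

end

theory Submission
  imports Defs
begin

text \<open>
  Write \<open>S = sqrt (- \<Delta> + m\<^sup>2)\<close> and let \<open>f = m u + |u|\<^bsup>p-1\<^esup> u\<close>, so that \<open>S u = f\<close>.  Since \<open>u\<close> and
  hence \<open>f\<close> is bounded, \<open>u\<close> lies in the spectral space \<open>H\<^sup>1\<^sub>0\<close>.  No boundary regularity is available, so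
  the Pohozaev identity is replaced by the variational inequality obtained by comparing \<open>u\<close> with
  \<open>u\<^sub>k(x) = u(k x)\<close> for \<open>k > 1\<close>, which by star-shapedness still vanishes outside \<open>\<Omega>\<close>.  Convexity of the
  form of \<open>S\<close> gives \<open>\<langle>S u\<^sub>k, u\<^sub>k\<rangle> - \<langle>S u, u\<rangle> \<ge> 2 \<langle>f, u\<^sub>k - u\<rangle>\<close>.  On the right,
  \<open>\<langle>f, u\<^sub>k - u\<rangle> \<ge> \<integral> (F(u\<^sub>k) - F(u)) - C (ln k)\<^sup>2\<close> for the primitive \<open>F\<close> of the nonlinearity, because
  \<open>u\<close> is in \<open>H\<^sup>1\<^sub>0\<close>.  On the left, operator monotonicity of the square root bounds \<open>\<langle>S u\<^sub>k, u\<^sub>k\<rangle>\<close> by the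
  form of the square root on the smaller domain, that is by
  \<open>k\<^bsup>-n\<^esup> \<Sum> c\<^sub>i\<^sup>2 sqrt (k\<^sup>2 \<lambda>\<^sub>i + m\<^sup>2)\<close>, where the \<open>c\<^sub>i\<close> are the coefficients of \<open>u\<close>.  Dividing by \<open>ln k\<close> and
  letting \<open>k \<rightarrow> 1\<close> gives, with \<open>s\<^sub>i = sqrt (\<lambda>\<^sub>i + m\<^sup>2)\<close>,
  \<open>(n - 1) \<Sum> s\<^sub>i c\<^sub>i\<^sup>2 + m\<^sup>2 \<Sum> c\<^sub>i\<^sup>2 / s\<^sub>i \<le> 2 n \<integral> F(u)\<close>.  For \<open>p \<ge> (n + 2) / (n - 2)\<close> this becomes
  \<open>\<Sum> c\<^sub>i\<^sup>2 (s\<^sub>i - m)\<^sup>2 / s\<^sub>i \<le> 0\<close>, and \<open>s\<^sub>i > m\<close>.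
\<close>

section \<open>Square-integrable functions\<close>

text \<open>The obstacle throughout is the boundary: an eigenfunction is known to be continuous and
  zero there, but nothing is known about its gradient. Every integration by parts is therefore done
  with a C2 truncation that is zero wherever the function is at most \<open>e\<close> in absolute
  value and so has compact support inside the domain. Its slope lies between 0 and 1, which makes
  its Dirichlet energy at most its pairing with minus the Laplacian of the original function, and
  that pairing converges as \<open>e\<close> tends to 0 without any gradient bound. Factors
  \<open>k < 1\<close> would push the support out of the domain, so only a one-sided derivative at
  \<open>k = 1\<close> is available and the outcome is an inequality. This is enough because its
  direction matches the sign of the final sum of squares. Operator monotonicity is obtained on
  finite sums only. A resolvent form is a minimum over decompositions, so it can be compared between
  the two domains by inserting a competitor; integration over the resolvent parameter then gives
  square roots. The number of coefficients tested and the number of modes of \<open>u\<close> are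
  independent, and each goes to infinity by an elementary limit.\<close>

definition sq_integrable :: "'a measure \<Rightarrow> ('a \<Rightarrow> real) \<Rightarrow> bool" where
  "sq_integrable M f \<longleftrightarrow> f \<in> borel_measurable M \<and> integrable M (\<lambda>x. (f x)\<^sup>2)"

definition ip :: "'a measure \<Rightarrow> ('a \<Rightarrow> real) \<Rightarrow> ('a \<Rightarrow> real) \<Rightarrow> real" where
  "ip M f g = (\<integral>x. f x * g x \<partial>M)"

definition l2norm :: "'a measure \<Rightarrow> ('a \<Rightarrow> real) \<Rightarrow> real" where
  "l2norm M f = sqrt (ip M f f)"

lemma sq_integrable_measurable [measurable_dest]: "sq_integrable M f \<Longrightarrow> f \<in> borel_measurable M"
  by (simp add: sq_integrable_def)

lemma sq_integrable_mult:
  assumes "sq_integrable M f" "sq_integrable M g"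
  shows "integrable M (\<lambda>x. f x * g x)"
proof (rule Bochner_Integration.integrable_bound)
  show "integrable M (\<lambda>x. (f x)\<^sup>2 + (g x)\<^sup>2)"
    using assms by (simp add: sq_integrable_def)
  show "(\<lambda>x. f x * g x) \<in> borel_measurable M"
    using assms by (auto simp: sq_integrable_def)
  have "\<bar>a * b\<bar> \<le> a\<^sup>2 + b\<^sup>2" for a b :: real
  proof -
    have "2 * (\<bar>a\<bar> * \<bar>b\<bar>) \<le> a\<^sup>2 + b\<^sup>2"
      using sum_squares_bound[of "\<bar>a\<bar>" "\<bar>b\<bar>"] by (simp add: mult.assoc)
    moreover have "0 \<le> \<bar>a\<bar> * \<bar>b\<bar>" by simp
    ultimately show ?thesis unfolding abs_mult by linarith
  qed
  then show "AE x in M. norm (f x * g x) \<le> norm ((f x)\<^sup>2 + (g x)\<^sup>2)"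
    by auto
qed

lemma sq_integrable_add:
  assumes "sq_integrable M f" "sq_integrable M g"
  shows "sq_integrable M (\<lambda>x. f x + g x)"
proof -
  have "integrable M (\<lambda>x. (f x)\<^sup>2 + (g x)\<^sup>2 + 2 * (f x * g x))"
    using assms sq_integrable_mult[OF assms] unfolding sq_integrable_def
    by (intro Bochner_Integration.integrable_add) auto
  then show ?thesis
    using assms unfolding sq_integrable_def by (auto simp: power2_sum mult.assoc)
qed

lemma sq_integrable_cmult:
  assumes "sq_integrable M f"
  shows "sq_integrable M (\<lambda>x. c * f x)"
  using assms unfolding sq_integrable_def by (auto simp: power_mult_distrib)

lemma sq_integrable_diff:
  assumes "sq_integrable M f" "sq_integrable M g"
  shows "sq_integrable M (\<lambda>x. f x - g x)"
  using sq_integrable_add[OF assms(1) sq_integrable_cmult[OF assms(2), of "-1"]] by simp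

lemma sq_integrable_zero [simp]: "sq_integrable M (\<lambda>x. 0)"
  by (simp add: sq_integrable_def)

lemma sq_integrable_sum:
  assumes "\<And>i. i \<in> I \<Longrightarrow> sq_integrable M (f i)"
  shows "sq_integrable M (\<lambda>x. \<Sum>i\<in>I. f i x)"
  using assms by (induction I rule: infinite_finite_induct) (simp_all add: sq_integrable_add)

lemma ip_commute: "ip M f g = ip M g f"
  by (simp add: ip_def mult.commute)

lemma ip_add_left:
  assumes "sq_integrable M f" "sq_integrable M g" "sq_integrable M h"
  shows "ip M (\<lambda>x. f x + g x) h = ip M f h + ip M g h"
  using assms by (simp add: ip_def distrib_right sq_integrable_mult)

lemma ip_diff_left:
  assumes "sq_integrable M f" "sq_integrable M g" "sq_integrable M h"
  shows "ip M (\<lambda>x. f x - g x) h = ip M f h - ip M g h"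
  using assms by (simp add: ip_def left_diff_distrib sq_integrable_mult)

lemma ip_cmult_left: "ip M (\<lambda>x. c * f x) h = c * ip M f h"
  by (simp add: ip_def mult.assoc)

lemma ip_sum_left:
  assumes "\<And>i. i \<in> I \<Longrightarrow> sq_integrable M (f i)" "sq_integrable M h"
  shows "ip M (\<lambda>x. \<Sum>i\<in>I. f i x) h = (\<Sum>i\<in>I. ip M (f i) h)"
  using assms unfolding ip_def sum_distrib_right
  by (intro Bochner_Integration.integral_sum sq_integrable_mult) auto

lemma ip_nonneg: "0 \<le> ip M f f"
  by (simp add: ip_def)

lemma l2norm_nonneg [simp]: "0 \<le> l2norm M f"
  by (simp add: l2norm_def ip_nonneg)

lemma l2norm_power2: "(l2norm M f)\<^sup>2 = ip M f f"
  by (simp add: l2norm_def ip_nonneg)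

lemma ip_power2_le:
  assumes "sq_integrable M f" "sq_integrable M g"
  shows "(ip M f g)\<^sup>2 \<le> ip M f f * ip M g g"
proof -
  have quad: "0 \<le> ip M f f * s\<^sup>2 - 2 * s * ip M f g + ip M g g" for s
  proof -
    have "0 \<le> (\<integral>x. (s * f x - g x)\<^sup>2 \<partial>M)" by simp
    also have "\<dots> = (\<integral>x. s\<^sup>2 * (f x * f x) - 2 * s * (f x * g x) + g x * g x \<partial>M)"
      by (rule arg_cong[where f="integral\<^sup>L M"]) (auto simp: power2_eq_square algebra_simps)
    also have "\<dots> = s\<^sup>2 * ip M f f - 2 * s * ip M f g + ip M g g"
      using assms by (simp add: ip_def sq_integrable_mult)
    finally show ?thesis by (simp add: mult.commute)
  qed
  show ?thesis
  proof (cases "ip M f f = 0")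
    case True
    have "ip M f g = 0"
    proof (rule ccontr)
      assume "ip M f g \<noteq> 0"
      \<comment> \<open>This parameter turns the nonnegative quadratic expression into -1.\<close>
      then show False
        using quad[of "(ip M g g + 1) / (2 * ip M f g)"] True by (simp add: field_simps)
    qed
    with True show ?thesis by simp
  next
    case False
    then have pos: "ip M f f > 0" using ip_nonneg[of M f] by simp
    have "ip M f f * (ip M f g / ip M f f)\<^sup>2 - 2 * (ip M f g / ip M f f) * ip M f g =
        - (ip M f g)\<^sup>2 / ip M f f"
      using pos by (simp add: power2_eq_square field_simps)
    then have "(ip M f g)\<^sup>2 / ip M f f \<le> ip M g g"
      using quad[of "ip M f g / ip M f f"] by linarith
    then show ?thesis using pos by (simp add: divide_le_eq mult.commute)
  qed
qed

lemma abs_ip_le: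
  assumes "sq_integrable M f" "sq_integrable M g"
  shows "\<bar>ip M f g\<bar> \<le> l2norm M f * l2norm M g"
  using real_sqrt_le_mono[OF ip_power2_le[OF assms]]
  by (simp add: l2norm_def real_sqrt_mult)

lemma l2norm_triangle:
  assumes "sq_integrable M f" "sq_integrable M g"
  shows "l2norm M (\<lambda>x. f x + g x) \<le> l2norm M f + l2norm M g"
proof (rule power2_le_imp_le)
  have "(l2norm M (\<lambda>x. f x + g x))\<^sup>2 = ip M f f + 2 * ip M f g + ip M g g"
  proof -
    have "(l2norm M (\<lambda>x. f x + g x))\<^sup>2 = (\<integral>x. f x * f x + 2 * (f x * g x) + g x * g x \<partial>M)"
      unfolding l2norm_power2 ip_def by (simp add: algebra_simps)
    then show ?thesis
      using assms by (simp add: ip_def sq_integrable_mult)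
  qed
  also have "\<dots> \<le> (l2norm M f + l2norm M g)\<^sup>2"
    using abs_ip_le[OF assms] by (simp add: power2_sum l2norm_power2)
  finally show "(l2norm M (\<lambda>x. f x + g x))\<^sup>2 \<le> (l2norm M f + l2norm M g)\<^sup>2" .
qed simp

lemma l2norm_minus_commute: "l2norm M (\<lambda>x. f x - g x) = l2norm M (\<lambda>x. g x - f x)"
  unfolding l2norm_def ip_def by (simp add: algebra_simps)

lemma l2norm_triangle_diff:
  assumes "sq_integrable M f" "sq_integrable M g" "sq_integrable M h"
  shows "l2norm M (\<lambda>x. f x - h x) \<le> l2norm M (\<lambda>x. f x - g x) + l2norm M (\<lambda>x. g x - h x)"
  using l2norm_triangle[OF sq_integrable_diff[OF assms(1,2)] sq_integrable_diff[OF assms(2,3)]]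
  by simp

lemma tendsto_ip:
  assumes "\<And>n. sq_integrable M (f n)" "sq_integrable M F" "\<And>n. sq_integrable M (g n)" "sq_integrable M G"
    and "(\<lambda>n. l2norm M (\<lambda>x. f n x - F x)) \<longlonglongrightarrow> 0"
    and "(\<lambda>n. l2norm M (\<lambda>x. g n x - G x)) \<longlonglongrightarrow> 0"
  shows "(\<lambda>n. ip M (f n) (g n)) \<longlonglongrightarrow> ip M F G"
proof -
  let ?d = "\<lambda>n. l2norm M (\<lambda>x. f n x - F x)" and ?e = "\<lambda>n. l2norm M (\<lambda>x. g n x - G x)"
  have bound: "norm (ip M (f n) (g n) - ip M F G) \<le> ?d n * ?e n + ?d n * l2norm M G + l2norm M F * ?e n" for n
  proof -
    have "ip M (f n) (g n) - ip M F G =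
        ip M (\<lambda>x. f n x - F x) (\<lambda>x. g n x - G x) + ip M (\<lambda>x. f n x - F x) G + ip M F (\<lambda>x. g n x - G x)"
      using assms(1-4)
      by (simp add: ip_diff_left ip_commute[of M _ "\<lambda>x. g n x - G x"] sq_integrable_diff
         ip_commute[of M "g n"] ip_commute[of M G])
    then show ?thesis
      using abs_ip_le[of M "\<lambda>x. f n x - F x" "\<lambda>x. g n x - G x"] abs_ip_le[of M "\<lambda>x. f n x - F x" G]
        abs_ip_le[of M F "\<lambda>x. g n x - G x"] assms(1-4) by (simp add: sq_integrable_diff)
  qed
  have "(\<lambda>n. ?d n * ?e n + ?d n * l2norm M G + l2norm M F * ?e n) \<longlonglongrightarrow> 0 * 0 + 0 * l2norm M G + l2norm M F * 0"
    by (intro tendsto_intros assms)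
  then have "(\<lambda>n. ip M (f n) (g n) - ip M F G) \<longlonglongrightarrow> 0"
    by (intro Lim_null_comparison[OF always_eventually[OF allI[OF bound]]]) simp
  then show ?thesis by (simp add: LIM_zero_iff)
qed

lemma tendsto_ip_left:
  assumes "\<And>n. sq_integrable M (f n)" "sq_integrable M F" "sq_integrable M G"
    and "(\<lambda>n. l2norm M (\<lambda>x. f n x - F x)) \<longlonglongrightarrow> 0"
  shows "(\<lambda>n. ip M (f n) G) \<longlonglongrightarrow> ip M F G"
  using tendsto_ip[OF assms(1,2) assms(3) assms(3) assms(4)] by (simp add: l2norm_def ip_def)

text \<open>The subsequence is chosen so sparse that its increments \<open>d k\<close> satisfy
  \<open>\<integral> \<Sum>k. 2 ^ k * (d k)\<^sup>2 < \<infinity>\<close>; the elementary bound \<open>\<bar>d\<bar> \<le> 2 ^ k * d\<^sup>2 + (1/2) ^ k\<close> then gives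
  pointwise convergence almost everywhere.\<close>

lemma l2_complete:
  fixes S :: "nat \<Rightarrow> 'a \<Rightarrow> real"
  assumes S: "\<And>n. sq_integrable M (S n)"
    and cauchy: "\<And>e. e > 0 \<Longrightarrow> \<exists>N. \<forall>m\<ge>N. \<forall>n\<ge>N. ip M (\<lambda>x. S m x - S n x) (\<lambda>x. S m x - S n x) \<le> e"
  shows "\<exists>w. sq_integrable M w \<and> (\<lambda>n. ip M (\<lambda>x. S n x - w x) (\<lambda>x. S n x - w x)) \<longlonglongrightarrow> 0"
proof -
  note [measurable] = sq_integrable_measurable[OF S]
  define q where "q m n = ip M (\<lambda>x. S m x - S n x) (\<lambda>x. S m x - S n x)" for m n
  have qint: "integrable M (\<lambda>x. (S m x - S n x)\<^sup>2)" for m n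
    using sq_integrable_diff[OF S S] by (simp add: sq_integrable_def)
  have "\<forall>k. \<exists>N. \<forall>m\<ge>N. \<forall>n\<ge>N. q m n \<le> (1/4) ^ k"
    unfolding q_def using cauchy by simp
  then obtain N0 where N0: "\<And>k m n. m \<ge> N0 k \<Longrightarrow> n \<ge> N0 k \<Longrightarrow> q m n \<le> (1/4) ^ k"
    by metis
  \<comment> \<open>The sum makes the indices monotone and at least \<open>N0 k\<close>; the summand
    \<open>k\<close> makes them tend to infinity.\<close>
  define N where "N k = (\<Sum>i\<le>k. N0 i) + k" for k
  have N_ge: "N k \<ge> N0 k" for k
    unfolding N_def by (intro trans_le_add1 member_le_sum) auto
  have N_mono: "N k \<le> N (Suc k)" for k by (simp add: N_def)
  have N_ge_id: "k \<le> N k" for k by (simp add: N_def)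
  define d where "d k x = S (N (Suc k)) x - S (N k) x" for k x
  have [measurable]: "d k \<in> borel_measurable M" for k unfolding d_def by measurable
  have dint: "integrable M (\<lambda>x. 2 ^ k * (d k x)\<^sup>2)" for k
    unfolding d_def by (intro integrable_mult_right qint)
  have dle: "(\<integral>x. 2 ^ k * (d k x)\<^sup>2 \<partial>M) \<le> (1/2) ^ k" for k
  proof -
    have "(\<integral>x. 2 ^ k * (d k x)\<^sup>2 \<partial>M) = 2 ^ k * q (N (Suc k)) (N k)"
      by (simp add: q_def ip_def d_def power2_eq_square)
    also have "\<dots> \<le> 2 ^ k * (1/4) ^ k"
      using N0[of k "N (Suc k)" "N k"] N_ge[of k] N_mono[of k] by simp
    also have "\<dots> = (1/2) ^ k" by (simp flip: power_mult_distrib)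
    finally show ?thesis .
  qed
  have "(\<integral>\<^sup>+x. (\<Sum>k. ennreal (2 ^ k * (d k x)\<^sup>2)) \<partial>M) = (\<Sum>k. \<integral>\<^sup>+x. ennreal (2 ^ k * (d k x)\<^sup>2) \<partial>M)"
    by (intro nn_integral_suminf) measurable
  also have "\<dots> = (\<Sum>k. ennreal (\<integral>x. 2 ^ k * (d k x)\<^sup>2 \<partial>M))"
    by (intro arg_cong[where f=suminf] ext nn_integral_eq_integral dint) auto
  also have "\<dots> \<le> (\<Sum>k. ennreal ((1/2) ^ k))"
    by (intro suminf_le ennreal_leI dle) auto
  also have "\<dots> = ennreal (\<Sum>k. (1/2) ^ k)"
    by (intro suminf_ennreal2 summable_geometric) auto
  also have "\<dots> < \<infinity>" by simp
  finally have "AE x in M. (\<Sum>k. ennreal (2 ^ k * (d k x)\<^sup>2)) \<noteq> \<infinity>"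
    by (intro nn_integral_PInf_AE) auto
  then have conv: "AE x in M. convergent (\<lambda>k. S (N k) x)"
  proof eventually_elim
    case (elim x)
    have sum2: "summable (\<lambda>k. 2 ^ k * (d k x)\<^sup>2)"
      by (rule summable_suminf_not_top) (use elim in auto)
    have bound: "norm (d k x) \<le> 2 ^ k * (d k x)\<^sup>2 + (1/2) ^ k" for k
    proof -
      have "0 \<le> (2 ^ k * \<bar>d k x\<bar> - 1)\<^sup>2" by simp
      also have "\<dots> = 2 ^ k * (2 ^ k * (d k x)\<^sup>2 - 2 * \<bar>d k x\<bar> + (1/2) ^ k)"
        by (simp add: power2_eq_square algebra_simps flip: power_mult_distrib)
      finally have "0 \<le> 2 ^ k * (d k x)\<^sup>2 - 2 * \<bar>d k x\<bar> + (1/2) ^ k"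
        using zero_le_mult_iff[of "2 ^ k :: real"] by (metis not_le zero_less_power zero_less_numeral)
      then show ?thesis by simp
    qed
    have "summable (\<lambda>k. d k x)"
      by (rule summable_comparison_test'[OF summable_add[OF sum2 summable_geometric[of "1/2"]]])
         (use bound in auto)
    then have "convergent (\<lambda>n. (\<Sum>k<n. d k x) + S (N 0) x)"
      by (intro convergent_add convergent_const) (simp add: summable_iff_convergent)
    moreover have "(\<lambda>n. (\<Sum>k<n. d k x) + S (N 0) x) = (\<lambda>n. S (N n) x)"
      unfolding d_def sum_lessThan_telescope[of "\<lambda>k. S (N k) x"] by simp
    ultimately show ?case by simp
  qed
  define w where "w x = lim (\<lambda>k. S (N k) x)" for x
  have [measurable]: "w \<in> borel_measurable M" unfolding w_def by (rule borel_measurable_lim_metric) measurable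
  have wlim: "AE x in M. (\<lambda>k. S (N k) x) \<longlonglongrightarrow> w x"
    using conv by eventually_elim (simp add: w_def convergent_LIMSEQ_iff)
  \<comment> \<open>Fatou along the subsequence: a bound on the distances from \<open>S n\<close> to
    all late terms passes to the distance from \<open>S n\<close> to the limit.\<close>
  have est: "(\<integral>\<^sup>+x. ennreal ((S n x - w x)\<^sup>2) \<partial>M) \<le> ennreal e"
    if e: "\<And>m. m \<ge> n0 \<Longrightarrow> q n m \<le> e" for n e n0
  proof -
    have "(\<integral>\<^sup>+x. ennreal ((S n x - w x)\<^sup>2) \<partial>M) = (\<integral>\<^sup>+x. liminf (\<lambda>k. ennreal ((S n x - S (N k) x)\<^sup>2)) \<partial>M)"
    proof (rule nn_integral_cong_AE, use wlim in eventually_elim)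
      case (elim x)
      have "(\<lambda>k. ennreal ((S n x - S (N k) x)\<^sup>2)) \<longlonglongrightarrow> ennreal ((S n x - w x)\<^sup>2)"
        by (intro tendsto_ennrealI tendsto_intros elim)
      from lim_imp_Liminf[OF _ this] show ?case by simp
    qed
    also have "\<dots> \<le> liminf (\<lambda>k. \<integral>\<^sup>+x. ennreal ((S n x - S (N k) x)\<^sup>2) \<partial>M)"
      by (rule nn_integral_liminf) measurable
    also have "\<dots> = liminf (\<lambda>k. ennreal (q n (N k)))"
      by (intro arg_cong[where f=liminf] ext, subst nn_integral_eq_integral[OF qint])
         (auto simp: q_def ip_def power2_eq_square)
    also have "\<dots> \<le> ennreal e"
    proof (rule Liminf_le)
      show "\<forall>\<^sub>F k in sequentially. ennreal (q n (N k)) \<le> ennreal e"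
        using eventually_ge_at_top[of n0]
        by eventually_elim (intro ennreal_leI e order.trans[OF _ N_ge_id])
    qed simp
    finally show ?thesis .
  qed
  have diffint: "integrable M (\<lambda>x. (S n x - w x)\<^sup>2)" if "\<And>m. m \<ge> n0 \<Longrightarrow> q n m \<le> e" for n n0 e
  proof (rule integrableI_nonneg)
    show "(\<integral>\<^sup>+x. ennreal ((S n x - w x)\<^sup>2) \<partial>M) < \<infinity>"
      using est[OF that] by (rule order_le_less_trans) auto
  qed auto
  have "sq_integrable M (\<lambda>x. S (N0 0) x - w x)"
    unfolding sq_integrable_def using diffint[of "N0 0" "N0 0" 1] N0[of 0 "N0 0"] by auto
  from sq_integrable_diff[OF S[of "N0 0"] this] have w: "sq_integrable M w" by simp
  have "(\<lambda>n. ip M (\<lambda>x. S n x - w x) (\<lambda>x. S n x - w x)) \<longlonglongrightarrow> 0"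
  proof (rule LIMSEQ_I)
    fix r :: real assume r: "r > 0"
    then obtain K where K: "\<And>m n. m \<ge> K \<Longrightarrow> n \<ge> K \<Longrightarrow> q m n \<le> r / 2"
      using cauchy[of "r/2"] unfolding q_def by auto
    have "norm (ip M (\<lambda>x. S n x - w x) (\<lambda>x. S n x - w x) - 0) < r" if "n \<ge> K" for n
    proof -
      have "ennreal (\<integral>x. (S n x - w x)\<^sup>2 \<partial>M) \<le> ennreal (r/2)"
        using est[of K n "r/2"] K that
        by (subst nn_integral_eq_integral[symmetric, OF diffint[of K n "r/2"]]) auto
      then have "(\<integral>x. (S n x - w x)\<^sup>2 \<partial>M) \<le> r / 2"
        using r by (subst (asm) ennreal_le_iff) auto
      then show ?thesis using r ip_nonneg[of M "\<lambda>x. S n x - w x"]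
        by (simp add: ip_def power2_eq_square)
    qed
    then show "\<exists>no. \<forall>n\<ge>no. norm (ip M (\<lambda>x. S n x - w x) (\<lambda>x. S n x - w x) - 0) < r" by blast
  qed
  with w show ?thesis by blast
qed

section \<open>Orthonormal systems\<close>

lemma ip_orthonormal_sum:
  assumes e: "\<And>i. sq_integrable M (e i)"
    and orth: "\<And>i j. ip M (e i) (e j) = (if i = j then 1 else 0)"
    and "finite A"
  shows "ip M (\<lambda>x. \<Sum>i\<in>A. a i * e i x) (\<lambda>x. \<Sum>i\<in>A. b i * e i x) = (\<Sum>i\<in>A. a i * b i)"
    and "ip M (\<lambda>x. \<Sum>i\<in>A. a i * e i x) (e j) = (if j \<in> A then a j else 0)"
proof -
  show 1: "ip M (\<lambda>x. \<Sum>i\<in>A. a i * e i x) (e j) = (if j \<in> A then a j else 0)" for j a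
    using assms(3) by (subst ip_sum_left[OF sq_integrable_cmult[OF e] e])
      (auto simp: ip_cmult_left orth sum.delta if_distrib cong: if_cong)
  have "ip M (\<lambda>x. \<Sum>i\<in>A. a i * e i x) (\<lambda>x. \<Sum>i\<in>A. b i * e i x)
      = ip M (\<lambda>x. \<Sum>i\<in>A. b i * e i x) (\<lambda>x. \<Sum>i\<in>A. a i * e i x)" by (rule ip_commute)
  also have "\<dots> = (\<Sum>i\<in>A. b i * ip M (e i) (\<lambda>x. \<Sum>i\<in>A. a i * e i x))"
    by (subst ip_sum_left[OF sq_integrable_cmult[OF e]])
      (auto simp: ip_cmult_left intro!: sq_integrable_sum sq_integrable_cmult e)
  also have "\<dots> = (\<Sum>i\<in>A. a i * b i)"
    by (intro sum.cong refl) (subst ip_commute, simp add: 1)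
  finally show "ip M (\<lambda>x. \<Sum>i\<in>A. a i * e i x) (\<lambda>x. \<Sum>i\<in>A. b i * e i x) = (\<Sum>i\<in>A. a i * b i)" .
qed

text \<open>Existence of the sum is what makes the choice in \<open>quarter_op\<close> pick a
  genuine L2 limit. On differences of partial sums the squared norm is a block of the series of
  \<open>(a i)\<^sup>2\<close>, so completeness applies.\<close>

lemma riesz_fischer:
  assumes e: "\<And>i. sq_integrable M (e i)"
    and orth: "\<And>i j. ip M (e i) (e j) = (if i = j then 1 else 0)"
    and a: "summable (\<lambda>i. (a i)\<^sup>2)"
  shows "\<exists>w. sq_integrable M w \<and>
    (\<lambda>n. ip M (\<lambda>x. (\<Sum>i<n. a i * e i x) - w x) (\<lambda>x. (\<Sum>i<n. a i * e i x) - w x)) \<longlonglongrightarrow> 0"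
proof (rule l2_complete)
  define S where "S n x = (\<Sum>i<n. a i * e i x)" for n x
  show "sq_integrable M (\<lambda>x. \<Sum>i<n. a i * e i x)" for n
    by (intro sq_integrable_sum sq_integrable_cmult e)
  fix r :: real assume "r > 0"
  then obtain N where N: "\<And>m n. m \<ge> N \<Longrightarrow> norm (\<Sum>i\<in>{m..<n}. (a i)\<^sup>2) < r"
    using a unfolding summable_Cauchy by meson
  have *: "ip M (\<lambda>x. S m x - S n x) (\<lambda>x. S m x - S n x) \<le> r" if "N \<le> n" "n \<le> m" for m n
  proof -
    have "S m x - S n x = (\<Sum>i\<in>{n..<m}. a i * e i x)" for x
      using that unfolding S_def by (simp add: sum_diff_nat_ivl[of 0 n m, symmetric] lessThan_atLeast0)
    then have "ip M (\<lambda>x. S m x - S n x) (\<lambda>x. S m x - S n x) = (\<Sum>i\<in>{n..<m}. (a i)\<^sup>2)"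
      using e orth by (simp add: ip_orthonormal_sum power2_eq_square)
    then show ?thesis using N[OF that(1), of m] by (simp add: sum_nonneg)
  qed
  have sym: "ip M (\<lambda>x. S m x - S n x) (\<lambda>x. S m x - S n x) = ip M (\<lambda>x. S n x - S m x) (\<lambda>x. S n x - S m x)" for m n
    unfolding ip_def by (simp add: algebra_simps)
  have "ip M (\<lambda>x. S m x - S n x) (\<lambda>x. S m x - S n x) \<le> r" if "N \<le> n" "N \<le> m" for m n
    using *[of n m] *[of m n] that sym[of m n] by (cases "n \<le> m") auto
  then show "\<exists>N. \<forall>m\<ge>N. \<forall>n\<ge>N. ip M (\<lambda>x. (\<Sum>i<m. a i * e i x) - (\<Sum>i<n. a i * e i x))
      (\<lambda>x. (\<Sum>i<m. a i * e i x) - (\<Sum>i<n. a i * e i x)) \<le> r"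
    unfolding S_def by blast
qed

section \<open>A smooth truncation of the real line\<close>

text \<open>Gluing \<open>f\<close> on the right to the constant \<open>f 0\<close> on the left: the
  one-sided derivatives at 0 agree because \<open>f' 0 = 0\<close>.\<close>

lemma has_real_derivative_comp_max0:
  fixes f f' :: "real \<Rightarrow> real"
  assumes f: "\<And>y. (f has_real_derivative f' y) (at y)" and f'0: "f' 0 = 0"
  shows "((\<lambda>x. f (max 0 x)) has_real_derivative f' (max 0 x)) (at x)"
proof (cases x "0::real" rule: linorder_cases)
  case less
  have "((\<lambda>x. f 0) has_real_derivative 0) (at x)" by simp
  then have "((\<lambda>x. f (max 0 x)) has_real_derivative 0) (at x)"
    by (rule has_field_derivative_transform_within_open[of _ _ _ "{..<0}"]) (use less in auto)
  then show ?thesis using less f'0 by (simp add: max_def)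
next
  case greater
  have "((\<lambda>x. f (max 0 x)) has_real_derivative f' x) (at x)"
    by (rule has_field_derivative_transform_within_open[OF f, of "{0<..}"]) (use greater in auto)
  then show ?thesis using greater by (simp add: max_def)
next
  case equal
  have "((\<lambda>h. (f (0 + h) - f 0) / h) \<longlongrightarrow> 0) (at 0)"
    using f[of 0] f'0 by (simp add: DERIV_def)
  then have "((\<lambda>h. (f (max 0 h) - f 0) / h) \<longlongrightarrow> 0) (at 0)"
    by (rule Lim_transform_bound[rotated]) (auto simp: max_def intro!: always_eventually simp del: real_norm_def)
  then show ?thesis using equal f'0 by (simp add: DERIV_def)
qed

text \<open>The function \<open>y - arctan y\<close> is chosen because its slope
  \<open>y\<^sup>2 / (1 + y\<^sup>2)\<close> lies in [0, 1) and vanishes at 0 together with its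
  derivative. Gluing it to 0 on the negative half-line is thus C2, and it stays within bounded
  distance of \<open>max 0 x\<close>. The functions \<open>cut1\<close> and \<open>cut2\<close> are
  its first two derivatives.\<close>

definition cut0 :: "real \<Rightarrow> real" where
  "cut0 x = max 0 x - arctan (max 0 x)"
definition cut1 :: "real \<Rightarrow> real" where
  "cut1 x = (max 0 x)\<^sup>2 / (1 + (max 0 x)\<^sup>2)"
definition cut2 :: "real \<Rightarrow> real" where
  "cut2 x = 2 * max 0 x / (1 + (max 0 x)\<^sup>2)\<^sup>2"

lemma cut_nonpos: "x \<le> 0 \<Longrightarrow> cut0 x = 0" "x \<le> 0 \<Longrightarrow> cut1 x = 0" "x \<le> 0 \<Longrightarrow> cut2 x = 0"
  by (auto simp: cut0_def cut1_def cut2_def max_def)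

lemma DERIV_cut0: "(cut0 has_real_derivative cut1 x) (at x)"
proof -
  have "((\<lambda>x. x - arctan x) has_real_derivative y\<^sup>2 / (1 + y\<^sup>2)) (at y)" for y :: real
  proof -
    have "1 + y\<^sup>2 > 0" by (simp add: add_pos_nonneg)
    then show ?thesis
      by (auto intro!: derivative_eq_intros simp: field_simps)
  qed
  from has_real_derivative_comp_max0[of "\<lambda>x. x - arctan x" "\<lambda>y. y\<^sup>2 / (1 + y\<^sup>2)", OF this]
  show ?thesis by (simp add: cut0_def[abs_def] cut1_def)
qed

lemma DERIV_cut1: "(cut1 has_real_derivative cut2 x) (at x)"
proof -
  have "((\<lambda>x. x\<^sup>2 / (1 + x\<^sup>2)) has_real_derivative 2 * y / (1 + y\<^sup>2)\<^sup>2) (at y)" for y :: real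
  proof -
    have "1 + y\<^sup>2 > 0" by (simp add: add_pos_nonneg)
    then show ?thesis
      by (auto intro!: derivative_eq_intros simp: field_simps power2_eq_square)
  qed
  from has_real_derivative_comp_max0[of "\<lambda>x. x\<^sup>2 / (1 + x\<^sup>2)" "\<lambda>y. 2 * y / (1 + y\<^sup>2)\<^sup>2", OF this]
  show ?thesis by (simp add: cut1_def[abs_def] cut2_def)
qed

lemma continuous_cut2: "continuous_on A cut2"
proof -
  have "1 + (max 0 x)\<^sup>2 > 0" for x :: real by (rule add_pos_nonneg) auto
  then show ?thesis
    unfolding cut2_def by (intro continuous_intros) (metis less_irrefl power_not_zero)
qed

lemma cut1_bounds: "0 \<le> cut1 x" "cut1 x \<le> 1"
proof -
  have "1 + (max 0 x)\<^sup>2 > 0" by (rule add_pos_nonneg) auto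
  then show "0 \<le> cut1 x" "cut1 x \<le> 1" by (simp_all add: cut1_def divide_le_eq_1_pos)
qed

lemma cut0_bounds: "0 \<le> cut0 x" "max 0 x - 2 \<le> cut0 x" "cut0 x \<le> max 0 x"
proof -
  have "arctan y \<le> 2" for y using arctan_ubound[of y] pi_half_less_two by linarith
  moreover have "arctan y \<le> y" if "0 \<le> y" for y
    using that arctan_le_self by blast
  moreover have "0 \<le> arctan y" if "0 \<le> y" for y using that by simp
  ultimately show "0 \<le> cut0 x" "max 0 x - 2 \<le> cut0 x" "cut0 x \<le> max 0 x"
    by (auto simp: cut0_def)
qed

text \<open>An odd C2 soft threshold with dead zone from \<open>-e\<close> to \<open>e\<close>.
  Composed with a continuous function that vanishes outside a bounded open set, it has compact
  support in that set.\<close>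

definition trunc :: "real \<Rightarrow> real \<Rightarrow> real" where
  "trunc e s = e * (cut0 (s / e - 1) - cut0 (- s / e - 1))"
definition trunc' :: "real \<Rightarrow> real \<Rightarrow> real" where
  "trunc' e s = cut1 (s / e - 1) + cut1 (- s / e - 1)"
definition trunc'' :: "real \<Rightarrow> real \<Rightarrow> real" where
  "trunc'' e s = (cut2 (s / e - 1) - cut2 (- s / e - 1)) / e"

lemma trunc_eq_0:
  assumes "e > 0" "\<bar>s\<bar> \<le> e"
  shows "trunc e s = 0" "trunc' e s = 0" "trunc'' e s = 0"
proof -
  have "s / e - 1 \<le> 0" "- s / e - 1 \<le> 0"
    using assms by (auto simp: field_simps)
  then show "trunc e s = 0" "trunc' e s = 0" "trunc'' e s = 0"
    by (simp_all add: trunc_def trunc'_def trunc''_def cut_nonpos)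
qed

lemma DERIV_trunc: "e > 0 \<Longrightarrow> (trunc e has_real_derivative trunc' e s) (at s)"
  unfolding trunc_def[abs_def] trunc'_def
  by (auto intro!: derivative_eq_intros DERIV_chain2[OF DERIV_cut0] simp: field_simps)

lemma DERIV_trunc': "e > 0 \<Longrightarrow> (trunc' e has_real_derivative trunc'' e s) (at s)"
  unfolding trunc'_def[abs_def] trunc''_def
  by (auto intro!: derivative_eq_intros DERIV_chain2[OF DERIV_cut1] simp: field_simps)

lemma continuous_trunc: "e > 0 \<Longrightarrow> continuous_on A (trunc e)"
  by (meson DERIV_trunc DERIV_isCont continuous_at_imp_continuous_on)

lemma continuous_trunc': "e > 0 \<Longrightarrow> continuous_on A (trunc' e)"
  by (meson DERIV_trunc' DERIV_isCont continuous_at_imp_continuous_on)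

lemma continuous_trunc'': "e > 0 \<Longrightarrow> continuous_on A (trunc'' e)"
  unfolding trunc''_def[abs_def]
  by (intro continuous_intros continuous_on_compose2[OF continuous_cut2[of UNIV]]) auto

lemma trunc'_bounds:
  assumes "e > 0"
  shows "0 \<le> trunc' e s" "trunc' e s \<le> 1"
proof -
  show "0 \<le> trunc' e s" by (simp add: trunc'_def cut1_bounds)
  show "trunc' e s \<le> 1"
  proof (cases "s \<ge> 0")
    case True
    then have "- s / e - 1 \<le> 0" using assms by (auto simp: field_simps)
    then show ?thesis by (simp add: trunc'_def cut1_bounds cut_nonpos)
  next
    case False
    then have "s / e - 1 \<le> 0" using assms by (auto simp: field_simps)
    then show ?thesis by (simp add: trunc'_def cut1_bounds cut_nonpos)
  qed
qed

text \<open>Of the factor 3, one unit comes from the shift by 1 that creates the dead zone and two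
  from \<open>arctan y \<le> 2\<close>.\<close>

lemma trunc_approx:
  assumes "e > 0"
  shows "\<bar>trunc e s - s\<bar> \<le> 3 * e"
proof -
  have 1: "\<bar>e * cut0 (r / e - 1) - r\<bar> \<le> 3 * e" if "r \<ge> 0" for r
  proof -
    let ?c = "cut0 (r / e - 1)"
    have "r / e - 1 - 2 \<le> ?c" "?c \<le> max 0 (r / e - 1)"
      using cut0_bounds[of "r / e - 1"] by auto
    moreover have "max 0 (r / e - 1) \<le> r / e" using that assms by simp
    ultimately have "r / e - 3 \<le> ?c" "?c \<le> r / e" by linarith+
    then have "r / e \<le> ?c + 3" "?c \<le> r / e" by linarith+
    then have "r \<le> (?c + 3) * e" "?c * e \<le> r"
      using assms by (simp_all add: pos_divide_le_eq pos_le_divide_eq)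
    then have "r \<le> e * ?c + 3 * e" "e * ?c \<le> r" by (simp_all add: algebra_simps)
    then show ?thesis using assms by linarith
  qed
  show ?thesis
  proof (cases "s \<ge> 0")
    case True
    then have "- s / e - 1 \<le> 0" using assms by (auto simp: field_simps)
    then show ?thesis using 1[OF True] by (simp add: trunc_def cut_nonpos)
  next
    case False
    then have "s / e - 1 \<le> 0" using assms by (auto simp: field_simps)
    then have "trunc e s - s = - (e * cut0 ((-s) / e - 1) - (-s))"
      by (simp add: trunc_def cut_nonpos)
    then show ?thesis using 1[of "-s"] False by simp
  qed
qed

lemma trunc_0 [simp]: "e > 0 \<Longrightarrow> trunc e 0 = 0" "e > 0 \<Longrightarrow> trunc' e 0 = 0" "e > 0 \<Longrightarrow> trunc'' e 0 = 0"
  by (auto intro: trunc_eq_0)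

lemma abs_trunc_le: assumes "e > 0" shows "\<bar>trunc e s\<bar> \<le> \<bar>s\<bar>"
proof -
  have "\<bar>trunc e s - trunc e 0\<bar> \<le> 1 * \<bar>s - 0\<bar>"
    by (rule field_differentiable_bound[of UNIV "trunc e" "trunc' e" 1, unfolded real_norm_def])
      (use assms trunc'_bounds in \<open>auto simp: DERIV_trunc\<close>)
  then show ?thesis using assms by simp
qed

lemma tendsto_trunc: "(\<lambda>n. trunc (1 / real (Suc n)) s) \<longlonglongrightarrow> s"
proof (rule LIM_zero_cancel, rule Lim_null_comparison)
  show "\<forall>\<^sub>F n in sequentially. norm (trunc (1 / real (Suc n)) s - s) \<le> 3 * (1 / real (Suc n))"
    unfolding real_norm_def by (intro always_eventually allI trunc_approx) simp
  show "(\<lambda>n. 3 * (1 / real (Suc n))) \<longlonglongrightarrow> 0"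
    using tendsto_mult_right[OF LIMSEQ_inverse_real_of_nat, of 3] by (simp add: inverse_eq_divide)
qed

section \<open>Compactly supported functions and integration by parts\<close>

lemma integral_translate:
  fixes f :: "'a::euclidean_space \<Rightarrow> real"
  assumes "f \<in> borel_measurable borel"
  shows "(\<integral>x. f (x + a) \<partial>lborel) = (\<integral>x. f x \<partial>lborel)"
proof -
  have "(\<integral>x. f x \<partial>lborel) = (\<integral>x. f x \<partial>distr lborel borel ((+) a))"
    by (simp add: lborel_distr_plus)
  also have "\<dots> = (\<integral>x. f (a + x) \<partial>lborel)"
    using assms by (intro integral_distr) auto
  finally show ?thesis by (simp add: add.commute)
qed

lemma integral_dilate:
  fixes f :: "'a::euclidean_space \<Rightarrow> real"
  assumes f: "f \<in> borel_measurable borel" and k: "k > 0"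
  shows "(\<integral>x. f (k *\<^sub>R x) \<partial>lborel) = (\<integral>x. f x \<partial>lborel) / k ^ DIM('a)"
    and "integrable lborel (\<lambda>x. f (k *\<^sub>R x)) \<longleftrightarrow> integrable lborel f"
proof -
  have [measurable]: "f \<in> borel_measurable borel" by fact
  have eq: "(lborel :: 'a measure) = density (distr lborel borel (\<lambda>x. inverse k *\<^sub>R x)) (\<lambda>_. \<bar>inverse k\<bar> ^ DIM('a))"
    using lborel_affine[of "inverse k" "0::'a"] k by simp
  show "(\<integral>x. f (k *\<^sub>R x) \<partial>lborel) = (\<integral>x. f x \<partial>lborel) / k ^ DIM('a)"
    using k by (subst eq) (simp add: integral_real_density integral_distr field_simps)
  show "integrable lborel (\<lambda>x. f (k *\<^sub>R x)) \<longleftrightarrow> integrable lborel f"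
    using k by (subst eq) (simp add: integrable_density integrable_distr_eq)
qed

lemma integrable_compact_support:
  fixes f :: "'a::euclidean_space \<Rightarrow> real"
  assumes "continuous_on UNIV f" "compact K" "\<And>x. x \<notin> K \<Longrightarrow> f x = 0"
  shows "integrable lborel f"
proof -
  have "integrable lborel (\<lambda>x. indicator K x *\<^sub>R f x)"
    using assms(1,2) by (intro borel_integrable_compact) (auto intro: continuous_on_subset)
  moreover have "(\<lambda>x. indicator K x *\<^sub>R f x) = f"
    using assms(3) by (auto simp: fun_eq_iff indicator_def)
  ultimately show ?thesis by simp
qed

lemma bounded_compact_support:
  fixes f :: "'a::euclidean_space \<Rightarrow> real"
  assumes "continuous_on UNIV f" "compact K" "\<And>x. x \<notin> K \<Longrightarrow> f x = 0"
  obtains C where "C \<ge> 0" "\<And>x. \<bar>f x\<bar> \<le> C"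
proof -
  have "bounded (f ` K)"
    using assms(1,2) by (intro compact_imp_bounded compact_continuous_image) (auto intro: continuous_on_subset)
  then obtain C where C: "\<And>x. x \<in> K \<Longrightarrow> \<bar>f x\<bar> \<le> C" by (auto simp: bounded_iff)
  show thesis
  proof
    show "\<bar>f x\<bar> \<le> \<bar>C\<bar>" for x using C[of x] assms(3)[of x] by (cases "x \<in> K") auto
  qed simp
qed

lemma continuous_extend_zero:
  fixes h :: "'a::euclidean_space \<Rightarrow> real"
  assumes "open S" "compact K" "K \<subseteq> S" "continuous_on S h" "\<And>x. x \<notin> K \<Longrightarrow> h x = 0"
  shows "continuous_on UNIV h"
proof -
  have "continuous_on (S \<union> - K) h"
  proof (rule continuous_on_open_Un)
    show "continuous_on (- K) h"
      using assms(5) by (subst continuous_on_cong[of _ _ _ "\<lambda>_. 0"]) auto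
  qed (use assms compact_imp_closed in auto)
  moreover have "S \<union> - K = UNIV" using assms(3) by auto
  ultimately show ?thesis by simp
qed

definition has_dir_deriv :: "'a::euclidean_space set \<Rightarrow> 'a \<Rightarrow> ('a \<Rightarrow> real) \<Rightarrow> ('a \<Rightarrow> real) \<Rightarrow> bool" where
  "has_dir_deriv S b f f' \<longleftrightarrow> (\<forall>x\<in>S. ((\<lambda>s. f (x + s *\<^sub>R b)) has_real_derivative f' x) (at 0))"

lemma has_dir_deriv_line:
  assumes "has_dir_deriv UNIV b f f'"
  shows "((\<lambda>s. f (x + s *\<^sub>R b)) has_real_derivative f' (x + s *\<^sub>R b)) (at s)"
proof -
  have "((\<lambda>r. f (x + s *\<^sub>R b + r *\<^sub>R b)) has_real_derivative f' (x + s *\<^sub>R b)) (at 0)"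
    using assms by (auto simp: has_dir_deriv_def)
  then have "((\<lambda>r. f (x + (r + s) *\<^sub>R b)) has_real_derivative f' (x + s *\<^sub>R b)) (at 0)"
    by (simp add: algebra_simps)
  then show ?thesis using DERIV_shift[of "\<lambda>s. f (x + s *\<^sub>R b)" _ 0 s] by simp
qed

text \<open>Difference quotients in direction \<open>b\<close> have integral 0 by translation
  invariance, and they converge to \<open>f'\<close> under domination.\<close>

lemma integral_dir_deriv_eq_0:
  fixes f :: "'a::euclidean_space \<Rightarrow> real"
  assumes K: "compact K"
    and f: "continuous_on UNIV f" "\<And>x. x \<notin> K \<Longrightarrow> f x = 0"
    and f': "continuous_on UNIV f'" "\<And>x. x \<notin> K \<Longrightarrow> f' x = 0"
    and deriv: "has_dir_deriv UNIV b f f'"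
  shows "(\<integral>x. f' x \<partial>lborel) = 0"
proof -
  have [measurable]: "f \<in> borel_measurable borel" "f' \<in> borel_measurable borel"
    using f(1) f'(1) by (auto intro: borel_measurable_continuous_onI)
  obtain C where C: "C \<ge> 0" "\<And>x. \<bar>f' x\<bar> \<le> C" using bounded_compact_support[OF f'(1) K f'(2)] by blast
  obtain R where R: "\<And>x. x \<in> K \<Longrightarrow> norm x \<le> R"
    using compact_imp_bounded[OF K] by (auto simp: bounded_iff)
  define s where "s n = 1 / real (Suc n)" for n
  have s: "s n > 0" "s n \<le> 1" for n by (auto simp: s_def)
  have s0: "s \<longlonglongrightarrow> 0"
    using LIMSEQ_inverse_real_of_nat by (simp add: s_def[abs_def] inverse_eq_divide)
  define g where "g n x = (f (x + s n *\<^sub>R b) - f x) / s n" for n x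
  have fint: "integrable lborel f" by (rule integrable_compact_support[OF f(1) K f(2)])
  have ftr: "integrable lborel (\<lambda>x. f (x + a))" for a
  proof (rule integrable_compact_support)
    show "continuous_on UNIV (\<lambda>x. f (x + a))"
      by (intro continuous_on_compose2[OF f(1)] continuous_intros) auto
    show "compact ((\<lambda>x. x - a) ` K)"
      by (intro compact_continuous_image continuous_intros K)
    show "f (x + a) = 0" if "x \<notin> (\<lambda>x. x - a) ` K" for x
      using that by (intro f(2)) (metis add_diff_cancel image_eqI)
  qed
  have "(\<integral>x. g n x \<partial>lborel) = 0" for n
    unfolding g_def using fint ftr[of "s n *\<^sub>R b"] integral_translate[of f "s n *\<^sub>R b"] by simp
  moreover have "(\<lambda>n. \<integral>x. g n x \<partial>lborel) \<longlonglongrightarrow> (\<integral>x. f' x \<partial>lborel)"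
  \<comment> \<open>The mean value theorem bounds the quotients by \<open>C\<close>. The steps
    \<open>s n\<close> are at most 1, so points farther out than \<open>R + norm b\<close> stay
    outside \<open>K\<close> after the shift.\<close>
  proof (rule integral_dominated_convergence[where w="\<lambda>x. C * indicator (cball 0 (R + norm b)) x"])
    show "integrable lborel (\<lambda>x. C * indicator (cball (0::'a) (R + norm b)) x)"
      using emeasure_compact_finite[of "cball (0::'a) (R + norm b)"]
      by (intro integrable_mult_right integrable_real_indicator) auto
    show "AE x in lborel. (\<lambda>n. g n x) \<longlonglongrightarrow> f' x"
    proof (rule AE_I2)
      fix x
      have "((\<lambda>h. (f (x + h *\<^sub>R b) - f x) / h) \<longlongrightarrow> f' x) (at 0)"
        using deriv by (auto simp: has_dir_deriv_def DERIV_def)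
      moreover have "filterlim s (at 0) sequentially"
        using s0 s by (auto simp: filterlim_at less_imp_neq[symmetric])
      ultimately show "(\<lambda>n. g n x) \<longlonglongrightarrow> f' x"
        unfolding g_def by (rule filterlim_compose)
    qed
    show "AE x in lborel. norm (g n x) \<le> C * indicator (cball 0 (R + norm b)) x" for n
    proof (rule AE_I2)
      fix x
      show "norm (g n x) \<le> C * indicator (cball 0 (R + norm b)) x"
      proof (cases "x \<in> cball 0 (R + norm b)")
        case True
        have "\<bar>f (x + s n *\<^sub>R b) - f (x + 0 *\<^sub>R b)\<bar> \<le> C * \<bar>s n - 0\<bar>"
          by (rule field_differentiable_bound[of UNIV "\<lambda>s. f (x + s *\<^sub>R b)" "\<lambda>s. f' (x + s *\<^sub>R b)" C,
              unfolded real_norm_def]) (auto intro: has_dir_deriv_line[OF deriv] C)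
        then show ?thesis using True s[of n] by (simp add: g_def pos_divide_le_eq)
      next
        case False
        then have nx: "norm x > R + norm b" by simp
        have "norm (s n *\<^sub>R b) \<le> norm b" using s[of n] by (simp add: mult_left_le_one_le)
        then have "norm (x + s n *\<^sub>R b) > R"
          using nx norm_diff_ineq[of x "s n *\<^sub>R b"] by linarith
        then have "x + s n *\<^sub>R b \<notin> K" using R by fastforce
        moreover have "norm x > R" using nx norm_ge_zero[of b] by linarith
        then have "x \<notin> K" using R by fastforce
        ultimately show ?thesis using f(2) C by (simp add: g_def)
      qed
    qed
  qed (auto simp: g_def)
  ultimately show ?thesis by (simp add: LIMSEQ_const_iff)
qed

text \<open>The product of \<open>f\<close> and \<open>g\<close> is supported in \<open>K\<close>,
  so it is differentiable along \<open>b\<close> on the whole space even if \<open>g\<close> is wild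
  outside \<open>S\<close>, and its derivative integrates to 0.\<close>

lemma integral_by_parts:
  fixes f g :: "'a::euclidean_space \<Rightarrow> real"
  assumes S: "open S" "compact K" "K \<subseteq> S"
    and f: "continuous_on UNIV f" "\<And>x. x \<notin> K \<Longrightarrow> f x = 0"
    and f': "continuous_on UNIV f'" "\<And>x. x \<notin> K \<Longrightarrow> f' x = 0"
    and df: "has_dir_deriv UNIV b f f'"
    and g: "continuous_on S g" "continuous_on S g'" "has_dir_deriv S b g g'"
  shows "(\<integral>x. f x * g' x \<partial>lborel) = - (\<integral>x. f' x * g x \<partial>lborel)"
    and "integrable lborel (\<lambda>x. f x * g' x)"
    and "integrable lborel (\<lambda>x. f' x * g x)"
proof -
  have cont: "continuous_on UNIV (\<lambda>x. p x * q x)"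
    if "continuous_on UNIV p" "\<And>x. x \<notin> K \<Longrightarrow> p x = 0" "continuous_on S q" for p q :: "'a \<Rightarrow> real"
    by (rule continuous_extend_zero[OF S]) (use that in \<open>auto intro!: continuous_intros intro: continuous_on_subset\<close>)
  note c1 = cont[OF f g(2)] and c2 = cont[OF f' g(1)]
  show i1: "integrable lborel (\<lambda>x. f x * g' x)"
    by (rule integrable_compact_support[OF c1 S(2)]) (use f(2) in auto)
  show i2: "integrable lborel (\<lambda>x. f' x * g x)"
    by (rule integrable_compact_support[OF c2 S(2)]) (use f'(2) in auto)
  have "has_dir_deriv UNIV b (\<lambda>x. f x * g x) (\<lambda>x. f x * g' x + f' x * g x)"
    unfolding has_dir_deriv_def
  proof
    fix x :: 'a
    show "((\<lambda>s. f (x + s *\<^sub>R b) * g (x + s *\<^sub>R b)) has_real_derivative f x * g' x + f' x * g x) (at 0)"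
    proof (cases "x \<in> S")
      case True
      have "((\<lambda>s. f (x + s *\<^sub>R b)) has_real_derivative f' x) (at 0)"
        "((\<lambda>s. g (x + s *\<^sub>R b)) has_real_derivative g' x) (at 0)"
        using df g(3) True by (auto simp: has_dir_deriv_def)
      from DERIV_mult[OF this] show ?thesis by (simp add: algebra_simps)
    next
      case False
      then have xK: "x \<notin> K" using S by auto
      have op: "open ((\<lambda>s. x + s *\<^sub>R b) -` (- K))"
        by (intro open_vimage continuous_intros) (use S compact_imp_closed in auto)
      have d0: "((\<lambda>s. 0) has_real_derivative 0) (at 0)" by simp
      have "((\<lambda>s. f (x + s *\<^sub>R b) * g (x + s *\<^sub>R b)) has_real_derivative 0) (at 0)"
        by (rule has_field_derivative_transform_within_open[OF d0 op]) (use xK f(2) in auto)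
      then show ?thesis using xK f(2) f'(2) by simp
    qed
  qed
  then have "(\<integral>x. f x * g' x + f' x * g x \<partial>lborel) = 0"
    by (intro integral_dir_deriv_eq_0[OF S(2) cont[OF f g(1)] _ continuous_on_add[OF c1 c2]])
       (use f(2) f'(2) in auto)
  then show "(\<integral>x. f x * g' x \<partial>lborel) = - (\<integral>x. f' x * g x \<partial>lborel)"
    using i1 i2 by simp
qed

text \<open>Here \<open>D2 b\<close> is the pure second derivative in direction \<open>b\<close>.
  These are the only ones that enter the Laplacian, so no mixed derivatives are carried
  along.\<close>

definition C2_on :: "'a::euclidean_space set \<Rightarrow> ('a \<Rightarrow> real) \<Rightarrow> ('a \<Rightarrow> 'a \<Rightarrow> real) \<Rightarrow> ('a \<Rightarrow> 'a \<Rightarrow> real) \<Rightarrow> bool" where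
  "C2_on S v D D2 \<longleftrightarrow>
     (\<forall>x\<in>S. (v has_derivative (\<lambda>h. \<Sum>b\<in>Basis. (h \<bullet> b) * D b x)) (at x)) \<and>
     (\<forall>b\<in>Basis. has_dir_deriv S b (D b) (D2 b) \<and> continuous_on S (D b) \<and> continuous_on S (D2 b))"

lemma has_derivative_imp_dir_deriv:
  assumes v: "\<And>x. x \<in> S \<Longrightarrow> (v has_derivative (\<lambda>h. \<Sum>c\<in>Basis. (h \<bullet> c) * D c x)) (at x)" and b: "b \<in> Basis"
  shows "has_dir_deriv S b v (D b)"
  unfolding has_dir_deriv_def
proof
  fix x assume "x \<in> S"
  then have v: "(v has_derivative (\<lambda>h. \<Sum>c\<in>Basis. (h \<bullet> c) * D c x)) (at (x + 0 *\<^sub>R b))"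
    using v by simp
  have "((\<lambda>s. x + s *\<^sub>R b) has_derivative (\<lambda>s. s *\<^sub>R b)) (at 0)"
    by (auto intro!: derivative_eq_intros)
  from has_derivative_compose[OF this v]
  have "((\<lambda>s. v (x + s *\<^sub>R b)) has_derivative (\<lambda>s. \<Sum>c\<in>Basis. (s *\<^sub>R b \<bullet> c) * D c x)) (at 0)" .
  moreover have "(\<Sum>c\<in>Basis. (s *\<^sub>R b \<bullet> c) * D c x) = D b x * s" for s
  proof -
    have "(\<Sum>c\<in>Basis. (s *\<^sub>R b \<bullet> c) * D c x) = (\<Sum>c\<in>Basis. if c = b then s * D c x else 0)"
      using b by (intro sum.cong refl) (auto simp: inner_Basis)
    then show ?thesis using b by (simp add: sum.delta)
  qed
  ultimately show "((\<lambda>s. v (x + s *\<^sub>R b)) has_real_derivative D b x) (at 0)"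
    by (simp add: has_field_derivative_def)
qed

lemma C2_onD:
  assumes "C2_on S v D D2" "b \<in> Basis"
  shows "continuous_on S v" "has_dir_deriv S b v (D b)" "has_dir_deriv S b (D b) (D2 b)"
    "continuous_on S (D b)" "continuous_on S (D2 b)"
proof -
  show "continuous_on S v"
    using assms unfolding C2_on_def
    by (meson continuous_at_imp_continuous_on has_derivative_continuous)
  show "has_dir_deriv S b v (D b)"
    by (rule has_derivative_imp_dir_deriv[OF _ assms(2)]) (use assms(1) in \<open>auto simp: C2_on_def\<close>)
qed (use assms in \<open>auto simp: C2_on_def\<close>)

text \<open>Only \<open>w\<close> is regular up to the boundary; \<open>v\<close>, an eigenfunction in the application, need not be.\<close>

lemma integral_laplacian_swap:
  fixes v w :: "'a::euclidean_space \<Rightarrow> real"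
  assumes S: "open S" "compact K" "K \<subseteq> S"
    and w: "C2_on UNIV w Dw D2w" "\<And>x. x \<notin> K \<Longrightarrow> w x = 0"
      "\<And>x b. x \<notin> K \<Longrightarrow> b \<in> Basis \<Longrightarrow> Dw b x = 0" "\<And>x b. x \<notin> K \<Longrightarrow> b \<in> Basis \<Longrightarrow> D2w b x = 0"
    and v: "C2_on S v D D2"
  shows "(\<integral>x. w x * (\<Sum>b\<in>Basis. D2 b x) \<partial>lborel) = (\<integral>x. (\<Sum>b\<in>Basis. D2w b x) * v x \<partial>lborel)"
proof -
  have int1: "integrable lborel (\<lambda>x. w x * D2 b x)"
    and int2: "integrable lborel (\<lambda>x. D2w b x * v x)"
    and eq: "(\<integral>x. w x * D2 b x \<partial>lborel) = (\<integral>x. D2w b x * v x \<partial>lborel)" if b: "b \<in> Basis" for b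
  proof -
    note W = C2_onD[OF w(1) b] and V = C2_onD[OF v b]
    note 1 = integral_by_parts[OF S W(1) w(2) W(4) w(3)[OF _ b] W(2) V(4) V(5) V(3)]
    note 2 = integral_by_parts[OF S W(4) w(3)[OF _ b] W(5) w(4)[OF _ b] W(3) V(1) V(4) V(2)]
    show "integrable lborel (\<lambda>x. w x * D2 b x)" "integrable lborel (\<lambda>x. D2w b x * v x)"
      "(\<integral>x. w x * D2 b x \<partial>lborel) = (\<integral>x. D2w b x * v x \<partial>lborel)"
      using 1 2 by auto
  qed
  show ?thesis
    unfolding sum_distrib_left sum_distrib_right
    by (subst (1 2) Bochner_Integration.integral_sum) (auto intro: int1 int2 sum.cong eq)
qed

lemma integral_laplacian_self:
  fixes w :: "'a::euclidean_space \<Rightarrow> real"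
  assumes K: "compact K"
    and w: "C2_on UNIV w Dw D2w" "\<And>x. x \<notin> K \<Longrightarrow> w x = 0"
      "\<And>x b. x \<notin> K \<Longrightarrow> b \<in> Basis \<Longrightarrow> Dw b x = 0" "\<And>x b. x \<notin> K \<Longrightarrow> b \<in> Basis \<Longrightarrow> D2w b x = 0"
  shows "(\<integral>x. w x * (\<Sum>b\<in>Basis. D2w b x) \<partial>lborel) = - (\<integral>x. (\<Sum>b\<in>Basis. (Dw b x)\<^sup>2) \<partial>lborel)"
    and "integrable lborel (\<lambda>x. \<Sum>b\<in>Basis. (Dw b x)\<^sup>2)"
proof -
  have *: "integrable lborel (\<lambda>x. w x * D2w b x)" "integrable lborel (\<lambda>x. (Dw b x)\<^sup>2)"
    "(\<integral>x. w x * D2w b x \<partial>lborel) = - (\<integral>x. (Dw b x)\<^sup>2 \<partial>lborel)" if b: "b \<in> Basis" for b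
  proof -
    note W = C2_onD[OF w(1) b]
    note 1 = integral_by_parts[OF open_UNIV K subset_UNIV W(1) w(2) W(4) w(3)[OF _ b] W(2) W(4) W(5) W(3)]
    show "integrable lborel (\<lambda>x. w x * D2w b x)" "integrable lborel (\<lambda>x. (Dw b x)\<^sup>2)"
      "(\<integral>x. w x * D2w b x \<partial>lborel) = - (\<integral>x. (Dw b x)\<^sup>2 \<partial>lborel)"
      using 1 by (auto simp: power2_eq_square)
  qed
  show "integrable lborel (\<lambda>x. \<Sum>b\<in>Basis. (Dw b x)\<^sup>2)" using * by auto
  show "(\<integral>x. w x * (\<Sum>b\<in>Basis. D2w b x) \<partial>lborel) = - (\<integral>x. (\<Sum>b\<in>Basis. (Dw b x)\<^sup>2) \<partial>lborel)"
    unfolding sum_distrib_left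
    by (subst (1 2) Bochner_Integration.integral_sum) (auto intro: * sum.cong simp flip: sum_negf)
qed

text \<open>The common shape of an eigenfunction extended by zero, of a finite combination of these
  and of a dilate: continuous across the boundary, but with derivatives that are meaningful only in
  \<open>S\<close> and may blow up towards its frontier.\<close>

locale dirichlet_fun =
  fixes S :: "'a::euclidean_space set" and v D D2
  assumes open_S: "open S" and bounded_S: "bounded S"
    and cont: "continuous_on UNIV v" and zero: "\<And>x. x \<notin> S \<Longrightarrow> v x = 0"
    and C2: "C2_on S v D D2"
begin

definition supp :: "real \<Rightarrow> 'a set" where "supp e = {x. e \<le> \<bar>v x\<bar>}"

text \<open>Closed by continuity of \<open>v\<close>, and contained in the bounded set
  \<open>S\<close> because \<open>v\<close> vanishes elsewhere.\<close>

lemma compact_supp: assumes "e > 0" shows "compact (supp e)"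
proof -
  have "closed (supp e)"
    unfolding supp_def by (intro closed_Collect_le continuous_intros cont)
  moreover have "supp e \<subseteq> S" using zero assms by (force simp: supp_def)
  ultimately show ?thesis
    using bounded_S bounded_subset compact_eq_bounded_closed by blast
qed

lemma supp_subset: "e > 0 \<Longrightarrow> supp e \<subseteq> S"
  using zero by (force simp: supp_def)

abbreviation w where "w e x \<equiv> trunc e (v x)"
abbreviation Dw where "Dw e b x \<equiv> trunc' e (v x) * D b x"
abbreviation D2w where "D2w e b x \<equiv> trunc'' e (v x) * (D b x)\<^sup>2 + trunc' e (v x) * D2 b x"

lemma w_off_supp:
  assumes "e > 0" "x \<notin> supp e"
  shows "w e x = 0" "Dw e b x = 0" "D2w e b x = 0"
  using assms by (auto simp: supp_def trunc_eq_0)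

lemma cont_comp: "continuous_on UNIV g \<Longrightarrow> continuous_on A (\<lambda>x. g (v x))" for g :: "real \<Rightarrow> real"
  using continuous_on_compose2[of UNIV g A v] cont continuous_on_subset by blast

lemma C2_w:
  assumes e: "e > 0"
  shows "C2_on UNIV (w e) (Dw e) (D2w e)"
  unfolding C2_on_def
proof (intro conjI ballI)
  note off = w_off_supp[OF e]
  have op: "open (- supp e)" using compact_supp[OF e] compact_imp_closed by auto
  fix x :: 'a
  show "(w e has_derivative (\<lambda>h. \<Sum>b\<in>Basis. (h \<bullet> b) * Dw e b x)) (at x)"
  proof (cases "x \<in> S")
    case True
    have "(v has_derivative (\<lambda>h. \<Sum>b\<in>Basis. (h \<bullet> b) * D b x)) (at x)"
      using C2 True by (auto simp: C2_on_def)
    moreover have "(trunc e has_derivative (\<lambda>h. trunc' e (v x) * h)) (at (v x))"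
      using DERIV_trunc[OF e] by (simp add: has_field_derivative_def)
    ultimately have "(w e has_derivative (\<lambda>h. trunc' e (v x) * (\<Sum>b\<in>Basis. (h \<bullet> b) * D b x))) (at x)"
      by (rule has_derivative_compose)
    then show ?thesis by (simp add: sum_distrib_left mult_ac)
  next
    case False
    then have x: "x \<notin> supp e" using supp_subset[OF e] by auto
    have "((\<lambda>x. 0) has_derivative (\<lambda>h. 0)) (at x)" by simp
    then have "(w e has_derivative (\<lambda>h. 0)) (at x)"
      by (rule has_derivative_transform_within_open[OF _ op]) (use x off in auto)
    moreover have "(\<lambda>h. \<Sum>b\<in>Basis. (h \<bullet> b) * Dw e b x) = (\<lambda>h. 0)"
      by (simp only: off(2)[OF x] mult_zero_right sum.neutral_const)
    ultimately show ?thesis by (simp only:)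
  qed
next
  note off = w_off_supp[OF e]
  note ext = continuous_extend_zero[OF open_S compact_supp[OF e] supp_subset[OF e]]
  fix b :: 'a assume b: "b \<in> Basis"
  note V = C2_onD[OF C2 b]
  show "continuous_on UNIV (Dw e b)"
    by (rule ext[OF _ off(2)])
       (intro continuous_intros cont_comp continuous_trunc' e V; simp)
  show "continuous_on UNIV (D2w e b)"
    by (rule ext[OF _ off(3)])
       (intro continuous_intros cont_comp continuous_trunc' continuous_trunc'' e V; simp)
  show "has_dir_deriv UNIV b (Dw e b) (D2w e b)"
    unfolding has_dir_deriv_def
  proof
    fix x :: 'a
    show "((\<lambda>s. Dw e b (x + s *\<^sub>R b)) has_real_derivative D2w e b x) (at 0)"
    proof (cases "x \<in> S")
      case True
      have d: "((\<lambda>s. v (x + s *\<^sub>R b)) has_real_derivative D b x) (at 0)"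
        "((\<lambda>s. D b (x + s *\<^sub>R b)) has_real_derivative D2 b x) (at 0)"
        using V True by (auto simp: has_dir_deriv_def)
      have "(trunc' e has_real_derivative trunc'' e (v (x + 0 *\<^sub>R b))) (at (v (x + 0 *\<^sub>R b)))"
        by (rule DERIV_trunc'[OF e])
      from DERIV_mult[OF DERIV_chain2[OF this d(1)] d(2)]
      show ?thesis by (simp add: power2_eq_square algebra_simps)
    next
      case False
      then have x: "x \<notin> supp e" using supp_subset[OF e] by auto
      have op: "open ((\<lambda>s. x + s *\<^sub>R b) -` (- supp e))"
        by (intro open_vimage continuous_intros) (use compact_supp[OF e] compact_imp_closed in auto)
      have d0: "((\<lambda>s. 0) has_real_derivative 0) (at 0)" by simp
      have "((\<lambda>s. Dw e b (x + s *\<^sub>R b)) has_real_derivative 0) (at 0)"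
        by (rule has_field_derivative_transform_within_open[OF d0 op]) (use x off(2) in auto)
      then show ?thesis using off(3)[OF x] by simp
    qed
  qed
qed

text \<open>Integrating by parts, the right-hand side is the integral of
  \<open>trunc' e (v x)\<close> times the squared gradient of \<open>v\<close>. Since
  \<open>trunc'\<close> lies between 0 and 1, it dominates its own square, which is the factor in
  the energy of the truncation.\<close>

lemma energy_w_le:
  assumes e: "e > 0"
  shows "(\<integral>x. (\<Sum>b\<in>Basis. (Dw e b x)\<^sup>2) \<partial>lborel) \<le> (\<integral>x. w e x * - (\<Sum>b\<in>Basis. D2 b x) \<partial>lborel)"
    and "integrable lborel (\<lambda>x. w e x * - (\<Sum>b\<in>Basis. D2 b x))"
    and "integrable lborel (\<lambda>x. \<Sum>b\<in>Basis. (Dw e b x)\<^sup>2)"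
proof -
  note S = open_S compact_supp[OF e] supp_subset[OF e]
  note off = w_off_supp[OF e]
  have *: "integrable lborel (\<lambda>x. w e x * D2 b x)" "integrable lborel (\<lambda>x. Dw e b x * D b x)"
    "(\<integral>x. w e x * D2 b x \<partial>lborel) = - (\<integral>x. Dw e b x * D b x \<partial>lborel)" if b: "b \<in> Basis" for b
  proof -
    note V = C2_onD[OF C2 b] and W = C2_onD[OF C2_w[OF e] b]
    note 1 = integral_by_parts[OF S W(1) off(1) W(4) off(2) W(2) V(4) V(5) V(3)]
    show "integrable lborel (\<lambda>x. w e x * D2 b x)" "integrable lborel (\<lambda>x. Dw e b x * D b x)"
      "(\<integral>x. w e x * D2 b x \<partial>lborel) = - (\<integral>x. Dw e b x * D b x \<partial>lborel)"
      using 1 by auto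
  qed
  show int: "integrable lborel (\<lambda>x. \<Sum>b\<in>Basis. (Dw e b x)\<^sup>2)"
    by (rule integral_laplacian_self[OF S(2) C2_w[OF e]]) (erule off)+
  have "(\<lambda>x. w e x * - (\<Sum>b\<in>Basis. D2 b x)) = (\<lambda>x. - (\<Sum>b\<in>Basis. w e x * D2 b x))"
    by (simp add: sum_distrib_left)
  then show "integrable lborel (\<lambda>x. w e x * - (\<Sum>b\<in>Basis. D2 b x))" using * by auto
  have "(\<integral>x. (\<Sum>b\<in>Basis. (Dw e b x)\<^sup>2) \<partial>lborel) \<le> (\<integral>x. (\<Sum>b\<in>Basis. Dw e b x * D b x) \<partial>lborel)"
  proof (rule integral_mono[OF int])
    show "(\<Sum>b\<in>Basis. (Dw e b x)\<^sup>2) \<le> (\<Sum>b\<in>Basis. Dw e b x * D b x)" for x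
    proof (rule sum_mono)
      fix b
      have "(trunc' e (v x))\<^sup>2 \<le> trunc' e (v x)"
        using trunc'_bounds[OF e, of "v x"] by (simp add: power2_eq_square mult_left_le)
      then have "(trunc' e (v x))\<^sup>2 * (D b x)\<^sup>2 \<le> trunc' e (v x) * (D b x)\<^sup>2"
        by (rule mult_right_mono) simp
      then show "(Dw e b x)\<^sup>2 \<le> Dw e b x * D b x"
        by (simp add: power_mult_distrib power2_eq_square mult_ac)
    qed
  qed (use * in auto)
  also have "\<dots> = (\<Sum>b\<in>Basis. \<integral>x. Dw e b x * D b x \<partial>lborel)"
    by (rule Bochner_Integration.integral_sum) (rule *)
  also have "\<dots> = - (\<Sum>b\<in>Basis. \<integral>x. w e x * D2 b x \<partial>lborel)"
    by (simp add: * sum_negf)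
  also have "\<dots> = - (\<integral>x. (\<Sum>b\<in>Basis. w e x * D2 b x) \<partial>lborel)"
    by (subst Bochner_Integration.integral_sum) (auto intro: *)
  finally show "(\<integral>x. (\<Sum>b\<in>Basis. (Dw e b x)\<^sup>2) \<partial>lborel) \<le> (\<integral>x. w e x * - (\<Sum>b\<in>Basis. D2 b x) \<partial>lborel)"
    by (simp add: sum_distrib_left)
qed

end

section \<open>Dilations of functions vanishing at the boundary\<close>

lemma sq_integrable_borel: "sq_integrable lborel f \<Longrightarrow> f \<in> borel_measurable borel"
  by (simp add: sq_integrable_def)

lemma l2norm_cmult: "l2norm M (\<lambda>x. c * f x) = \<bar>c\<bar> * l2norm M f"
proof -
  have "ip M (\<lambda>x. c * f x) (\<lambda>x. c * f x) = c\<^sup>2 * ip M f f"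
    by (simp add: ip_cmult_left ip_commute[of M f "\<lambda>x. c * f x"] power2_eq_square)
  then show ?thesis by (simp add: l2norm_def real_sqrt_mult)
qed

lemma sq_integrable_compact_support:
  fixes f :: "'a::euclidean_space \<Rightarrow> real"
  assumes "continuous_on UNIV f" "compact K" "\<And>x. x \<notin> K \<Longrightarrow> f x = 0"
  shows "sq_integrable lborel f"
  unfolding sq_integrable_def
proof
  show "f \<in> borel_measurable lborel"
    using assms(1) by (simp add: borel_measurable_continuous_onI)
  show "integrable lborel (\<lambda>x. (f x)\<^sup>2)"
    by (rule integrable_compact_support[OF _ assms(2)]) (use assms in \<open>auto intro!: continuous_intros\<close>)
qed

lemma sq_integrable_dilate:
  fixes f :: "'a::euclidean_space \<Rightarrow> real"
  assumes "sq_integrable lborel f" "k > 0"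
  shows "sq_integrable lborel (\<lambda>x. f (k *\<^sub>R x))"
  using assms integral_dilate(2)[of "\<lambda>x. (f x)\<^sup>2" k] unfolding sq_integrable_def by auto

lemma ip_dilate:
  fixes f g :: "'a::euclidean_space \<Rightarrow> real"
  assumes "sq_integrable lborel f" "sq_integrable lborel g" "k > 0"
  shows "ip lborel (\<lambda>x. f (k *\<^sub>R x)) (\<lambda>x. g (k *\<^sub>R x)) = ip lborel f g / k ^ DIM('a)"
  unfolding ip_def using assms
  by (intro integral_dilate(1)[of "\<lambda>x. f x * g x"]) (auto simp: sq_integrable_def)

lemma l2norm_dilate_le:
  fixes f :: "'a::euclidean_space \<Rightarrow> real"
  assumes "sq_integrable lborel f" "k \<ge> 1"
  shows "l2norm lborel (\<lambda>x. f (k *\<^sub>R x)) \<le> l2norm lborel f"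
proof -
  have "ip lborel f f / k ^ DIM('a) \<le> ip lborel f f"
    using assms(2) ip_nonneg[of lborel f] by (intro divide_le_eq_1_pos[THEN iffD2] mult_imp_div_pos_le)
      (auto simp: mult_le_cancel_left1 one_le_power)
  then show ?thesis
    using assms ip_dilate[OF assms(1,1), of k] by (simp add: l2norm_def)
qed

text \<open>Since \<open>s \<mapsto> l2norm (w (exp s *\<^sub>R x) - w x)\<close> is subadditive, it is bounded by \<open>s\<close> times its
  derivative at \<open>0\<close>, the norm of the radial derivative of \<open>w\<close>.\<close>

lemma l2norm_dilate_diff_smooth:
  fixes w :: "'a::euclidean_space \<Rightarrow> real"
  assumes K: "compact K" "K \<subseteq> cball 0 R" and R: "R > 0"
    and w: "C2_on UNIV w Dw D2w" "\<And>x. x \<notin> K \<Longrightarrow> w x = 0"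
      "\<And>x b. x \<notin> K \<Longrightarrow> b \<in> Basis \<Longrightarrow> Dw b x = 0"
    and int: "integrable lborel (\<lambda>x. \<Sum>b\<in>Basis. (Dw b x)\<^sup>2)"
    and s: "s > 0"
  shows "l2norm lborel (\<lambda>x. w (exp s *\<^sub>R x) - w x) \<le> s * R * sqrt (\<integral>x. (\<Sum>b\<in>Basis. (Dw b x)\<^sup>2) \<partial>lborel)"
proof -
  obtain b0 :: 'a where b0: "b0 \<in> Basis" using nonempty_Basis by blast
  have wc: "continuous_on UNIV w" using C2_onD(1)[OF w(1) b0] .
  have wsq: "sq_integrable lborel w" by (rule sq_integrable_compact_support[OF wc K(1) w(2)])
  have wdil: "sq_integrable lborel (\<lambda>x. w (k *\<^sub>R x))" if "k > 0" for k
    by (rule sq_integrable_dilate[OF wsq that])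
  have [measurable]: "w \<in> borel_measurable borel" by (rule sq_integrable_borel[OF wsq])
  define E where "E r = l2norm lborel (\<lambda>x. w (exp r *\<^sub>R x) - w x)" for r
  define G where "G x = (\<Sum>b\<in>Basis. (x \<bullet> b) * Dw b x)" for x
  have Gc: "continuous_on UNIV G"
    unfolding G_def by (intro continuous_intros C2_onD(4)[OF w(1)])
  have G0: "G x = 0" if "x \<notin> K" for x
    unfolding G_def using w(3)[OF that] by simp
  have Gsq: "sq_integrable lborel G" by (rule sq_integrable_compact_support[OF Gc K(1) G0])
  obtain C where C: "C \<ge> 0" "\<And>x. \<bar>G x\<bar> \<le> C" using bounded_compact_support[OF Gc K(1) G0] by blast
  \<comment> \<open>Dilation by \<open>exp r\<close> with \<open>r \<ge> 0\<close> does not increase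
    the L2 norm, hence the sign condition.\<close>
  have E_add: "E (r + q) \<le> E r + E q" if "r \<ge> 0" for r q
  proof -
    have "E (r + q) \<le> l2norm lborel (\<lambda>x. w (exp (r + q) *\<^sub>R x) - w (exp r *\<^sub>R x)) + E r"
      unfolding E_def by (intro l2norm_triangle_diff wdil wsq) auto
    also have "l2norm lborel (\<lambda>x. w (exp (r + q) *\<^sub>R x) - w (exp r *\<^sub>R x))
        = l2norm lborel (\<lambda>x. (\<lambda>x. w (exp q *\<^sub>R x) - w x) (exp r *\<^sub>R x))"
      by (simp add: exp_add mult.commute)
    also have "\<dots> \<le> E q"
      unfolding E_def using that
      by (intro l2norm_dilate_le sq_integrable_diff wdil wsq) auto
    finally show ?thesis by simp
  qed
  have E0: "E 0 = 0" by (simp add: E_def l2norm_def ip_def)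
  have E_mult: "E (real n * r) \<le> real n * E r" if "r \<ge> 0" for n r
  proof (induction n)
    case (Suc n)
    have "E (real (Suc n) * r) = E (real n * r + r)" by (simp add: algebra_simps)
    also have "\<dots> \<le> E (real n * r) + E r" using that by (intro E_add) auto
    also have "\<dots> \<le> real n * E r + E r" using Suc by simp
    finally show ?case by (simp add: algebra_simps)
  qed (simp add: E0)
  have ray: "((\<lambda>r. w (exp r *\<^sub>R x)) has_real_derivative G (exp r *\<^sub>R x)) (at r)" for x r
  proof -
    have 1: "((\<lambda>r. exp r *\<^sub>R x) has_derivative (\<lambda>h. (h * exp r) *\<^sub>R x)) (at r)"
      by (auto intro!: derivative_eq_intros)
    have 2: "(w has_derivative (\<lambda>h. \<Sum>b\<in>Basis. (h \<bullet> b) * Dw b (exp r *\<^sub>R x))) (at (exp r *\<^sub>R x))"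
      using w(1) by (auto simp: C2_on_def)
    have "(\<lambda>h. \<Sum>b\<in>Basis. ((h * exp r) *\<^sub>R x \<bullet> b) * Dw b (exp r *\<^sub>R x)) = (*) (G (exp r *\<^sub>R x))"
      by (rule ext) (simp add: G_def sum_distrib_left sum_distrib_right mult_ac)
    with has_derivative_compose[OF 1 2] show ?thesis
      by (simp only: has_field_derivative_def)
  qed
  \<comment> \<open>Splitting the dilation by \<open>exp s\<close> into \<open>Suc n\<close> equal
    ones bounds \<open>E s\<close> by \<open>s\<close> times the norm of the difference quotient
    \<open>q n\<close>, which converges to the radial derivative \<open>G\<close>.\<close>
  define r where "r n = s / real (Suc n)" for n
  have r: "r n > 0" for n using s by (simp add: r_def)
  have r0: "r \<longlonglongrightarrow> 0"
    using tendsto_mult_left[OF LIMSEQ_inverse_real_of_nat, of s] by (simp add: r_def[abs_def] divide_inverse)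
  define q where "q n x = (w (exp (r n) *\<^sub>R x) - w x) / r n" for n x
  have [measurable]: "q n \<in> borel_measurable borel" for n unfolding q_def by measurable
  have [measurable]: "G \<in> borel_measurable borel" by (rule sq_integrable_borel[OF Gsq])
  have "(\<lambda>n. \<integral>x. (q n x)\<^sup>2 \<partial>lborel) \<longlonglongrightarrow> (\<integral>x. (G x)\<^sup>2 \<partial>lborel)"
  proof (rule integral_dominated_convergence[where w="\<lambda>x. C\<^sup>2 * indicator (cball 0 R) x"])
    show "integrable lborel (\<lambda>x. C\<^sup>2 * indicator (cball (0::'a) R) x)"
      using emeasure_compact_finite[of "cball (0::'a) R"]
      by (intro integrable_mult_right integrable_real_indicator) auto
    show "AE x in lborel. (\<lambda>n. (q n x)\<^sup>2) \<longlonglongrightarrow> (G x)\<^sup>2"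
    proof (rule AE_I2)
      fix x
      have "((\<lambda>h. (w (exp h *\<^sub>R x) - w x) / h) \<longlongrightarrow> G x) (at 0)"
        using ray[of x 0] by (simp add: DERIV_def)
      moreover have "filterlim r (at 0) sequentially"
        using r0 r by (auto simp: filterlim_at less_imp_neq[symmetric])
      ultimately have "(\<lambda>n. q n x) \<longlonglongrightarrow> G x"
        unfolding q_def by (rule filterlim_compose)
      then show "(\<lambda>n. (q n x)\<^sup>2) \<longlonglongrightarrow> (G x)\<^sup>2" by (rule tendsto_power)
    qed
    show "AE x in lborel. norm ((q n x)\<^sup>2) \<le> C\<^sup>2 * indicator (cball 0 R) x" for n
    proof (rule AE_I2)
      fix x
      show "norm ((q n x)\<^sup>2) \<le> C\<^sup>2 * indicator (cball 0 R) x"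
      proof (cases "x \<in> cball 0 R")
        case True
        have "\<bar>w (exp (r n) *\<^sub>R x) - w (exp 0 *\<^sub>R x)\<bar> \<le> C * \<bar>r n - 0\<bar>"
          by (rule field_differentiable_bound[of UNIV "\<lambda>r. w (exp r *\<^sub>R x)" "\<lambda>r. G (exp r *\<^sub>R x)" C,
              unfolded real_norm_def]) (auto intro: ray C)
        then have "\<bar>q n x\<bar> \<le> C" using r[of n] by (simp add: q_def pos_divide_le_eq)
        then have "(q n x)\<^sup>2 \<le> C\<^sup>2" by (metis C(1) abs_le_square_iff abs_of_nonneg)
        then show ?thesis using True by simp
      next
        case False
        have "1 * norm x \<le> exp (r n) * norm x" using r[of n] by (intro mult_right_mono) auto
        then have "exp (r n) *\<^sub>R x \<notin> cball 0 R" "x \<notin> cball 0 R" using False by auto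
        then have "w (exp (r n) *\<^sub>R x) = 0" "w x = 0" using K(2) w(2) by blast+
        then show ?thesis using C by (simp add: q_def)
      qed
    qed
  qed auto
  then have "(\<lambda>n. l2norm lborel (q n)) \<longlonglongrightarrow> l2norm lborel G"
    unfolding l2norm_def ip_def by (intro tendsto_real_sqrt) (simp add: power2_eq_square)
  then have lim: "(\<lambda>n. s * l2norm lborel (q n)) \<longlonglongrightarrow> s * l2norm lborel G"
    by (rule tendsto_mult_left)
  have "E s \<le> s * l2norm lborel (q n)" for n
  proof -
    have "E s = E (real (Suc n) * r n)" by (simp add: r_def)
    also have "\<dots> \<le> real (Suc n) * E (r n)" using r[of n] by (intro E_mult) simp
    also have "E (r n) = r n * l2norm lborel (q n)"
    proof -
      have "w (exp (r n) *\<^sub>R x) - w x = r n * q n x" for x using r[of n] by (simp add: q_def)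
      then show ?thesis using r[of n] by (simp add: E_def l2norm_cmult)
    qed
    finally show ?thesis by (simp add: r_def)
  qed
  then have 1: "E s \<le> s * l2norm lborel G"
    by (intro LIMSEQ_le_const[OF lim]) auto
  have "ip lborel G G \<le> (\<integral>x. R\<^sup>2 * (\<Sum>b\<in>Basis. (Dw b x)\<^sup>2) \<partial>lborel)"
    unfolding ip_def
  proof (rule integral_mono[OF sq_integrable_mult[OF Gsq Gsq] integrable_mult_right[OF int]])
    fix x
    show "G x * G x \<le> R\<^sup>2 * (\<Sum>b\<in>Basis. (Dw b x)\<^sup>2)"
    proof (cases "x \<in> K")
      case True
      \<comment> \<open>Cauchy-Schwarz: the radial derivative is at most \<open>norm x\<close> times
        the length of the gradient, and \<open>norm x \<le> R\<close> on the support.\<close>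
      have "(G x)\<^sup>2 \<le> (\<Sum>b\<in>Basis. (x \<bullet> b)\<^sup>2) * (\<Sum>b\<in>Basis. (Dw b x)\<^sup>2)"
        unfolding G_def by (rule Cauchy_Schwarz_ineq_sum)
      also have "(\<Sum>b\<in>Basis. (x \<bullet> b)\<^sup>2) = (norm x)\<^sup>2"
        unfolding power2_norm_eq_inner by (subst euclidean_inner) (simp add: power2_eq_square)
      also have "(norm x)\<^sup>2 * (\<Sum>b\<in>Basis. (Dw b x)\<^sup>2) \<le> R\<^sup>2 * (\<Sum>b\<in>Basis. (Dw b x)\<^sup>2)"
        using True K(2) by (intro mult_right_mono power_mono sum_nonneg) auto
      finally show ?thesis by (simp add: power2_eq_square)
    qed (simp add: G0 sum_nonneg)
  qed
  then have "l2norm lborel G \<le> sqrt (R\<^sup>2 * (\<integral>x. (\<Sum>b\<in>Basis. (Dw b x)\<^sup>2) \<partial>lborel))"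
    by (simp add: l2norm_def)
  also have "\<dots> = R * sqrt (\<integral>x. (\<Sum>b\<in>Basis. (Dw b x)\<^sup>2) \<partial>lborel)"
    using R by (simp add: real_sqrt_mult)
  finally have "s * l2norm lborel G \<le> s * (R * sqrt (\<integral>x. (\<Sum>b\<in>Basis. (Dw b x)\<^sup>2) \<partial>lborel))"
    using s by (intro mult_left_mono) auto
  with 1 show ?thesis by (simp add: E_def mult.assoc)
qed

section \<open>From truncations to the function itself\<close>

context dirichlet_fun
begin

abbreviation trunc_seq :: "nat \<Rightarrow> 'a \<Rightarrow> real" where
  "trunc_seq n x \<equiv> w (1 / real (Suc n)) x"

lemma closure_compact: "compact (closure S)"
  using bounded_S by (simp add: compact_closure)

lemma sq_int: "sq_integrable lborel v"
  by (rule sq_integrable_compact_support[OF cont closure_compact])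
     (use zero closure_subset in blast)

lemma sq_int_w: "e > 0 \<Longrightarrow> sq_integrable lborel (w e)"
  by (rule sq_integrable_compact_support[OF _ compact_supp w_off_supp(1)])
     (auto intro: cont_comp continuous_trunc)

lemma l2norm_trunc_seq: "(\<lambda>n. l2norm lborel (\<lambda>x. trunc_seq n x - v x)) \<longlonglongrightarrow> 0"
proof -
  have [measurable]: "v \<in> borel_measurable borel" by (rule sq_integrable_borel[OF sq_int])
  have [measurable]: "trunc_seq n \<in> borel_measurable borel" for n
    by (rule sq_integrable_borel[OF sq_int_w]) simp
  have "(\<lambda>n. \<integral>x. (trunc_seq n x - v x)\<^sup>2 \<partial>lborel) \<longlonglongrightarrow> (\<integral>x. 0 \<partial>(lborel :: 'a measure))"
  proof (rule integral_dominated_convergence[where w="\<lambda>x. (2 * v x)\<^sup>2"])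
    show "integrable lborel (\<lambda>x. (2 * v x)\<^sup>2)"
      using sq_integrable_cmult[OF sq_int, of 2] by (simp add: sq_integrable_def)
    have "(\<lambda>n. (trunc_seq n x - v x)\<^sup>2) \<longlonglongrightarrow> (v x - v x)\<^sup>2" for x
      by (intro tendsto_intros tendsto_trunc)
    then show "AE x in lborel. (\<lambda>n. (trunc_seq n x - v x)\<^sup>2) \<longlonglongrightarrow> 0" by simp
    have "\<bar>trunc_seq n x - v x\<bar> \<le> \<bar>2 * v x\<bar>" for n x
      using abs_trunc_le[of "1 / real (Suc n)" "v x"] by simp
    then have "(trunc_seq n x - v x)\<^sup>2 \<le> (2 * v x)\<^sup>2" for n x
      by (simp only: abs_le_square_iff)
    then show "AE x in lborel. norm ((trunc_seq n x - v x)\<^sup>2) \<le> (2 * v x)\<^sup>2" for n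
      by simp
    show "(\<lambda>x. (trunc_seq n x - v x)\<^sup>2) \<in> borel_measurable lborel" for n
      by measurable
  qed simp
  then have "(\<lambda>n. sqrt (\<integral>x. (trunc_seq n x - v x)\<^sup>2 \<partial>lborel)) \<longlonglongrightarrow> sqrt 0"
    by (intro tendsto_real_sqrt) simp
  then show ?thesis by (simp add: l2norm_def ip_def power2_eq_square)
qed

text \<open>The function \<open>G\<close> is minus the Laplacian of \<open>v\<close>, with arbitrary
  values off \<open>S\<close>, where the truncations vanish anyway. Because \<open>trunc\<close>
  never exceeds its argument in absolute value, \<open>v x * G x\<close> dominates, and the gradient
  of \<open>v\<close> is never integrated.\<close>

lemma energy_limit:
  assumes G: "\<And>x. x \<in> S \<Longrightarrow> G x = - (\<Sum>b\<in>Basis. D2 b x)" "integrable lborel (\<lambda>x. v x * G x)"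
  shows "(\<lambda>n. \<integral>x. trunc_seq n x * - (\<Sum>b\<in>Basis. D2 b x) \<partial>lborel) \<longlonglongrightarrow> (\<integral>x. v x * G x \<partial>lborel)"
proof (rule integral_dominated_convergence[where w="\<lambda>x. norm (v x * G x)"])
  have eq: "trunc_seq n x * - (\<Sum>b\<in>Basis. D2 b x) = trunc_seq n x * G x" for n x
    using G(1)[of x] zero[of x] by (cases "x \<in> S") auto
  show "AE x in lborel. (\<lambda>n. trunc_seq n x * - (\<Sum>b\<in>Basis. D2 b x)) \<longlonglongrightarrow> v x * G x"
    unfolding eq by (intro AE_I2 tendsto_mult_right tendsto_trunc)
  show "AE x in lborel. norm (trunc_seq n x * - (\<Sum>b\<in>Basis. D2 b x)) \<le> norm (v x * G x)" for n
    unfolding eq real_norm_def abs_mult by (intro AE_I2 mult_right_mono abs_trunc_le) auto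
  show "(\<lambda>x. trunc_seq n x * - (\<Sum>b\<in>Basis. D2 b x)) \<in> borel_measurable lborel" for n
    by (rule borel_measurable_integrable[OF energy_w_le(2)]) simp
qed (use G in auto)

lemma energy_nonneg:
  assumes "\<And>x. x \<in> S \<Longrightarrow> G x = - (\<Sum>b\<in>Basis. D2 b x)" "integrable lborel (\<lambda>x. v x * G x)"
  shows "0 \<le> (\<integral>x. v x * G x \<partial>lborel)"
proof (rule LIMSEQ_le_const[OF energy_limit[OF assms]])
  have "0 \<le> (\<integral>x. trunc_seq n x * - (\<Sum>b\<in>Basis. D2 b x) \<partial>lborel)" for n
    by (rule order_trans[OF _ energy_w_le(1)]) (auto intro!: integral_nonneg_AE sum_nonneg)
  then show "\<exists>N. \<forall>n\<ge>N. 0 \<le> (\<integral>x. trunc_seq n x * - (\<Sum>b\<in>Basis. D2 b x) \<partial>lborel)" by blast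
qed simp

text \<open>The estimate holds for each truncation with its own energy, which
  \<open>energy_w_le\<close> bounds by a convergent quantity. The two error terms
  \<open>?d n\<close> account for replacing \<open>v\<close> by the truncation before and after
  dilating.\<close>

lemma l2norm_dilate_diff:
  assumes G: "\<And>x. x \<in> S \<Longrightarrow> G x = - (\<Sum>b\<in>Basis. D2 b x)" "integrable lborel (\<lambda>x. v x * G x)"
    and R: "S \<subseteq> cball 0 R" "R > 0" and s: "s > 0"
  shows "l2norm lborel (\<lambda>x. v (exp s *\<^sub>R x) - v x) \<le> s * R * sqrt (\<integral>x. v x * G x \<partial>lborel)"
proof -
  let ?d = "\<lambda>n. l2norm lborel (\<lambda>x. trunc_seq n x - v x)"
  let ?E = "\<lambda>n. \<integral>x. trunc_seq n x * - (\<Sum>b\<in>Basis. D2 b x) \<partial>lborel"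
  have bound: "l2norm lborel (\<lambda>x. v (exp s *\<^sub>R x) - v x) \<le> ?d n + s * R * sqrt (?E n) + ?d n" for n
  proof -
    let ?e = "1 / real (Suc n)"
    have e: "?e > 0" by simp
    note vs = sq_integrable_dilate[OF sq_int, of "exp s"] and ws = sq_integrable_dilate[OF sq_int_w[OF e], of "exp s"]
    have "l2norm lborel (\<lambda>x. v (exp s *\<^sub>R x) - v x) \<le>
       l2norm lborel (\<lambda>x. v (exp s *\<^sub>R x) - trunc_seq n (exp s *\<^sub>R x)) + l2norm lborel (\<lambda>x. trunc_seq n (exp s *\<^sub>R x) - v x)"
      by (rule l2norm_triangle_diff) (use vs ws sq_int in auto)
    also have "l2norm lborel (\<lambda>x. trunc_seq n (exp s *\<^sub>R x) - v x) \<le>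
       l2norm lborel (\<lambda>x. trunc_seq n (exp s *\<^sub>R x) - trunc_seq n x) + ?d n"
      by (rule l2norm_triangle_diff) (use ws sq_int_w[OF e] sq_int in auto)
    also have "l2norm lborel (\<lambda>x. v (exp s *\<^sub>R x) - trunc_seq n (exp s *\<^sub>R x)) \<le> l2norm lborel (\<lambda>x. v x - trunc_seq n x)"
      by (rule l2norm_dilate_le[of "\<lambda>x. v x - trunc_seq n x"])
         (use sq_integrable_diff[OF sq_int sq_int_w[OF e]] s in auto)
    also have "l2norm lborel (\<lambda>x. v x - trunc_seq n x) = ?d n" by (rule l2norm_minus_commute)
    also have "l2norm lborel (\<lambda>x. trunc_seq n (exp s *\<^sub>R x) - trunc_seq n x) \<le>
        s * R * sqrt (\<integral>x. (\<Sum>b\<in>Basis. (Dw ?e b x)\<^sup>2) \<partial>lborel)"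
      by (rule l2norm_dilate_diff_smooth[OF compact_supp[OF e] _ R(2) C2_w[OF e] _ _ energy_w_le(3)[OF e] s])
         (use supp_subset[OF e] R(1) w_off_supp(1)[OF e] w_off_supp(2)[OF e] in blast)+
    also have "\<dots> \<le> s * R * sqrt (?E n)"
      using R s energy_w_le(1)[OF e] by (intro mult_left_mono real_sqrt_le_mono) auto
    finally show ?thesis by simp
  qed
  have "(\<lambda>n. ?d n + s * R * sqrt (?E n) + ?d n) \<longlonglongrightarrow> 0 + s * R * sqrt (\<integral>x. v x * G x \<partial>lborel) + 0"
    by (intro tendsto_add tendsto_mult tendsto_const tendsto_real_sqrt l2norm_trunc_seq energy_limit[OF G])
  then show ?thesis using bound by (intro LIMSEQ_le_const) auto
qed

text \<open>The chain rule gives one factor \<open>k\<close> for each derivative. The vanishing set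
  changes with it: the dilate is a Dirichlet function of the domain shrunk by
  \<open>k\<close>.\<close>

lemma dilated:
  assumes k: "k > 0"
  shows "dirichlet_fun ((\<lambda>x. k *\<^sub>R x) -` S) (\<lambda>x. v (k *\<^sub>R x)) (\<lambda>b x. k * D b (k *\<^sub>R x)) (\<lambda>b x. k\<^sup>2 * D2 b (k *\<^sub>R x))"
proof
  show "open ((\<lambda>x. k *\<^sub>R x) -` S)" by (intro open_vimage continuous_intros open_S)
  have "(\<lambda>x. k *\<^sub>R x) -` S \<subseteq> (\<lambda>x. inverse k *\<^sub>R x) ` S"
  proof
    fix x assume "x \<in> (\<lambda>x. k *\<^sub>R x) -` S"
    then show "x \<in> (\<lambda>x. inverse k *\<^sub>R x) ` S"
      using k by (intro image_eqI[of _ _ "k *\<^sub>R x"]) auto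
  qed
  then show "bounded ((\<lambda>x. k *\<^sub>R x) -` S)"
    using bounded_scaling[OF bounded_S] bounded_subset by blast
  show "continuous_on UNIV (\<lambda>x. v (k *\<^sub>R x))"
    by (intro continuous_on_compose2[OF cont] continuous_intros) auto
  show "x \<notin> (\<lambda>x. k *\<^sub>R x) -` S \<Longrightarrow> v (k *\<^sub>R x) = 0" for x by (auto intro: zero)
  show "C2_on ((\<lambda>x. k *\<^sub>R x) -` S) (\<lambda>x. v (k *\<^sub>R x)) (\<lambda>b x. k * D b (k *\<^sub>R x)) (\<lambda>b x. k\<^sup>2 * D2 b (k *\<^sub>R x))"
    unfolding C2_on_def
  proof (intro conjI ballI)
    fix x assume "x \<in> (\<lambda>x. k *\<^sub>R x) -` S"
    then have "(v has_derivative (\<lambda>h. \<Sum>b\<in>Basis. (h \<bullet> b) * D b (k *\<^sub>R x))) (at (k *\<^sub>R x))"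
      using C2 by (auto simp: C2_on_def)
    moreover have "((\<lambda>x. k *\<^sub>R x) has_derivative (\<lambda>h. k *\<^sub>R h)) (at x)"
      by (auto intro!: derivative_eq_intros)
    ultimately have "((\<lambda>x. v (k *\<^sub>R x)) has_derivative (\<lambda>h. \<Sum>b\<in>Basis. (k *\<^sub>R h \<bullet> b) * D b (k *\<^sub>R x))) (at x)"
      using has_derivative_compose by blast
    then show "((\<lambda>x. v (k *\<^sub>R x)) has_derivative (\<lambda>h. \<Sum>b\<in>Basis. (h \<bullet> b) * (k * D b (k *\<^sub>R x)))) (at x)"
      by (simp add: mult_ac)
  next
    fix b :: 'a assume b: "b \<in> Basis"
    note V = C2_onD[OF C2 b]
    show "continuous_on ((\<lambda>x. k *\<^sub>R x) -` S) (\<lambda>x. k * D b (k *\<^sub>R x))"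
      by (intro continuous_intros continuous_on_compose2[OF V(4)]) auto
    show "continuous_on ((\<lambda>x. k *\<^sub>R x) -` S) (\<lambda>x. k\<^sup>2 * D2 b (k *\<^sub>R x))"
      by (intro continuous_intros continuous_on_compose2[OF V(5)]) auto
    show "has_dir_deriv ((\<lambda>x. k *\<^sub>R x) -` S) b (\<lambda>x. k * D b (k *\<^sub>R x)) (\<lambda>x. k\<^sup>2 * D2 b (k *\<^sub>R x))"
      unfolding has_dir_deriv_def
    proof
      fix x assume "x \<in> (\<lambda>x. k *\<^sub>R x) -` S"
      then have "((\<lambda>s. D b (k *\<^sub>R x + s *\<^sub>R b)) has_real_derivative D2 b (k *\<^sub>R x)) (at (k * 0))"
        using V(3) by (auto simp: has_dir_deriv_def)
      moreover have "((\<lambda>s. k * s) has_real_derivative k) (at 0)"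
        by (auto intro!: derivative_eq_intros)
      ultimately have "((\<lambda>s. D b (k *\<^sub>R x + (k * s) *\<^sub>R b)) has_real_derivative D2 b (k *\<^sub>R x) * k) (at 0)"
        by (rule DERIV_chain2)
      from DERIV_cmult[OF this, of k]
      show "((\<lambda>s. k * D b (k *\<^sub>R (x + s *\<^sub>R b))) has_real_derivative k\<^sup>2 * D2 b (k *\<^sub>R x)) (at 0)"
        by (simp add: scaleR_add_right power2_eq_square mult_ac)
    qed
  qed
qed

end

lemma dirichlet_fun_sum:
  fixes S :: "'a::euclidean_space set"
  assumes f: "\<And>i. i \<in> I \<Longrightarrow> dirichlet_fun S (f i) (D i) (D2 i)" and I: "finite I" "I \<noteq> {}"
  shows "dirichlet_fun S (\<lambda>x. \<Sum>i\<in>I. c i * f i x) (\<lambda>b x. \<Sum>i\<in>I. c i * D i b x) (\<lambda>b x. \<Sum>i\<in>I. c i * D2 i b x)"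
proof
  obtain i0 where i0: "i0 \<in> I" using I by auto
  show "open S" "bounded S" using f[OF i0] by (auto simp: dirichlet_fun_def)
  show "continuous_on UNIV (\<lambda>x. \<Sum>i\<in>I. c i * f i x)"
    using f by (intro continuous_intros) (auto simp: dirichlet_fun_def)
  show "x \<notin> S \<Longrightarrow> (\<Sum>i\<in>I. c i * f i x) = 0" for x
    using f by (intro sum.neutral) (auto simp: dirichlet_fun_def)
  have C: "C2_on S (f i) (D i) (D2 i)" if "i \<in> I" for i using f[OF that] by (simp add: dirichlet_fun_def)
  show "C2_on S (\<lambda>x. \<Sum>i\<in>I. c i * f i x) (\<lambda>b x. \<Sum>i\<in>I. c i * D i b x) (\<lambda>b x. \<Sum>i\<in>I. c i * D2 i b x)"
    unfolding C2_on_def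
  proof (intro conjI ballI)
    fix x assume x: "x \<in> S"
    have "((\<lambda>x. \<Sum>i\<in>I. c i * f i x) has_derivative (\<lambda>h. \<Sum>i\<in>I. c i * (\<Sum>b\<in>Basis. (h \<bullet> b) * D i b x))) (at x)"
      using C x by (intro has_derivative_sum has_derivative_mult_right) (auto simp: C2_on_def)
    moreover have "(\<Sum>i\<in>I. c i * (\<Sum>b\<in>Basis. (h \<bullet> b) * D i b x)) = (\<Sum>b\<in>Basis. (h \<bullet> b) * (\<Sum>i\<in>I. c i * D i b x))" for h
      unfolding sum_distrib_left by (subst sum.swap) (simp add: mult_ac)
    ultimately show "((\<lambda>x. \<Sum>i\<in>I. c i * f i x) has_derivative (\<lambda>h. \<Sum>b\<in>Basis. (h \<bullet> b) * (\<Sum>i\<in>I. c i * D i b x))) (at x)"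
      by simp
  next
    fix b :: 'a assume b: "b \<in> Basis"
    note V = C2_onD[OF C b]
    show "continuous_on S (\<lambda>x. \<Sum>i\<in>I. c i * D i b x)" "continuous_on S (\<lambda>x. \<Sum>i\<in>I. c i * D2 i b x)"
      by (intro continuous_intros V; assumption)+
    show "has_dir_deriv S b (\<lambda>x. \<Sum>i\<in>I. c i * D i b x) (\<lambda>x. \<Sum>i\<in>I. c i * D2 i b x)"
      using V(3) unfolding has_dir_deriv_def by (auto intro!: DERIV_sum DERIV_cmult)
  qed
qed

section \<open>The square root of the Laplacian on dilated functions\<close>

text \<open>The left-hand side is the minimum of the right-hand side over \<open>e\<close>, attained
  at \<open>e = a * d / (a + r)\<close>; the difference is a square. This is the variational form of
  a resolvent in one spectral coordinate.\<close>

lemma inf_convolution_le: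
  fixes a r d e :: real
  assumes "a > 0" "r > 0"
  shows "d\<^sup>2 * (a * r / (a + r)) \<le> a * (d - e)\<^sup>2 + r * e\<^sup>2"
proof -
  have "(a * (d - e)\<^sup>2 + r * e\<^sup>2) * (a + r) - d\<^sup>2 * (a * r) = (a * (d - e) - r * e)\<^sup>2"
    by (simp add: power2_eq_square algebra_simps)
  then have "d\<^sup>2 * (a * r) \<le> (a * (d - e)\<^sup>2 + r * e\<^sup>2) * (a + r)"
    using zero_le_power2[of "a * (d - e) - r * e"] by linarith
  then show ?thesis using assms by (simp add: pos_divide_le_eq)
qed

text \<open>The representation \<open>sqrt a = (2 / pi) * \<integral>y>0. a / (a + y\<^sup>2)\<close> transfers an inequality between
  resolvents to square roots.\<close>

lemma sum_sqrt_le: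
  fixes a b p q :: "nat \<Rightarrow> real"
  assumes a: "\<And>j. j < J \<Longrightarrow> a j > 0" and b: "\<And>i. i < N \<Longrightarrow> b i > 0"
    and le: "\<And>y. y > 0 \<Longrightarrow> (\<Sum>j<J. p j * (a j / (a j + y\<^sup>2))) \<le> (\<Sum>i<N. q i * (b i / (b i + y\<^sup>2)))"
  shows "(\<Sum>j<J. p j * sqrt (a j)) \<le> (\<Sum>i<N. q i * sqrt (b i))"
proof -
  \<comment> \<open>The antiderivative of \<open>c / (c + y\<^sup>2)\<close> in \<open>y\<close>
    that vanishes at 0; its limit at infinity is \<open>sqrt c * (pi / 2)\<close>.\<close>
  define h where "h c y = sqrt c * arctan (y / sqrt c)" for c y :: real
  have dh: "(h c has_real_derivative c / (c + y\<^sup>2)) (at y)" if "c > 0" for c y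
  proof -
    have "c + y\<^sup>2 > 0" using that by (simp add: add_pos_nonneg)
    moreover have "((\<lambda>y. sqrt c * arctan (y / sqrt c)) has_real_derivative
        sqrt c * (inverse (1 + (y / sqrt c)\<^sup>2) * (1 / sqrt c))) (at y)"
      by (intro DERIV_cmult DERIV_chain2[OF DERIV_arctan] DERIV_cdivide DERIV_ident)
    moreover have "sqrt c * (inverse (1 + (y / sqrt c)\<^sup>2) * (1 / sqrt c)) = inverse (1 + y\<^sup>2 / c)"
      using that by (simp add: power_divide)
    moreover have "inverse (1 + y\<^sup>2 / c) = c / (c + y\<^sup>2)"
      using that by (simp add: add_divide_distrib[symmetric] divide_simps)
    ultimately show ?thesis by (simp add: h_def[abs_def])
  qed
  have lim_h: "(h c \<longlongrightarrow> sqrt c * (pi / 2)) at_top" if "c > 0" for c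
  proof -
    have "filterlim (\<lambda>y. inverse (sqrt c) * y) at_top at_top"
      by (rule filterlim_tendsto_pos_mult_at_top[OF tendsto_const _ filterlim_ident]) (use that in simp)
    from tendsto_mult_left[OF filterlim_compose[OF tendsto_arctan_at_top this], of "sqrt c"]
    show ?thesis unfolding h_def divide_inverse_commute[of _ "sqrt c"] .
  qed
  \<comment> \<open>Improper integrals are avoided: the hypothesis says that \<open>\<Phi>\<close>
    is increasing on the positive axis, so its limit at infinity is at least
    \<open>\<Phi> 0 = 0\<close>.\<close>
  define \<Phi> where "\<Phi> y = (\<Sum>i<N. q i * h (b i) y) - (\<Sum>j<J. p j * h (a j) y)" for y
  have d\<Phi>: "(\<Phi> has_real_derivative (\<Sum>i<N. q i * (b i / (b i + y\<^sup>2))) - (\<Sum>j<J. p j * (a j / (a j + y\<^sup>2)))) (at y)" for y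
    unfolding \<Phi>_def[abs_def] by (intro DERIV_diff DERIV_sum DERIV_cmult dh) (use a b in auto)
  have "0 \<le> \<Phi> y" if "y > 0" for y
  proof -
    have "\<Phi> 0 \<le> \<Phi> y"
    proof (rule DERIV_nonneg_imp_increasing_open[of 0 y \<Phi>])
      show "\<exists>d. (\<Phi> has_real_derivative d) (at x) \<and> 0 \<le> d" if "0 < x" "x < y" for x
        using d\<Phi>[of x] le[OF that(1)] by auto
      show "continuous_on {0..y} \<Phi>"
        using d\<Phi> by (meson DERIV_isCont continuous_at_imp_continuous_on)
    qed (use that in auto)
    then show ?thesis by (simp add: \<Phi>_def h_def)
  qed
  moreover have "(\<Phi> \<longlongrightarrow> (\<Sum>i<N. q i * (sqrt (b i) * (pi / 2))) - (\<Sum>j<J. p j * (sqrt (a j) * (pi / 2)))) at_top"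
    unfolding \<Phi>_def by (intro tendsto_diff tendsto_sum tendsto_mult_left lim_h) (use a b in auto)
  ultimately have "0 \<le> (\<Sum>i<N. q i * (sqrt (b i) * (pi / 2))) - (\<Sum>j<J. p j * (sqrt (a j) * (pi / 2)))"
    by (intro tendsto_lowerbound[of \<Phi> _ at_top]) (auto intro: eventually_mono[OF eventually_gt_at_top[of 0]])
  then have "(\<Sum>j<J. p j * sqrt (a j)) * (pi / 2) \<le> (\<Sum>i<N. q i * sqrt (b i)) * (pi / 2)"
    by (simp only: sum_distrib_right mult.assoc)
  then show ?thesis by (rule mult_right_le_imp_le) simp
qed

text \<open>The eigensystem restated for functions on the whole space that vanish off the domain, so
  that dilations act without change of measure space. Completeness enters in the form of Parseval's
  identity.\<close>

locale dirichlet_system =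
  fixes \<Omega> :: "'a::euclidean_space set" and lam :: "nat \<Rightarrow> real" and e :: "nat \<Rightarrow> 'a \<Rightarrow> real"
    and De D2e :: "nat \<Rightarrow> 'a \<Rightarrow> 'a \<Rightarrow> real"
  assumes dirichlet: "\<And>j. dirichlet_fun \<Omega> (e j) (De j) (D2e j)"
    and eig: "\<And>j x. x \<in> \<Omega> \<Longrightarrow> lam j * e j x = - (\<Sum>b\<in>Basis. D2e j b x)"
    and orth: "\<And>i j. ip lborel (e i) (e j) = (if i = j then 1 else 0)"
    and parseval: "\<And>f g. sq_integrable lborel f \<Longrightarrow> sq_integrable lborel g \<Longrightarrow>
      (\<And>x. x \<notin> \<Omega> \<Longrightarrow> f x = 0) \<Longrightarrow> (\<And>x. x \<notin> \<Omega> \<Longrightarrow> g x = 0) \<Longrightarrow>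
      (\<lambda>j. ip lborel f (e j) * ip lborel g (e j)) sums ip lborel f g"
    and star: "\<And>x t. x \<in> \<Omega> \<Longrightarrow> 0 \<le> t \<Longrightarrow> t \<le> 1 \<Longrightarrow> t *\<^sub>R x \<in> \<Omega>"
begin

lemma e_sq: "sq_integrable lborel (e j)"
  using dirichlet_fun.sq_int[OF dirichlet] .

lemma e_zero: "x \<notin> \<Omega> \<Longrightarrow> e j x = 0"
  using dirichlet_fun.zero[OF dirichlet] .

lemma in_ball: obtains R where "R > 0" "\<Omega> \<subseteq> cball 0 R"
proof -
  obtain R where "\<forall>x\<in>\<Omega>. norm x \<le> R"
    using dirichlet_fun.bounded_S[OF dirichlet] by (auto simp: bounded_iff)
  then show thesis by (intro that[of "max 1 R"]) (auto intro: max.coboundedI2)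
qed

lemma ip_e_lam: "(\<integral>x. e j x * (lam j * e j x) \<partial>lborel) = lam j"
proof -
  have "(\<integral>x. e j x * (lam j * e j x) \<partial>lborel) = lam j * ip lborel (e j) (e j)"
    unfolding ip_def by (simp add: mult_ac flip: Bochner_Integration.integral_mult_right_zero)
  then show ?thesis by (simp add: orth)
qed

lemma e_lam_integrable: "integrable lborel (\<lambda>x. e j x * (lam j * e j x))"
  by (intro sq_integrable_mult sq_integrable_cmult e_sq)

lemma lam_nonneg: "0 \<le> lam j"
  using dirichlet_fun.energy_nonneg[OF dirichlet eig e_lam_integrable, of j] by (simp add: ip_e_lam)

text \<open>A zero eigenvalue would make the dilation estimate force \<open>e j\<close> to coincide
  in L2 with its dilate by \<open>exp 1\<close>, whose norm is strictly smaller. Strictness matters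
  in the end, where it gives \<open>s j > m\<close>.\<close>

lemma lam_pos: "0 < lam j"
proof (rule ccontr)
  assume "\<not> 0 < lam j"
  then have 0: "lam j = 0" using lam_nonneg[of j] by simp
  obtain R where R: "R > 0" "\<Omega> \<subseteq> cball 0 R" by (rule in_ball)
  let ?d = "\<lambda>x. e j (exp 1 *\<^sub>R x)"
  have d: "sq_integrable lborel ?d" by (rule sq_integrable_dilate[OF e_sq]) simp
  have "l2norm lborel (\<lambda>x. ?d x - e j x) \<le> 1 * R * sqrt (lam j)"
    using dirichlet_fun.l2norm_dilate_diff[OF dirichlet eig e_lam_integrable R(2,1), of 1 j]
    by (simp add: ip_e_lam)
  then have "l2norm lborel (\<lambda>x. e j x - ?d x) = 0"
    using 0 by (simp add: l2norm_minus_commute[of _ "e j"] order_antisym)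
  then have "l2norm lborel (e j) \<le> l2norm lborel ?d"
    using l2norm_triangle[OF sq_integrable_diff[OF e_sq d] d, of j] by simp
  then have "1 \<le> (l2norm lborel ?d)\<^sup>2" by (simp add: l2norm_def[of _ "e j"] orth)
  moreover have "(l2norm lborel ?d)\<^sup>2 = 1 / exp 1 ^ DIM('a)"
    by (simp add: l2norm_power2 ip_dilate[OF e_sq e_sq] orth)
  moreover have "(exp 1 :: real) ^ DIM('a) > 1" by (intro one_less_power) auto
  then have "1 / (exp 1 :: real) ^ DIM('a) < 1" by (intro divide_less_eq_1_pos[THEN iffD2]) linarith+
  ultimately show False by linarith
qed

lemma bessel:
  assumes "sq_integrable lborel f" "\<And>x. x \<notin> \<Omega> \<Longrightarrow> f x = 0"
  shows "(\<Sum>j<J. (ip lborel f (e j))\<^sup>2) \<le> ip lborel f f"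
proof -
  have sums: "(\<lambda>j. (ip lborel f (e j))\<^sup>2) sums ip lborel f f"
    using parseval[OF assms(1,1) assms(2,2)] by (simp add: power2_eq_square)
  show ?thesis
    using sum_le_suminf[OF sums_summable[OF sums], of "{..<J}"] sums_unique[OF sums] by simp
qed

text \<open>The Dirichlet form does not increase when a function on \<open>S\<close> is regarded as
  a function on the larger domain. A truncation is C2 with compact support, so its Laplacian is in
  L2 and Parseval identifies its spectral energy with its gradient energy; with \<open>J\<close>
  fixed, the coefficients then pass to the limit.\<close>

lemma spectral_energy_le:
  assumes v: "dirichlet_fun S v D D2" and S: "S \<subseteq> \<Omega>"
    and G: "\<And>x. x \<in> S \<Longrightarrow> G x = - (\<Sum>b\<in>Basis. D2 b x)" "integrable lborel (\<lambda>x. v x * G x)"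
  shows "(\<Sum>j<J. lam j * (ip lborel v (e j))\<^sup>2) \<le> (\<integral>x. v x * G x \<partial>lborel)"
proof -
  interpret v: dirichlet_fun S v D D2 by fact
  have le: "(\<Sum>j<J. lam j * (ip lborel (v.trunc_seq n) (e j))\<^sup>2) \<le> (\<integral>x. v.trunc_seq n x * - (\<Sum>b\<in>Basis. D2 b x) \<partial>lborel)" for n
  proof -
    let ?e = "1 / real (Suc n)"
    have e0: "?e > 0" by simp
    note K = v.compact_supp[OF e0] and off = v.w_off_supp[OF e0] and C2 = v.C2_w[OF e0]
    let ?w = "v.w ?e" and ?L = "\<lambda>x. \<Sum>b\<in>Basis. v.D2w ?e b x"
    have K\<Omega>: "v.supp ?e \<subseteq> \<Omega>" using v.supp_subset[OF e0] S by blast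
    have w: "sq_integrable lborel ?w" by (rule v.sq_int_w[OF e0])
    have w0: "?w x = 0" if "x \<notin> \<Omega>" for x using off(1) K\<Omega> that by blast
    have L0': "?L x = 0" if "x \<notin> v.supp ?e" for x by (simp only: off(3)[OF that] sum.neutral_const)
    have L0: "?L x = 0" if "x \<notin> \<Omega>" for x by (rule L0') (use K\<Omega> that in blast)
    have L: "sq_integrable lborel ?L"
      by (rule sq_integrable_compact_support[OF _ K L0']) (intro continuous_on_sum C2_onD(5)[OF C2])
    \<comment> \<open>Both derivatives are moved from the eigenfunction to the truncation. Off the
      domain \<open>D2e\<close> has no meaning, but the truncation is 0 there.\<close>
    have ev: "lam j * ip lborel ?w (e j) = - ip lborel ?L (e j)" for j
    proof -
      have "ip lborel ?L (e j) = (\<integral>x. ?w x * (\<Sum>b\<in>Basis. D2e j b x) \<partial>lborel)"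
        unfolding ip_def
        by (rule integral_laplacian_swap[symmetric, OF _ K K\<Omega> C2])
           (use off dirichlet_fun.C2[OF dirichlet] dirichlet_fun.open_S[OF dirichlet] in blast)+
      also have "\<dots> = (\<integral>x. - lam j * (?w x * e j x) \<partial>lborel)"
      proof (rule arg_cong[where f="integral\<^sup>L lborel"], rule ext)
        fix x
        show "?w x * (\<Sum>b\<in>Basis. D2e j b x) = - lam j * (?w x * e j x)"
        proof (cases "x \<in> \<Omega>")
          case True
          have "(\<Sum>b\<in>Basis. D2e j b x) = - (lam j * e j x)" using eig[OF True, of j] by simp
          then show ?thesis by (simp only:) (simp add: mult_ac)
        next
          case False
          show ?thesis unfolding w0[OF False] by simp
        qed
      qed
      finally show ?thesis by (simp add: ip_def)
    qed
    have "(\<lambda>j. ip lborel ?L (e j) * ip lborel ?w (e j)) sums ip lborel ?L ?w"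
      by (rule parseval[OF L w L0 w0])
    then have sums: "(\<lambda>j. lam j * (ip lborel ?w (e j))\<^sup>2) sums - ip lborel ?L ?w"
      using sums_minus[of "\<lambda>j. ip lborel ?L (e j) * ip lborel ?w (e j)"] ev
      by (simp add: power2_eq_square flip: mult.assoc)
    have "(\<Sum>j<J. lam j * (ip lborel ?w (e j))\<^sup>2) \<le> - ip lborel ?L ?w"
      using sum_le_suminf[OF sums_summable[OF sums], of "{..<J}"] sums_unique[OF sums] lam_nonneg by simp
    also have "- ip lborel ?L ?w = (\<integral>x. (\<Sum>b\<in>Basis. (v.Dw ?e b x)\<^sup>2) \<partial>lborel)"
    proof -
      have "(\<integral>x. ?w x * ?L x \<partial>lborel) = - (\<integral>x. (\<Sum>b\<in>Basis. (v.Dw ?e b x)\<^sup>2) \<partial>lborel)"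
        by (rule integral_laplacian_self(1)[OF K C2]) (erule off)+
      then show ?thesis by (simp only: ip_commute[of lborel ?L ?w]) (simp only: ip_def minus_minus)
    qed
    also have "\<dots> \<le> (\<integral>x. ?w x * - (\<Sum>b\<in>Basis. D2 b x) \<partial>lborel)"
      by (rule v.energy_w_le(1)[OF e0])
    finally show ?thesis .
  qed
  have "(\<lambda>n. \<Sum>j<J. lam j * (ip lborel (v.trunc_seq n) (e j))\<^sup>2) \<longlonglongrightarrow> (\<Sum>j<J. lam j * (ip lborel v (e j))\<^sup>2)"
    by (intro tendsto_sum tendsto_mult_left tendsto_power tendsto_ip_left v.sq_int e_sq v.sq_int_w v.l2norm_trunc_seq) simp
  from LIMSEQ_le[OF this v.energy_limit[OF G]] le show ?thesis by blast
qed

section \<open>Finite eigenfunction combinations and their dilates\<close>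

definition comb :: "(nat \<Rightarrow> real) \<Rightarrow> nat \<Rightarrow> 'a \<Rightarrow> real" where
  "comb c N x = (\<Sum>i<N. c i * e i x)"

lemma comb_sq: "sq_integrable lborel (comb c N)"
  unfolding comb_def[abs_def] by (intro sq_integrable_sum sq_integrable_cmult e_sq)

lemma comb_zero: "x \<notin> \<Omega> \<Longrightarrow> comb c N x = 0"
  by (simp add: comb_def e_zero)

lemma ip_comb: "ip lborel (comb c N) (comb d N) = (\<Sum>i<N. c i * d i)"
  unfolding comb_def[abs_def] by (rule ip_orthonormal_sum(1)[OF e_sq orth]) simp

lemma comb_diff: "comb c N x - comb d N x = comb (\<lambda>i. c i - d i) N x"
  by (simp add: comb_def sum_subtractf left_diff_distrib)

lemma dirichlet_comb:
  assumes "N > 0"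
  shows "dirichlet_fun \<Omega> (comb c N) (\<lambda>b x. \<Sum>i<N. c i * De i b x) (\<lambda>b x. \<Sum>i<N. c i * D2e i b x)"
  unfolding comb_def[abs_def] by (rule dirichlet_fun_sum[OF dirichlet]) (use assms in auto)

lemma laplacian_comb:
  assumes "x \<in> \<Omega>"
  shows "comb (\<lambda>i. c i * lam i) N x = - (\<Sum>b\<in>Basis. \<Sum>i<N. c i * D2e i b x)"
proof -
  have "(\<Sum>b\<in>Basis. \<Sum>i<N. c i * D2e i b x) = (\<Sum>i<N. c i * (\<Sum>b\<in>Basis. D2e i b x))"
    by (subst sum.swap) (simp add: sum_distrib_left)
  also have "\<dots> = (\<Sum>i<N. - (c i * lam i * e i x))"
  proof (intro sum.cong refl)
    fix i
    have "(\<Sum>b\<in>Basis. D2e i b x) = - (lam i * e i x)" using eig[OF assms, of i] by simp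
    then show "c i * (\<Sum>b\<in>Basis. D2e i b x) = - (c i * lam i * e i x)" by simp
  qed
  finally show ?thesis by (simp add: comb_def sum_negf)
qed

text \<open>This is where star-shapedness acts: a function vanishing off the domain still does so
  after dilation by \<open>k \<ge> 1\<close>.\<close>

lemma vimage_subset: "k \<ge> 1 \<Longrightarrow> (\<lambda>x. k *\<^sub>R x) -` \<Omega> \<subseteq> \<Omega>"
proof
  fix x assume "k \<ge> 1" "x \<in> (\<lambda>x. k *\<^sub>R x) -` \<Omega>"
  then show "x \<in> \<Omega>" using star[of "k *\<^sub>R x" "1 / k"] by simp
qed

lemma dilate_zero: "k \<ge> 1 \<Longrightarrow> (\<And>x. x \<notin> \<Omega> \<Longrightarrow> f x = 0) \<Longrightarrow> x \<notin> \<Omega> \<Longrightarrow> f (k *\<^sub>R x) = 0"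
  using vimage_subset by blast

text \<open>The factor \<open>k\<^sup>2\<close> comes from the Laplacian of the dilate, the power of
  \<open>k\<close> in the denominator from the change of variables.\<close>

lemma energy_dilate_comb:
  assumes k: "k \<ge> 1"
  shows "(\<Sum>j<J. lam j * (ip lborel (\<lambda>x. comb c N (k *\<^sub>R x)) (e j))\<^sup>2)
     \<le> k\<^sup>2 * (\<Sum>i<N. lam i * (c i)\<^sup>2) / k ^ DIM('a)"
proof (cases "N = 0")
  case True
  then show ?thesis by (simp add: comb_def ip_def)
next
  case False
  have k0: "k > 0" using k by simp
  let ?g = "comb (\<lambda>i. c i * lam i) N"
  note v = dirichlet_fun.dilated[OF dirichlet_comb k0, of N c]
  have int: "integrable lborel (\<lambda>x. comb c N (k *\<^sub>R x) * (k\<^sup>2 * ?g (k *\<^sub>R x)))"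
    by (intro sq_integrable_mult sq_integrable_cmult sq_integrable_dilate comb_sq k0)
  have "(\<Sum>j<J. lam j * (ip lborel (\<lambda>x. comb c N (k *\<^sub>R x)) (e j))\<^sup>2)
      \<le> (\<integral>x. comb c N (k *\<^sub>R x) * (k\<^sup>2 * ?g (k *\<^sub>R x)) \<partial>lborel)"
  proof (rule spectral_energy_le[OF v vimage_subset[OF k] _ int])
    show "0 < N" using False by simp
    show "k\<^sup>2 * ?g (k *\<^sub>R x) = - (\<Sum>b\<in>Basis. k\<^sup>2 * (\<Sum>i<N. c i * D2e i b (k *\<^sub>R x)))"
      if "x \<in> (\<lambda>x. k *\<^sub>R x) -` \<Omega>" for x
      using that by (simp add: laplacian_comb sum_distrib_left)
  qed
  also have "\<dots> = k\<^sup>2 * ip lborel (\<lambda>x. comb c N (k *\<^sub>R x)) (\<lambda>x. ?g (k *\<^sub>R x))"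
    unfolding ip_def by (simp add: mult_ac flip: Bochner_Integration.integral_mult_right_zero)
  also have "\<dots> = k\<^sup>2 * (\<Sum>i<N. lam i * (c i)\<^sup>2) / k ^ DIM('a)"
    by (simp add: ip_dilate[OF comb_sq comb_sq k0] ip_comb power2_eq_square mult_ac)
  finally show ?thesis .
qed

lemma bessel_dilate_comb:
  assumes k: "k \<ge> 1"
  shows "(\<Sum>j<J. (ip lborel (\<lambda>x. comb c N (k *\<^sub>R x)) (e j))\<^sup>2) \<le> (\<Sum>i<N. (c i)\<^sup>2) / k ^ DIM('a)"
proof -
  have k0: "k > 0" using k by simp
  have "(\<Sum>j<J. (ip lborel (\<lambda>x. comb c N (k *\<^sub>R x)) (e j))\<^sup>2)
      \<le> ip lborel (\<lambda>x. comb c N (k *\<^sub>R x)) (\<lambda>x. comb c N (k *\<^sub>R x))"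
    by (rule bessel[OF sq_integrable_dilate[OF comb_sq k0]])
       (rule dilate_zero[of k "comb c N", OF k comb_zero])
  also have "\<dots> = (\<Sum>i<N. (c i)\<^sup>2) / k ^ DIM('a)"
    by (simp add: ip_dilate[OF comb_sq comb_sq k0] ip_comb power2_eq_square)
  finally show ?thesis .
qed

text \<open>The quadratic form of \<open>sqrt (- \<Delta> + m\<^sup>2)\<close> on a dilated function is at most that of the same
  operator on the dilated domain.  The optimal decomposition of the coefficients \<open>c i\<close> for the
  resolvent of the latter is a competitor for the former.\<close>

lemma sqrt_form_dilate_comb:
  assumes k: "k \<ge> 1" and m: "m > 0"
  shows "(\<Sum>j<J. (ip lborel (\<lambda>x. comb c N (k *\<^sub>R x)) (e j))\<^sup>2 * sqrt (lam j + m\<^sup>2))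
     \<le> (\<Sum>i<N. (c i)\<^sup>2 / k ^ DIM('a) * sqrt (k\<^sup>2 * lam i + m\<^sup>2))"
proof (rule sum_sqrt_le)
  have k0: "k > 0" using k by simp
  define P where "P = k ^ DIM('a)"
  have P: "P > 0" using k0 by (simp add: P_def)
  show a: "0 < lam j + m\<^sup>2" for j using lam_nonneg[of j] m by (simp add: add_nonneg_pos)
  show b: "0 < k\<^sup>2 * lam i + m\<^sup>2" for i using lam_nonneg[of i] m by (simp add: add_nonneg_pos)
  fix y :: real assume y: "y > 0"
  define r where "r = y\<^sup>2"
  have r: "r > 0" using y by (simp add: r_def)
  define B where "B i = k\<^sup>2 * lam i + m\<^sup>2" for i
  \<comment> \<open>The minimiser in \<open>inf_convolution_le\<close> for the eigenvalue
    \<open>B i\<close> of the dilated operator. With it that inequality becomes an equality, proved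
    as \<open>eq\<close> below, so nothing is lost on the right-hand side.\<close>
  define \<theta> where "\<theta> i = B i / (B i + r)" for i
  define d where "d j = ip lborel (\<lambda>x. comb c N (k *\<^sub>R x)) (e j)" for j
  define z where "z j = ip lborel (\<lambda>x. comb (\<lambda>i. c i * \<theta> i) N (k *\<^sub>R x)) (e j)" for j
  have dz: "d j - z j = ip lborel (\<lambda>x. comb (\<lambda>i. c i - c i * \<theta> i) N (k *\<^sub>R x)) (e j)" for j
    unfolding d_def z_def comb_diff[symmetric]
    by (rule ip_diff_left[symmetric]) (intro sq_integrable_dilate comb_sq e_sq k0)+
  \<comment> \<open>Multiplication by \<open>r\<close> brings the quotient into the form
    \<open>a * r / (a + r)\<close>. The \<open>z j\<close>, which are not optimal for the original
    domain, serve as competitors.\<close>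
  have "r * (\<Sum>j<J. (d j)\<^sup>2 * ((lam j + m\<^sup>2) / (lam j + m\<^sup>2 + r)))
      = (\<Sum>j<J. (d j)\<^sup>2 * ((lam j + m\<^sup>2) * r / (lam j + m\<^sup>2 + r)))"
    by (simp add: sum_distrib_left mult_ac)
  also have "\<dots> \<le> (\<Sum>j<J. (lam j + m\<^sup>2) * (d j - z j)\<^sup>2 + r * (z j)\<^sup>2)"
    by (intro sum_mono inf_convolution_le a r)
  also have "\<dots> = (\<Sum>j<J. lam j * (d j - z j)\<^sup>2) + m\<^sup>2 * (\<Sum>j<J. (d j - z j)\<^sup>2) + r * (\<Sum>j<J. (z j)\<^sup>2)"
    by (simp add: sum.distrib sum_distrib_left distrib_right)
  also have "\<dots> \<le> k\<^sup>2 * (\<Sum>i<N. lam i * (c i - c i * \<theta> i)\<^sup>2) / P + m\<^sup>2 * ((\<Sum>i<N. (c i - c i * \<theta> i)\<^sup>2) / P)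
      + r * ((\<Sum>i<N. (c i * \<theta> i)\<^sup>2) / P)"
    unfolding dz P_def unfolding z_def using r
    by (intro add_mono mult_left_mono energy_dilate_comb bessel_dilate_comb k) auto
  also have "\<dots> = (\<Sum>i<N. (k\<^sup>2 * (lam i * (c i - c i * \<theta> i)\<^sup>2) + m\<^sup>2 * (c i - c i * \<theta> i)\<^sup>2 + r * (c i * \<theta> i)\<^sup>2) / P)"
    by (simp add: sum.distrib sum_distrib_left sum_divide_distrib add_divide_distrib)
  also have "\<dots> = (\<Sum>i<N. r * ((c i)\<^sup>2 / P * (B i / (B i + r))))"
  proof (intro sum.cong refl)
    fix i
    have B: "B i + r > 0" using b[of i] r by (simp add: B_def)
    have eq: "B i * (1 - \<theta> i)\<^sup>2 + r * (\<theta> i)\<^sup>2 = r * \<theta> i"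
    proof -
      have 1: "1 - \<theta> i = r / (B i + r)" using B by (simp add: \<theta>_def field_simps)
      have "B i * (1 - \<theta> i)\<^sup>2 + r * (\<theta> i)\<^sup>2 = r * B i * (B i + r) / (B i + r)\<^sup>2"
        unfolding 1 unfolding \<theta>_def by (simp add: power_divide add_divide_distrib[symmetric]) (simp add: power2_eq_square algebra_simps)
      also have "\<dots> = r * \<theta> i" using B by (simp add: power2_eq_square \<theta>_def)
      finally show ?thesis .
    qed
    have "k\<^sup>2 * (lam i * (c i - c i * \<theta> i)\<^sup>2) + m\<^sup>2 * (c i - c i * \<theta> i)\<^sup>2 + r * (c i * \<theta> i)\<^sup>2
        = (c i)\<^sup>2 * (B i * (1 - \<theta> i)\<^sup>2 + r * (\<theta> i)\<^sup>2)"
      by (simp add: B_def power2_eq_square algebra_simps)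
    also have "\<dots> = (c i)\<^sup>2 * (r * \<theta> i)" by (simp only: eq)
    finally show "(k\<^sup>2 * (lam i * (c i - c i * \<theta> i)\<^sup>2) + m\<^sup>2 * (c i - c i * \<theta> i)\<^sup>2 + r * (c i * \<theta> i)\<^sup>2) / P
        = r * ((c i)\<^sup>2 / P * (B i / (B i + r)))"
      by (simp add: \<theta>_def mult_ac)
  qed
  also have "\<dots> = r * (\<Sum>i<N. (c i)\<^sup>2 / P * (B i / (B i + r)))"
    by (rule sum_distrib_left[symmetric])
  finally have "(\<Sum>j<J. (d j)\<^sup>2 * ((lam j + m\<^sup>2) / (lam j + m\<^sup>2 + r))) \<le> (\<Sum>i<N. (c i)\<^sup>2 / P * (B i / (B i + r)))"
    by (rule mult_left_le_imp_le[OF _ r])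
  then show "(\<Sum>j<J. (ip lborel (\<lambda>x. comb c N (k *\<^sub>R x)) (e j))\<^sup>2 * ((lam j + m\<^sup>2) / (lam j + m\<^sup>2 + y\<^sup>2)))
      \<le> (\<Sum>i<N. (c i)\<^sup>2 / k ^ DIM('a) * ((k\<^sup>2 * lam i + m\<^sup>2) / (k\<^sup>2 * lam i + m\<^sup>2 + y\<^sup>2)))"
    by (simp only: d_def B_def P_def r_def)
qed

end

section \<open>The Pohozaev inequality\<close>

text \<open>Concavity of the square root, obtained from the square of
  \<open>sqrt b - sqrt a\<close>. It will extract the first-order effect of replacing
  \<open>m\<^sup>2\<close> by \<open>m\<^sup>2 / k\<^sup>2\<close>.\<close>

lemma sqrt_le_tangent:
  fixes a b :: real
  assumes "a > 0" "b \<ge> 0"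
  shows "sqrt b \<le> sqrt a + (b - a) / (2 * sqrt a)"
proof -
  have "0 \<le> (sqrt b - sqrt a)\<^sup>2" by simp
  also have "\<dots> = b + a - 2 * (sqrt a * sqrt b)"
    using assms by (simp add: power2_diff mult_ac)
  finally have "sqrt b * (2 * sqrt a) \<le> 2 * a + (b - a)" by (simp add: mult_ac)
  then have "sqrt b \<le> (2 * a + (b - a)) / (2 * sqrt a)"
    using assms by (simp add: pos_le_divide_eq)
  also have "\<dots> = a / sqrt a + (b - a) / (2 * sqrt a)"
    using add_divide_distrib[of "2 * a" "b - a" "2 * sqrt a"] by (simp only: mult_divide_mult_cancel_left)
  also have "a / sqrt a = sqrt a" using assms by (simp add: real_div_sqrt)
  finally show ?thesis .
qed

context dirichlet_system
begin

lemma tendsto_comb_coeff: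
  assumes u: "sq_integrable lborel u" "\<And>x. x \<notin> \<Omega> \<Longrightarrow> u x = 0"
  shows "(\<lambda>N. l2norm lborel (\<lambda>x. comb (\<lambda>i. ip lborel u (e i)) N x - u x)) \<longlonglongrightarrow> 0"
proof -
  let ?c = "\<lambda>i. ip lborel u (e i)"
  have "(\<lambda>i. (?c i)\<^sup>2) sums ip lborel u u"
    using parseval[OF u(1,1) u(2,2)] by (simp add: power2_eq_square)
  then have lim: "(\<lambda>N. \<Sum>i<N. (?c i)\<^sup>2) \<longlonglongrightarrow> ip lborel u u" by (simp add: sums_def)
  have eq: "ip lborel (\<lambda>x. comb ?c N x - u x) (\<lambda>x. comb ?c N x - u x) = ip lborel u u - (\<Sum>i<N. (?c i)\<^sup>2)" for N
  proof -
    have cu: "ip lborel (comb ?c N) u = (\<Sum>i<N. (?c i)\<^sup>2)"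
      unfolding comb_def[abs_def]
      by (subst ip_sum_left[OF sq_integrable_cmult[OF e_sq] u(1)])
         (simp add: ip_cmult_left ip_commute[of _ "e _" u] power2_eq_square)
    have "ip lborel (\<lambda>x. comb ?c N x - u x) (\<lambda>x. comb ?c N x - u x)
        = ip lborel (comb ?c N) (\<lambda>x. comb ?c N x - u x) - ip lborel u (\<lambda>x. comb ?c N x - u x)"
      by (rule ip_diff_left[OF comb_sq u(1) sq_integrable_diff[OF comb_sq u(1)]])
    also have "ip lborel (comb ?c N) (\<lambda>x. comb ?c N x - u x) = ip lborel (comb ?c N) (comb ?c N) - ip lborel u (comb ?c N)"
      by (subst ip_commute) (rule ip_diff_left[OF comb_sq u(1) comb_sq])
    also have "ip lborel u (\<lambda>x. comb ?c N x - u x) = ip lborel (comb ?c N) u - ip lborel u u"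
      by (subst ip_commute) (rule ip_diff_left[OF comb_sq u(1) u(1)])
    finally show ?thesis
      by (simp add: cu ip_comb ip_commute[of _ u "comb ?c N"] power2_eq_square)
  qed
  have "(\<lambda>N. ip lborel u u - (\<Sum>i<N. (?c i)\<^sup>2)) \<longlonglongrightarrow> ip lborel u u - ip lborel u u"
    by (intro tendsto_intros lim)
  then have "(\<lambda>N. sqrt (ip lborel u u - (\<Sum>i<N. (?c i)\<^sup>2))) \<longlonglongrightarrow> sqrt 0"
    by (intro tendsto_real_sqrt) simp
  then show ?thesis by (simp add: l2norm_def eq)
qed

lemma l2norm_dilate_diff_comb:
  assumes R: "R > 0" "\<Omega> \<subseteq> cball 0 R" and s: "s > 0"
  shows "l2norm lborel (\<lambda>x. comb c N (exp s *\<^sub>R x) - comb c N x) \<le> s * R * sqrt (\<Sum>i<N. lam i * (c i)\<^sup>2)"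
proof (cases "N = 0")
  case True
  then show ?thesis by (simp add: comb_def l2norm_def ip_def)
next
  case False
  let ?g = "comb (\<lambda>i. c i * lam i) N"
  have "(\<integral>x. comb c N x * ?g x \<partial>lborel) = (\<Sum>i<N. lam i * (c i)\<^sup>2)"
    using ip_comb[of c N "\<lambda>i. c i * lam i"] by (simp add: ip_def power2_eq_square mult_ac)
  moreover have "l2norm lborel (\<lambda>x. comb c N (exp s *\<^sub>R x) - comb c N x) \<le>
      s * R * sqrt (\<integral>x. comb c N x * ?g x \<partial>lborel)"
    by (rule dirichlet_fun.l2norm_dilate_diff[OF dirichlet_comb laplacian_comb sq_integrable_mult[OF comb_sq comb_sq] R(2,1) s])
       (use False in auto)
  ultimately show ?thesis by simp
qed

text \<open>The operator \<open>sqrt (- \<Delta> + m\<^sup>2)\<close> maps \<open>u\<close> to \<open>f\<close>.\<close>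

context
  fixes m :: real and u f :: "'a \<Rightarrow> real"
  assumes m: "m > 0"
    and u: "sq_integrable lborel u" "\<And>x. x \<notin> \<Omega> \<Longrightarrow> u x = 0"
    and f: "sq_integrable lborel f" "\<And>x. x \<notin> \<Omega> \<Longrightarrow> f x = 0"
    and uf: "\<And>j. ip lborel f (e j) = sqrt (lam j + m\<^sup>2) * ip lborel u (e j)"
begin

abbreviation c where "c j \<equiv> ip lborel u (e j)"
abbreviation s where "s j \<equiv> sqrt (lam j + m\<^sup>2)"

lemma lam_m_pos: "lam j + m\<^sup>2 > 0"
  using lam_nonneg[of j] m by (simp add: add_nonneg_pos)

lemma s_pos: "s j > 0"
  using lam_m_pos by simp

lemma s_ge_m: "m \<le> s j"
  using lam_nonneg[of j] by (intro real_le_rsqrt) simp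

lemma sums_form: "(\<lambda>j. s j * (c j)\<^sup>2) sums ip lborel f u"
  using parseval[OF f(1) u(1) f(2) u(2)] by (simp add: uf power2_eq_square mult.assoc)

lemma summable_inverse_form: "summable (\<lambda>j. (c j)\<^sup>2 / s j)"
proof (rule summable_comparison_test')
  have "(\<lambda>j. c j * c j) sums ip lborel u u"
    by (rule parseval[OF u(1,1) u(2,2)])
  then show "summable (\<lambda>j. (c j)\<^sup>2 / m)"
    by (auto simp: sums_iff power2_eq_square intro: summable_divide)
  show "norm ((c j)\<^sup>2 / s j) \<le> (c j)\<^sup>2 / m" if "j \<ge> 0" for j
    using s_ge_m[of j] m s_pos[of j] by (auto intro!: divide_left_mono mult_pos_pos)
qed

text \<open>The gain from half a derivative to a full one:
  \<open>(lam i + m\<^sup>2) * (c i)\<^sup>2\<close> is the square of the \<open>i\<close>-th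
  coefficient of \<open>f\<close>, and \<open>f\<close> is in L2.\<close>

lemma energy_le: "(\<Sum>i<N. lam i * (c i)\<^sup>2) \<le> ip lborel f f"
proof -
  have "(\<Sum>i<N. lam i * (c i)\<^sup>2) \<le> (\<Sum>i<N. (ip lborel f (e i))\<^sup>2)"
  proof (rule sum_mono)
    fix i
    have "lam i * (c i)\<^sup>2 \<le> (lam i + m\<^sup>2) * (c i)\<^sup>2" by (intro mult_right_mono) auto
    also have "\<dots> = (ip lborel f (e i))\<^sup>2"
      unfolding uf power_mult_distrib using lam_m_pos[of i] by simp
    finally show "lam i * (c i)\<^sup>2 \<le> (ip lborel f (e i))\<^sup>2" .
  qed
  also have "\<dots> \<le> ip lborel f f" by (rule bessel[OF f])
  finally show ?thesis .
qed

text \<open>A bound linear in \<open>t\<close> makes the quadratic remainder of the primitive of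
  order \<open>t\<^sup>2\<close>, so that it disappears in the first-order limit.\<close>

lemma l2norm_dilate_diff_solution:
  assumes R: "R > 0" "\<Omega> \<subseteq> cball 0 R" and t: "t > 0"
  shows "l2norm lborel (\<lambda>x. u (exp t *\<^sub>R x) - u x) \<le> t * R * l2norm lborel f"
proof -
  let ?d = "\<lambda>N. l2norm lborel (\<lambda>x. comb c N x - u x)"
  have bound: "l2norm lborel (\<lambda>x. u (exp t *\<^sub>R x) - u x) \<le> ?d N + t * R * l2norm lborel f + ?d N" for N
  proof -
    note us = sq_integrable_dilate[OF u(1), of "exp t"] and cs = sq_integrable_dilate[OF comb_sq, of "exp t"]
    have "l2norm lborel (\<lambda>x. u (exp t *\<^sub>R x) - u x) \<le>
       l2norm lborel (\<lambda>x. u (exp t *\<^sub>R x) - comb c N (exp t *\<^sub>R x)) + l2norm lborel (\<lambda>x. comb c N (exp t *\<^sub>R x) - u x)"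
      by (rule l2norm_triangle_diff) (use us cs u in auto)
    also have "l2norm lborel (\<lambda>x. comb c N (exp t *\<^sub>R x) - u x) \<le>
       l2norm lborel (\<lambda>x. comb c N (exp t *\<^sub>R x) - comb c N x) + ?d N"
      by (rule l2norm_triangle_diff) (use cs comb_sq u in auto)
    also have "l2norm lborel (\<lambda>x. u (exp t *\<^sub>R x) - comb c N (exp t *\<^sub>R x)) \<le> l2norm lborel (\<lambda>x. u x - comb c N x)"
      by (rule l2norm_dilate_le[of "\<lambda>x. u x - comb c N x"])
         (use sq_integrable_diff[OF u(1) comb_sq] t in auto)
    also have "l2norm lborel (\<lambda>x. u x - comb c N x) = ?d N" by (rule l2norm_minus_commute)
    also have "l2norm lborel (\<lambda>x. comb c N (exp t *\<^sub>R x) - comb c N x) \<le> t * R * sqrt (\<Sum>i<N. lam i * (c i)\<^sup>2)"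
      by (rule l2norm_dilate_diff_comb[OF R t])
    also have "\<dots> \<le> t * R * l2norm lborel f"
      unfolding l2norm_def using R t energy_le[of N] by (intro mult_left_mono real_sqrt_le_mono) auto
    finally show ?thesis by simp
  qed
  have "(\<lambda>N. ?d N + t * R * l2norm lborel f + ?d N) \<longlonglongrightarrow> 0 + t * R * l2norm lborel f + 0"
    by (intro tendsto_add tendsto_const tendsto_comb_coeff[OF u])
  then show ?thesis using bound by (intro LIMSEQ_le_const) auto
qed

text \<open>Taking \<open>k\<close> out of \<open>sqrt (k\<^sup>2 * lam i + m\<^sup>2)\<close>
  cancels one power of \<open>k\<close> in the denominator and leaves
  \<open>sqrt (lam i + m\<^sup>2 / k\<^sup>2)\<close>. The tangent at
  \<open>lam i + m\<^sup>2\<close> bounds this by \<open>s i\<close> minus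
  \<open>(1 - 1 / k\<^sup>2) * m\<^sup>2 / 2\<close> divided by \<open>s i\<close>.\<close>

lemma sqrt_form_dilate:
  assumes k: "k \<ge> 1"
  shows "(\<Sum>j<J. (ip lborel (\<lambda>x. u (k *\<^sub>R x)) (e j))\<^sup>2 * s j)
     \<le> (ip lborel f u - (1 - 1 / k\<^sup>2) * m\<^sup>2 / 2 * (\<Sum>j. (c j)\<^sup>2 / s j)) / k ^ (DIM('a) - 1)"
proof -
  have k0: "k > 0" using k by simp
  let ?\<kappa> = "(1 - 1 / k\<^sup>2) * m\<^sup>2 / 2"
  have le: "(\<Sum>j<J. (ip lborel (\<lambda>x. comb c N (k *\<^sub>R x)) (e j))\<^sup>2 * s j)
     \<le> ((\<Sum>i<N. s i * (c i)\<^sup>2) - ?\<kappa> * (\<Sum>i<N. (c i)\<^sup>2 / s i)) / k ^ (DIM('a) - 1)" for N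
  proof -
    have "(\<Sum>j<J. (ip lborel (\<lambda>x. comb c N (k *\<^sub>R x)) (e j))\<^sup>2 * s j)
        \<le> (\<Sum>i<N. (c i)\<^sup>2 / k ^ DIM('a) * sqrt (k\<^sup>2 * lam i + m\<^sup>2))"
      by (rule sqrt_form_dilate_comb[OF k m])
    also have "\<dots> \<le> (\<Sum>i<N. (s i * (c i)\<^sup>2 - ?\<kappa> * ((c i)\<^sup>2 / s i)) / k ^ (DIM('a) - 1))"
    proof (rule sum_mono)
      fix i
      have "k ^ DIM('a) = k * k ^ (DIM('a) - 1)"
        using DIM_positive[where 'a='a] by (simp flip: power_Suc)
      moreover have "sqrt (k\<^sup>2 * lam i + m\<^sup>2) = k * sqrt (lam i + m\<^sup>2 / k\<^sup>2)"
      proof -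
        have "k\<^sup>2 * lam i + m\<^sup>2 = k\<^sup>2 * (lam i + m\<^sup>2 / k\<^sup>2)" using k0 by (simp add: field_simps)
        then show ?thesis using k0 by (simp only: real_sqrt_mult) simp
      qed
      ultimately have "(c i)\<^sup>2 / k ^ DIM('a) * sqrt (k\<^sup>2 * lam i + m\<^sup>2) = (c i)\<^sup>2 * sqrt (lam i + m\<^sup>2 / k\<^sup>2) / k ^ (DIM('a) - 1)"
        using k0 by simp
      also have "\<dots> \<le> (c i)\<^sup>2 * (s i - ?\<kappa> / s i) / k ^ (DIM('a) - 1)"
      proof -
        have "sqrt (lam i + m\<^sup>2 / k\<^sup>2) \<le> s i + (lam i + m\<^sup>2 / k\<^sup>2 - (lam i + m\<^sup>2)) / (2 * s i)"
          using lam_nonneg[of i] by (intro sqrt_le_tangent lam_m_pos) auto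
        also have "\<dots> = s i - ?\<kappa> / s i"
          by (simp add: diff_divide_distrib left_diff_distrib)
        finally show ?thesis using k0 by (intro divide_right_mono mult_left_mono) auto
      qed
      finally show "(c i)\<^sup>2 / k ^ DIM('a) * sqrt (k\<^sup>2 * lam i + m\<^sup>2)
          \<le> (s i * (c i)\<^sup>2 - ?\<kappa> * ((c i)\<^sup>2 / s i)) / k ^ (DIM('a) - 1)"
        by (simp add: right_diff_distrib mult_ac)
    qed
    also have "\<dots> = ((\<Sum>i<N. s i * (c i)\<^sup>2) - ?\<kappa> * (\<Sum>i<N. (c i)\<^sup>2 / s i)) / k ^ (DIM('a) - 1)"
      by (simp only: sum_divide_distrib[symmetric] sum_subtractf sum_distrib_left[symmetric])
    finally show ?thesis .
  qed
  have l2: "(\<lambda>N. l2norm lborel (\<lambda>x. comb c N (k *\<^sub>R x) - u (k *\<^sub>R x))) \<longlonglongrightarrow> 0"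
  proof (rule Lim_null_comparison[OF always_eventually tendsto_comb_coeff[OF u]], rule allI)
    fix N
    show "norm (l2norm lborel (\<lambda>x. comb c N (k *\<^sub>R x) - u (k *\<^sub>R x))) \<le> l2norm lborel (\<lambda>x. comb c N x - u x)"
      using l2norm_dilate_le[of "\<lambda>x. comb c N x - u x" k, OF sq_integrable_diff[OF comb_sq u(1)] k] by simp
  qed
  have L1: "(\<lambda>N. \<Sum>j<J. (ip lborel (\<lambda>x. comb c N (k *\<^sub>R x)) (e j))\<^sup>2 * s j) \<longlonglongrightarrow>
      (\<Sum>j<J. (ip lborel (\<lambda>x. u (k *\<^sub>R x)) (e j))\<^sup>2 * s j)"
    by (intro tendsto_sum tendsto_mult_right tendsto_power tendsto_ip_left[OF _ _ _ l2]
        sq_integrable_dilate comb_sq u(1) e_sq k0)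
  have L2: "(\<lambda>N. ((\<Sum>i<N. s i * (c i)\<^sup>2) - ?\<kappa> * (\<Sum>i<N. (c i)\<^sup>2 / s i)) / k ^ (DIM('a) - 1)) \<longlonglongrightarrow>
      (ip lborel f u - ?\<kappa> * (\<Sum>j. (c j)\<^sup>2 / s j)) / k ^ (DIM('a) - 1)"
    using sums_form summable_sums[OF summable_inverse_form] k0
    by (intro tendsto_divide tendsto_diff tendsto_mult_left tendsto_const) (auto simp: sums_def)
  show ?thesis using LIMSEQ_le[OF L1 L2] le by blast
qed

text \<open>Convexity of the quadratic form of \<open>sqrt (- \<Delta> + m\<^sup>2)\<close>, linearised at \<open>u\<close>.\<close>

lemma dilate_variation_le:
  assumes k: "k \<ge> 1"
  shows "2 * ip lborel f (\<lambda>x. u (k *\<^sub>R x)) - ip lborel f u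
     \<le> (ip lborel f u - (1 - 1 / k\<^sup>2) * m\<^sup>2 / 2 * (\<Sum>j. (c j)\<^sup>2 / s j)) / k ^ (DIM('a) - 1)"
proof -
  let ?d = "\<lambda>j. ip lborel (\<lambda>x. u (k *\<^sub>R x)) (e j)"
  have "(\<lambda>j. ip lborel f (e j) * ?d j) sums ip lborel f (\<lambda>x. u (k *\<^sub>R x))"
    by (rule parseval[OF f(1) sq_integrable_dilate[OF u(1)] f(2)])
       (use k dilate_zero[of k u, OF k u(2)] in auto)
  then have "(\<lambda>j. 2 * (ip lborel f (e j) * ?d j) - s j * (c j)\<^sup>2) sums (2 * ip lborel f (\<lambda>x. u (k *\<^sub>R x)) - ip lborel f u)"
    by (intro sums_diff sums_mult sums_form)
  then have lim: "(\<lambda>J. \<Sum>j<J. 2 * (ip lborel f (e j) * ?d j) - s j * (c j)\<^sup>2) \<longlonglongrightarrow>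
      2 * ip lborel f (\<lambda>x. u (k *\<^sub>R x)) - ip lborel f u" by (simp add: sums_def)
  have "(\<Sum>j<J. 2 * (ip lborel f (e j) * ?d j) - s j * (c j)\<^sup>2)
      \<le> (ip lborel f u - (1 - 1 / k\<^sup>2) * m\<^sup>2 / 2 * (\<Sum>j. (c j)\<^sup>2 / s j)) / k ^ (DIM('a) - 1)" for J
  proof (rule order_trans[OF sum_mono sqrt_form_dilate[OF k]])
    fix j
    have "0 \<le> s j * (?d j - c j)\<^sup>2" using s_pos[of j] by simp
    then show "2 * (ip lborel f (e j) * ?d j) - s j * (c j)\<^sup>2 \<le> (?d j)\<^sup>2 * s j"
      by (simp add: uf power2_diff algebra_simps)
  qed
  then show ?thesis by (intro LIMSEQ_le_const2[OF lim]) auto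
qed

text \<open>The parameter \<open>fn\<close> is the primitive of the nonlinearity; the first
  hypothesis makes \<open>f\<close> its derivative along \<open>u\<close> up to a quadratic error.
  The conclusion is the first-order term at \<open>t = 0\<close> of the variation with
  \<open>k = exp t\<close>.\<close>

lemma pohozaev_inequality:
  assumes fn: "\<And>x y. fn (u y) - fn (u x) \<le> f x * (u y - u x) + C * (u y - u x)\<^sup>2"
    and C: "C \<ge> 0"
    and int: "integrable lborel (\<lambda>x. fn (u x))"
  shows "(real DIM('a) - 1) * ip lborel f u + m\<^sup>2 * (\<Sum>j. (c j)\<^sup>2 / s j)
     \<le> 2 * real DIM('a) * (\<integral>x. fn (u x) \<partial>lborel)"
proof -
  obtain R where R: "R > 0" "\<Omega> \<subseteq> cball 0 R" by (rule in_ball)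
  define n where "n = real DIM('a)"
  define Q I W L where "Q = ip lborel f u" and "I = (\<integral>x. fn (u x) \<partial>lborel)"
    and "W = (\<Sum>j. (c j)\<^sup>2 / s j)" and "L = R * l2norm lborel f"
  have meas: "(\<lambda>x. fn (u x)) \<in> borel_measurable borel"
    using borel_measurable_integrable[OF int] by simp
  have main: "2 * (exp (- n * t) - 1) * I \<le>
      exp (- (n - 1) * t) * (Q - (1 - exp (- 2 * t)) * m\<^sup>2 / 2 * W) - Q + 2 * C * L\<^sup>2 * t\<^sup>2" if t: "t > 0" for t
  proof -
    let ?k = "exp t"
    have k: "?k \<ge> 1" "?k > 0" using t by auto
    let ?v = "\<lambda>x. u (?k *\<^sub>R x)"
    have v: "sq_integrable lborel ?v" by (rule sq_integrable_dilate[OF u(1) k(2)])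
    have d: "sq_integrable lborel (\<lambda>x. ?v x - u x)" by (rule sq_integrable_diff[OF v u(1)])
    have intk: "integrable lborel (\<lambda>x. fn (?v x))"
      using integral_dilate(2)[OF meas k(2)] int by simp
    \<comment> \<open>The pointwise hypothesis is used with \<open>y = exp t *\<^sub>R x\<close> and
      integrated.\<close>
    have "(\<integral>x. fn (?v x) - fn (u x) \<partial>lborel) \<le> (\<integral>x. f x * (?v x - u x) + C * ((?v x - u x) * (?v x - u x)) \<partial>lborel)"
      using fn by (intro integral_mono Bochner_Integration.integrable_add Bochner_Integration.integrable_diff
          int intk integrable_mult_right sq_integrable_mult f d) (auto simp: power2_eq_square)
    also have "\<dots> = ip lborel f (\<lambda>x. ?v x - u x) + C * (l2norm lborel (\<lambda>x. ?v x - u x))\<^sup>2"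
      unfolding l2norm_power2 unfolding ip_def
      by (subst Bochner_Integration.integral_add) (auto intro!: integrable_mult_right sq_integrable_mult f d)
    also have "ip lborel f (\<lambda>x. ?v x - u x) = ip lborel f ?v - Q"
      unfolding Q_def using ip_diff_left[OF v u(1) f(1)] by (simp only: ip_commute[of lborel f])
    also have "(l2norm lborel (\<lambda>x. ?v x - u x))\<^sup>2 \<le> (t * L)\<^sup>2"
      using l2norm_dilate_diff_solution[OF R t] by (intro power_mono) (auto simp: L_def mult_ac)
    finally have 1: "(\<integral>x. fn (?v x) - fn (u x) \<partial>lborel) \<le> ip lborel f ?v - Q + C * (t * L)\<^sup>2"
      using C by (simp add: mult_left_mono)
    have 2: "(\<integral>x. fn (?v x) - fn (u x) \<partial>lborel) = (exp (- n * t) - 1) * I"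
    proof -
      have "(\<integral>x. fn (?v x) - fn (u x) \<partial>lborel) = I / ?k ^ DIM('a) - I"
        using int intk integral_dilate(1)[OF meas k(2)] by (simp add: I_def)
      moreover have "1 / ?k ^ DIM('a) = exp (- n * t)"
        by (simp add: n_def exp_minus exp_of_nat_mult[symmetric] divide_inverse)
      ultimately show ?thesis by (simp add: left_diff_distrib flip: divide_inverse) (metis times_divide_eq_left mult_1)
    qed
    have "2 * ip lborel f ?v - Q \<le> (Q - (1 - 1 / ?k\<^sup>2) * m\<^sup>2 / 2 * W) / ?k ^ (DIM('a) - 1)"
      using dilate_variation_le[OF k(1)] by (simp add: Q_def W_def)
    also have "1 / ?k\<^sup>2 = exp (- 2 * t)"
      by (simp add: exp_minus exp_double divide_inverse)
    also have "(Q - (1 - exp (- 2 * t)) * m\<^sup>2 / 2 * W) / ?k ^ (DIM('a) - 1) =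
        exp (- (n - 1) * t) * (Q - (1 - exp (- 2 * t)) * m\<^sup>2 / 2 * W)"
    proof -
      have "real (DIM('a) - 1) = n - 1" using DIM_positive[where 'a='a] by (simp add: n_def of_nat_diff)
      then have "?k ^ (DIM('a) - 1) = exp ((n - 1) * t)"
        by (simp flip: exp_of_nat_mult)
      moreover have "exp (- (n - 1) * t) = inverse (exp ((n - 1) * t))"
        by (simp only: exp_minus[symmetric] minus_mult_left)
      ultimately show ?thesis by (simp only: divide_inverse mult.commute)
    qed
    finally show ?thesis using 1 2 by (simp add: power_mult_distrib algebra_simps)
  qed
  \<comment> \<open>The gap in \<open>main\<close>: zero at 0 and nonnegative for
    \<open>t > 0\<close>, so its derivative at 0 is nonnegative. The term with
    \<open>t\<^sup>2\<close> contributes nothing to it.\<close>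
  define \<Psi> where "\<Psi> t = exp (- (n - 1) * t) * (Q - (1 - exp (- 2 * t)) * m\<^sup>2 / 2 * W) - Q + 2 * C * L\<^sup>2 * t\<^sup>2
      - 2 * (exp (- n * t) - 1) * I" for t
  have "(\<Psi> has_real_derivative (- (n - 1) * Q - m\<^sup>2 * W + 2 * n * I)) (at 0)"
    unfolding \<Psi>_def[abs_def] by (auto intro!: derivative_eq_intros simp: algebra_simps)
  moreover have "\<Psi> 0 = 0" by (simp add: \<Psi>_def)
  ultimately have "((\<lambda>t. \<Psi> t / t) \<longlongrightarrow> - (n - 1) * Q - m\<^sup>2 * W + 2 * n * I) (at 0)"
    by (simp add: DERIV_def)
  then have "((\<lambda>t. \<Psi> t / t) \<longlongrightarrow> - (n - 1) * Q - m\<^sup>2 * W + 2 * n * I) (at_right 0)"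
    by (simp add: filterlim_at_split)
  moreover have "\<forall>\<^sub>F t in at_right 0. 0 \<le> \<Psi> t / t"
    using eventually_at_right_less[of 0]
  proof eventually_elim
    case (elim t)
    then show ?case using main[of t] by (simp add: \<Psi>_def)
  qed
  ultimately have "0 \<le> - (n - 1) * Q - m\<^sup>2 * W + 2 * n * I"
    by (intro tendsto_lowerbound) auto
  then show ?thesis by (simp add: n_def Q_def W_def I_def algebra_simps)
qed

end

end

section \<open>The nonlinearity and the transfer to Lebesgue measure\<close>

text \<open>Away from 0 this is the power rule; at 0 the difference quotient is
  \<open>\<bar>h\<bar> powr q\<close>, which tends to 0 as \<open>q > 0\<close>.\<close>

lemma DERIV_abs_powr_mult:
  fixes q s :: real
  assumes q: "q > 0"
  shows "((\<lambda>s. \<bar>s\<bar> powr q * s) has_real_derivative (q + 1) * \<bar>s\<bar> powr q) (at s)"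
proof (cases s "0::real" rule: linorder_cases)
  case less
  have "((\<lambda>s. (- s) powr q * s) has_real_derivative (q + 1) * (- s) powr q) (at s)"
    using less by (auto intro!: derivative_eq_intros simp: field_simps powr_diff)
  then have "((\<lambda>s. \<bar>s\<bar> powr q * s) has_real_derivative (q + 1) * (- s) powr q) (at s)"
    by (rule has_field_derivative_transform_within_open[of _ _ _ "{..<0}"]) (use less in auto)
  then show ?thesis using less by simp
next
  case greater
  have "((\<lambda>s. s powr q * s) has_real_derivative (q + 1) * s powr q) (at s)"
    using greater by (auto intro!: derivative_eq_intros simp: field_simps powr_diff)
  then have "((\<lambda>s. \<bar>s\<bar> powr q * s) has_real_derivative (q + 1) * s powr q) (at s)"
    by (rule has_field_derivative_transform_within_open[of _ _ _ "{0<..}"]) (use greater in auto)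
  then show ?thesis using greater by simp
next
  case equal
  have "((\<lambda>h. \<bar>h\<bar> powr q) \<longlongrightarrow> 0) (at (0::real))"
    by (intro tendsto_zero_powrI[where b=q]) (use q in \<open>auto intro!: tendsto_eq_intros\<close>)
  moreover have "\<forall>\<^sub>F h in at 0. \<bar>h\<bar> powr q = (\<bar>0 + h\<bar> powr q * (0 + h) - \<bar>0\<bar> powr q * 0) / (h::real)"
    by (auto simp: eventually_at_filter)
  ultimately show ?thesis
    using equal by (simp add: DERIV_def tendsto_cong)
qed

lemma DERIV_abs_powr:
  fixes q s :: real
  assumes q: "q > 0"
  shows "((\<lambda>s. \<bar>s\<bar> powr (q + 2) / (q + 2)) has_real_derivative \<bar>s\<bar> powr q * s) (at s)"
proof -
  have eq: "\<bar>s\<bar> powr (q + 2) = (\<bar>s\<bar> powr q * s) * s" for s :: real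
  proof (cases "s = 0")
    case False
    then show ?thesis by (simp add: powr_add power2_eq_square flip: abs_mult)
  qed simp
  have "((\<lambda>s. (\<bar>s\<bar> powr q * s) * s / (q + 2)) has_real_derivative
      (((q + 1) * \<bar>s\<bar> powr q) * s + 1 * (\<bar>s\<bar> powr q * s)) / (q + 2)) (at s)"
    by (intro DERIV_cdivide DERIV_mult DERIV_abs_powr_mult q DERIV_ident)
  moreover have "(((q + 1) * \<bar>s\<bar> powr q) * s + 1 * (\<bar>s\<bar> powr q * s)) / (q + 2) = \<bar>s\<bar> powr q * s"
    using q by (simp add: divide_simps) (simp add: algebra_simps)
  ultimately show ?thesis by (simp add: eq)
qed

text \<open>The mean value inequality is applied twice: to \<open>f\<close>, which is Lipschitz on
  \<open>S\<close>, and then to \<open>F x - f a * x\<close> on the segment. The sharper factor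
  \<open>C / 2\<close> is not sought.\<close>

lemma second_order_bound:
  fixes F f f' :: "real \<Rightarrow> real"
  assumes F: "\<And>x. (F has_real_derivative f x) (at x)" and f: "\<And>x. (f has_real_derivative f' x) (at x)"
    and S: "convex S" "\<And>x. x \<in> S \<Longrightarrow> \<bar>f' x\<bar> \<le> C" and ab: "a \<in> S" "b \<in> S"
  shows "F b - F a \<le> f a * (b - a) + C * (b - a)\<^sup>2"
proof -
  have C: "C \<ge> 0" using S(2)[OF ab(1)] by simp
  have 1: "\<bar>f x - f a\<bar> \<le> C * \<bar>x - a\<bar>" if "x \<in> S" for x
    by (rule field_differentiable_bound[OF S(1) _ _ that ab(1), of f f', unfolded real_norm_def])
       (use f S(2) has_field_derivative_at_within in blast)+
  have "\<bar>(F b - f a * b) - (F a - f a * a)\<bar> \<le> C * \<bar>b - a\<bar> * \<bar>b - a\<bar>"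
  proof (rule field_differentiable_bound[where S="closed_segment a b" and f="\<lambda>x. F x - f a * x"
        and f'="\<lambda>x. f x - f a", unfolded real_norm_def])
    fix x assume x: "x \<in> closed_segment a b"
    show "((\<lambda>x. F x - f a * x) has_real_derivative f x - f a) (at x within closed_segment a b)"
      by (rule has_field_derivative_at_within) (auto intro!: derivative_eq_intros F)
    have "x \<in> S" using x ab S(1) by (meson closed_segment_subset subsetD)
    moreover have "\<bar>x - a\<bar> \<le> \<bar>b - a\<bar>"
      using x by (auto simp: closed_segment_eq_real_ivl split: if_splits)
    ultimately show "\<bar>f x - f a\<bar> \<le> C * \<bar>b - a\<bar>"
      using 1[of x] C mult_left_mono[of "\<bar>x - a\<bar>" "\<bar>b - a\<bar>" C] by linarith
  qed auto
  moreover have "C * \<bar>b - a\<bar> * \<bar>b - a\<bar> = C * (b - a)\<^sup>2"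
    by (simp add: power2_eq_square mult.assoc flip: abs_mult)
  ultimately show ?thesis by (simp add: algebra_simps abs_le_iff)
qed

section \<open>Lebesgue measure on an open set and Borel functions on the whole space\<close>

lemma continuous_extension_by_zero:
  fixes f :: "'a::euclidean_space \<Rightarrow> real"
  assumes "open S" "continuous_on (closure S) f" "\<And>x. x \<in> frontier S \<Longrightarrow> f x = 0"
  shows "continuous_on UNIV (\<lambda>x. if x \<in> S then f x else 0)"
proof -
  have "continuous_on (closure S \<union> - S) (\<lambda>x. if x \<in> S then f x else 0)"
    using assms by (intro continuous_on_cases)
      (auto simp: frontier_def interior_open closed_Compl)
  moreover have "closure S \<union> - S = UNIV" using closure_subset by auto
  ultimately show ?thesis by simp
qed

lemma integrable_bounded_support:
  fixes f :: "'a::euclidean_space \<Rightarrow> real"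
  assumes "f \<in> borel_measurable borel" "bounded S" "\<And>x. x \<notin> S \<Longrightarrow> f x = 0" "\<And>x. \<bar>f x\<bar> \<le> C"
  shows "integrable lborel f"
proof (rule Bochner_Integration.integrable_bound)
  show "integrable lborel (\<lambda>x. C * indicator (closure S) x)"
    using emeasure_compact_finite[of "closure S"] assms(2)
    by (intro integrable_mult_right integrable_real_indicator) (auto simp: compact_closure)
  have "\<bar>f x\<bar> \<le> \<bar>C * indicator (closure S) x\<bar>" for x
    using assms(3)[of x] assms(4)[of x] closure_subset[of S] by (cases "x \<in> S") auto
  then show "AE x in lborel. norm (f x) \<le> norm (C * indicator (closure S) x)" by simp
qed (use assms in auto)

lemma lebesgue_on_borel_integral:
  fixes g :: "'a::euclidean_space \<Rightarrow> real"
  assumes S: "open S" and g: "g \<in> borel_measurable borel" "\<And>x. x \<notin> S \<Longrightarrow> g x = 0"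
  shows "integral\<^sup>L (lebesgue_on S) g = integral\<^sup>L lborel g"
    and "integrable (lebesgue_on S) g \<longleftrightarrow> integrable lborel g"
proof -
  have S': "S \<inter> space lebesgue \<in> sets lebesgue" using S by simp
  have eq: "(\<lambda>x. indicator S x *\<^sub>R g x) = g"
    using g(2) by (auto simp: fun_eq_iff indicator_def)
  show "integral\<^sup>L (lebesgue_on S) g = integral\<^sup>L lborel g"
    unfolding integral_restrict_space[OF S'] eq using g(1) by (simp add: integral_completion)
  show "integrable (lebesgue_on S) g \<longleftrightarrow> integrable lborel g"
    unfolding integrable_restrict_space[OF S'] eq using g(1) by (simp add: integrable_completion)
qed

lemma borel_measurable_lebesgue_onI:
  "g \<in> borel_measurable borel \<Longrightarrow> g \<in> borel_measurable (lebesgue_on S)"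
  by (rule measurable_restrict_space1, rule measurable_completion) simp

lemma lebesgue_on_sq_integrable:
  fixes f :: "'a::euclidean_space \<Rightarrow> real"
  assumes S: "open S" and f: "sq_integrable lborel f" "\<And>x. x \<notin> S \<Longrightarrow> f x = 0"
  shows "sq_integrable (lebesgue_on S) f"
proof -
  have m: "f \<in> borel_measurable borel" by (rule sq_integrable_borel[OF f(1)])
  then have sq: "(\<lambda>x. (f x)\<^sup>2) \<in> borel_measurable borel" by measurable
  have "integrable (lebesgue_on S) (\<lambda>x. (f x)\<^sup>2) \<longleftrightarrow> integrable lborel (\<lambda>x. (f x)\<^sup>2)"
    by (rule lebesgue_on_borel_integral(2)[OF S sq]) (simp add: f(2))
  then have "integrable (lebesgue_on S) (\<lambda>x. (f x)\<^sup>2)" using f(1) by (simp add: sq_integrable_def)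
  then show ?thesis using m by (simp only: sq_integrable_def borel_measurable_lebesgue_onI simp_thms)
qed

lemma lebesgue_on_ip:
  fixes f g :: "'a::euclidean_space \<Rightarrow> real"
  assumes "open S" "f \<in> borel_measurable borel" "g \<in> borel_measurable borel" "\<And>x. x \<notin> S \<Longrightarrow> f x = 0"
  shows "ip (lebesgue_on S) f g = ip lborel f g"
  unfolding ip_def by (rule lebesgue_on_borel_integral(1)) (use assms in auto)

text \<open>A class in L-infinity offers only Lebesgue measurability and an almost everywhere bound,
  whereas dilation and the pointwise Taylor bound need a Borel function bounded everywhere. Clamping
  a Borel version changes it on a null set only.\<close>

lemma memLinf_borel_representative:
  fixes u :: "'a::euclidean_space \<Rightarrow> real"
  assumes S: "open S" and u: "memLinf S u"
  obtains u' K where "u' \<in> borel_measurable borel" "K > 0" "\<And>x. \<bar>u' x\<bar> \<le> K" "\<And>x. x \<notin> S \<Longrightarrow> u' x = 0"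
    "AE x in lebesgue_on S. u x = u' x"
proof -
  have S': "S \<inter> space lebesgue \<in> sets lebesgue" using S by simp
  obtain C where um: "u \<in> borel_measurable (lebesgue_on S)" and C: "AE x in lebesgue_on S. \<bar>u x\<bar> \<le> C"
    using u by (auto simp: memLinf_def)
  have "(\<lambda>x. indicator S x *\<^sub>R u x) \<in> borel_measurable lebesgue"
    using um borel_measurable_restrict_space_iff[OF S'] by blast
  then obtain g where g: "g \<in> borel_measurable lborel" "AE x in lborel. indicator S x *\<^sub>R u x = g x"
    using completion_ex_borel_measurable_real by blast
  \<comment> \<open>The 1 makes \<open>K\<close> positive whatever \<open>C\<close> is.\<close>
  define K where "K = max 1 C"
  define u' where "u' x = indicator S x * max (- K) (min K (g x))" for x
  have [measurable]: "S \<in> sets borel" "g \<in> borel_measurable borel" using S g by auto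
  show thesis
  proof
    show "u' \<in> borel_measurable borel" unfolding u'_def by measurable
    show "K > 0" by (simp add: K_def)
    then show "\<bar>u' x\<bar> \<le> K" for x by (auto simp: u'_def indicator_def)
    show "x \<notin> S \<Longrightarrow> u' x = 0" for x by (simp add: u'_def)
    have "AE x in lebesgue_on S. indicator S x *\<^sub>R u x = g x"
      using AE_completion[OF g(2)] unfolding AE_restrict_space_iff[OF S']
      by (rule eventually_mono) (auto simp: indicator_def)
    moreover have "AE x in lebesgue_on S. x \<in> S" by (rule AE_I2) simp
    ultimately show "AE x in lebesgue_on S. u x = u' x"
      using C by eventually_elim (auto simp: u'_def K_def)
  qed
qed

lemma memLp_2_iff: "memLp S 2 f \<longleftrightarrow> sq_integrable (lebesgue_on S) f"
proof -
  have "\<bar>y\<bar> powr 2 = y\<^sup>2" for y :: real by (cases "y = 0") auto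
  then show ?thesis by (simp add: memLp_def sq_integrable_def)
qed

lemma L2_series_limit_iff:
  "L2_series_limit S \<phi> a w \<longleftrightarrow> sq_integrable (lebesgue_on S) w \<and>
     (\<lambda>N. ip (lebesgue_on S) (\<lambda>x. (\<Sum>i<N. a i * \<phi> i x) - w x) (\<lambda>x. (\<Sum>i<N. a i * \<phi> i x) - w x)) \<longlonglongrightarrow> 0"
  by (simp add: L2_series_limit_def memLp_2_iff ip_def power2_eq_square)

text \<open>Parseval for prescribed coefficients: on partial sums it is orthonormality, and the
  inner product is continuous in L2.\<close>

lemma L2_series_limit_ip:
  assumes \<phi>: "\<And>i. sq_integrable (lebesgue_on S) (\<phi> i)"
    and orth: "\<And>i j. ip (lebesgue_on S) (\<phi> i) (\<phi> j) = (if i = j then 1 else 0)"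
    and f: "L2_series_limit S \<phi> a f" and g: "L2_series_limit S \<phi> b g"
  shows "(\<lambda>i. a i * b i) sums ip (lebesgue_on S) f g"
proof -
  have lim: "(\<lambda>N. l2norm (lebesgue_on S) (\<lambda>x. (\<Sum>i<N. a i * \<phi> i x) - f x)) \<longlonglongrightarrow> 0"
    if "L2_series_limit S \<phi> a f" for a f
  proof -
    have "(\<lambda>N. ip (lebesgue_on S) (\<lambda>x. (\<Sum>i<N. a i * \<phi> i x) - f x) (\<lambda>x. (\<Sum>i<N. a i * \<phi> i x) - f x)) \<longlonglongrightarrow> 0"
      using that by (simp add: L2_series_limit_iff)
    from tendsto_real_sqrt[OF this] show ?thesis by (simp add: l2norm_def)
  qed
  have sq: "sq_integrable (lebesgue_on S) (\<lambda>x. \<Sum>i<N. a i * \<phi> i x)" for a :: "nat \<Rightarrow> real" and N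
    by (intro sq_integrable_sum sq_integrable_cmult \<phi>)
  have "(\<lambda>N. ip (lebesgue_on S) (\<lambda>x. \<Sum>i<N. a i * \<phi> i x) (\<lambda>x. \<Sum>i<N. b i * \<phi> i x)) \<longlonglongrightarrow> ip (lebesgue_on S) f g"
    by (rule tendsto_ip[OF sq _ sq _ lim[OF f] lim[OF g]]) (use f g in \<open>auto simp: L2_series_limit_iff\<close>)
  then show ?thesis
    by (simp add: ip_orthonormal_sum(1)[OF \<phi> orth] sums_def)
qed

section \<open>Nonexistence of bounded solutions\<close>

lemma dirichlet_eigenpair_extension:
  assumes \<Omega>: "open \<Omega>" "bounded \<Omega>" and \<phi>: "dirichlet_eigenpair \<Omega> lam \<phi>"
  shows "\<exists>D D2. dirichlet_fun \<Omega> (\<lambda>x. if x \<in> \<Omega> then \<phi> x else 0) D D2 \<and>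
     (\<forall>x\<in>\<Omega>. lam * \<phi> x = - (\<Sum>b\<in>Basis. D2 b x))"
proof -
  let ?e = "\<lambda>x. if x \<in> \<Omega> then \<phi> x else 0"
  from \<phi> obtain D D2 where cont: "continuous_on (closure \<Omega>) \<phi>" and zero: "\<And>x. x \<in> frontier \<Omega> \<Longrightarrow> \<phi> x = 0"
    and D: "\<And>x. x \<in> \<Omega> \<Longrightarrow> (\<phi> has_derivative (\<lambda>h. \<Sum>b\<in>Basis. (h \<bullet> b) * D b x)) (at x)"
    and D2: "\<And>b x. b \<in> Basis \<Longrightarrow> x \<in> \<Omega> \<Longrightarrow> (D b has_derivative (\<lambda>h. \<Sum>c\<in>Basis. (h \<bullet> c) * D2 b c x)) (at x)"
    and D2c: "\<And>b c. b \<in> Basis \<Longrightarrow> c \<in> Basis \<Longrightarrow> continuous_on \<Omega> (D2 b c)"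
    and eig: "\<And>x. x \<in> \<Omega> \<Longrightarrow> - (\<Sum>b\<in>Basis. D2 b b x) = lam * \<phi> x"
    unfolding dirichlet_eigenpair_def by blast
  have "C2_on \<Omega> ?e D (\<lambda>b. D2 b b)"
    unfolding C2_on_def
  proof (intro conjI ballI)
    fix x assume x: "x \<in> \<Omega>"
    show "(?e has_derivative (\<lambda>h. \<Sum>b\<in>Basis. (h \<bullet> b) * D b x)) (at x)"
      by (rule has_derivative_transform_within_open[OF D[OF x] \<Omega>(1) x]) simp
  next
    fix b :: 'a assume b: "b \<in> Basis"
    show "continuous_on \<Omega> (D b)"
      using D2[OF b] by (meson continuous_at_imp_continuous_on has_derivative_continuous)
    show "continuous_on \<Omega> (D2 b b)" by (rule D2c[OF b b])
    show "has_dir_deriv \<Omega> b (D b) (D2 b b)"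
      by (rule has_derivative_imp_dir_deriv[OF D2[OF b] b])
  qed
  then have "dirichlet_fun \<Omega> ?e D (\<lambda>b. D2 b b)"
    by unfold_locales (use \<Omega> continuous_extension_by_zero[OF \<Omega>(1) cont zero] in auto)
  then show ?thesis using eig by fastforce
qed

lemma eigensystem_dirichlet_system:
  assumes \<Omega>: "open \<Omega>" "bounded \<Omega>" "star_shaped_origin \<Omega>" and sys: "dirichlet_eigensystem \<Omega> lam \<phi>"
  shows "\<exists>D D2. dirichlet_system \<Omega> lam (\<lambda>j x. if x \<in> \<Omega> then \<phi> j x else 0) D D2"
proof -
  let ?M = "lebesgue_on \<Omega>"
  define e where "e j x = (if x \<in> \<Omega> then \<phi> j x else 0)" for j x
  have \<phi>sq: "sq_integrable ?M (\<phi> j)" for j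
    using sys by (simp add: dirichlet_eigensystem_def memLp_2_iff)
  have orth: "ip ?M (\<phi> i) (\<phi> j) = (if i = j then 1 else 0)" for i j
    using sys by (simp add: dirichlet_eigensystem_def L2int_def ip_def)
  have "\<forall>j. \<exists>D D2. dirichlet_fun \<Omega> (e j) D D2 \<and> (\<forall>x\<in>\<Omega>. lam j * \<phi> j x = - (\<Sum>b\<in>Basis. D2 b x))"
    using sys dirichlet_eigenpair_extension[OF \<Omega>(1,2)] unfolding e_def dirichlet_eigensystem_def by blast
  then obtain D D2 where D: "\<And>j. dirichlet_fun \<Omega> (e j) (D j) (D2 j)"
    and eig: "\<And>j x. x \<in> \<Omega> \<Longrightarrow> lam j * \<phi> j x = - (\<Sum>b\<in>Basis. D2 j b x)"
    by metis
  have em: "e j \<in> borel_measurable borel" for j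
    using dirichlet_fun.cont[OF D] by (rule borel_measurable_continuous_onI)
  have ip\<phi>: "ip ?M f (\<phi> j) = ip lborel f (e j)" if "f \<in> borel_measurable borel" "\<And>x. x \<notin> \<Omega> \<Longrightarrow> f x = 0" for f j
  proof -
    have "ip ?M f (\<phi> j) = ip ?M f (e j)"
      unfolding ip_def by (rule Bochner_Integration.integral_cong) (auto simp: e_def)
    then show ?thesis using lebesgue_on_ip[OF \<Omega>(1) that(1) em that(2)] by simp
  qed
  have "dirichlet_system \<Omega> lam e D D2"
  proof (rule dirichlet_system.intro)
    show "dirichlet_fun \<Omega> (e j) (D j) (D2 j)" for j by (rule D)
    show "x \<in> \<Omega> \<Longrightarrow> lam j * e j x = - (\<Sum>b\<in>Basis. D2 j b x)" for j x using eig[of x j] by (simp add: e_def)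
    show "ip lborel (e i) (e j) = (if i = j then 1 else 0)" for i j
    proof -
      have "ip lborel (e i) (e j) = ip ?M (e i) (\<phi> j)"
        by (rule ip\<phi>[symmetric]) (auto simp: em e_def)
      also have "\<dots> = ip ?M (\<phi> i) (\<phi> j)"
        unfolding ip_def by (rule Bochner_Integration.integral_cong) (auto simp: e_def)
      finally show ?thesis by (simp add: orth)
    qed
    show "t *\<^sub>R x \<in> \<Omega>" if "x \<in> \<Omega>" "0 \<le> t" "t \<le> 1" for x t
    proof -
      have "t *\<^sub>R x \<in> closed_segment 0 x" using that by (auto simp: in_segment)
      then show ?thesis using \<Omega>(3) that(1) by (auto simp: star_shaped_origin_def)
    qed
    fix f g :: "'a \<Rightarrow> real"
    assume f: "sq_integrable lborel f" and g: "sq_integrable lborel g"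
      and f0: "\<And>x. x \<notin> \<Omega> \<Longrightarrow> f x = 0" and g0: "\<And>x. x \<notin> \<Omega> \<Longrightarrow> g x = 0"
    have series: "L2_series_limit \<Omega> \<phi> (\<lambda>i. ip lborel h (e i)) h"
      if "sq_integrable lborel h" "\<And>x. x \<notin> \<Omega> \<Longrightarrow> h x = 0" for h
    proof -
      have "L2_series_limit \<Omega> \<phi> (\<lambda>i. L2int \<Omega> h (\<phi> i)) h"
        using sys lebesgue_on_sq_integrable[OF \<Omega>(1) that] by (simp add: dirichlet_eigensystem_def memLp_2_iff)
      then show ?thesis
        using ip\<phi>[OF sq_integrable_borel[OF that(1)] that(2)] by (simp add: L2int_def ip_def)
    qed
    have "(\<lambda>j. ip lborel f (e j) * ip lborel g (e j)) sums ip ?M f g"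
      by (rule L2_series_limit_ip[OF \<phi>sq orth series[OF f f0] series[OF g g0]])
    then show "(\<lambda>j. ip lborel f (e j) * ip lborel g (e j)) sums ip lborel f g"
      using lebesgue_on_ip[OF \<Omega>(1) sq_integrable_borel[OF f] sq_integrable_borel[OF g] f0] by simp
  qed
  then show ?thesis unfolding e_def by blast
qed

text \<open>An eigenfunction as test function turns the weak equation into one equation per
  coefficient: two quarter powers multiply to a square root. Integrability is recorded because the
  weak formulation integrates a single difference, which has to be split.\<close>

lemma quarter_op_ip:
  assumes sys: "dirichlet_eigensystem \<Omega> lam \<phi>" and lam: "\<And>i. lam i \<ge> 0" and m: "m \<ge> 0"
    and u: "u \<in> H12_0 \<Omega> lam \<phi>"
  shows "\<phi> j \<in> H12_0 \<Omega> lam \<phi>"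
    and "(\<integral>x. quarter_op \<Omega> lam \<phi> m u x * quarter_op \<Omega> lam \<phi> m (\<phi> j) x \<partial>lebesgue_on \<Omega>)
       = sqrt (lam j + m\<^sup>2) * L2int \<Omega> u (\<phi> j)"
    and "integrable (lebesgue_on \<Omega>) (\<lambda>x. quarter_op \<Omega> lam \<phi> m u x * quarter_op \<Omega> lam \<phi> m (\<phi> j) x)"
proof -
  let ?M = "lebesgue_on \<Omega>"
  have \<phi>sq: "sq_integrable ?M (\<phi> j)" for j
    using sys by (simp add: dirichlet_eigensystem_def memLp_2_iff)
  have L2orth: "L2int \<Omega> (\<phi> i) (\<phi> j) = (if i = j then 1 else 0)" for i j
    using sys by (simp add: dirichlet_eigensystem_def)
  then have orth: "ip ?M (\<phi> i) (\<phi> j) = (if i = j then 1 else 0)" for i j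
    by (simp add: L2int_def ip_def)
  show \<phi>H: "\<phi> j \<in> H12_0 \<Omega> lam \<phi>"
    unfolding H12_0_def
  proof (intro CollectI conjI)
    show "memLp \<Omega> 2 (\<phi> j)" using \<phi>sq by (simp add: memLp_2_iff)
    show "summable (\<lambda>i. (L2int \<Omega> (\<phi> j) (\<phi> i))\<^sup>2 * sqrt (lam i))"
      by (rule summable_finite[of "{j}"]) (auto simp: L2orth)
  qed
  have powr: "(lam i + m\<^sup>2) powr (1/4) * (lam i + m\<^sup>2) powr (1/4) = sqrt (lam i + m\<^sup>2)" for i
    using lam[of i] by (simp add: powr_half_sqrt flip: powr_add)
  have series: "L2_series_limit \<Omega> \<phi> (\<lambda>i. L2int \<Omega> v (\<phi> i) * (lam i + m\<^sup>2) powr (1/4)) (quarter_op \<Omega> lam \<phi> m v)"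
    if v: "v \<in> H12_0 \<Omega> lam \<phi>" for v
    unfolding quarter_op_def
  proof (rule someI_ex[where P="L2_series_limit \<Omega> \<phi> (\<lambda>i. L2int \<Omega> v (\<phi> i) * (lam i + m\<^sup>2) powr (1/4))"])
    let ?c = "\<lambda>i. L2int \<Omega> v (\<phi> i)"
    have "L2_series_limit \<Omega> \<phi> ?c v"
      using sys v by (simp add: dirichlet_eigensystem_def H12_0_def)
    from L2_series_limit_ip[OF \<phi>sq orth this this]
    have c2: "summable (\<lambda>i. (?c i)\<^sup>2)" by (simp add: power2_eq_square sums_iff)
    \<comment> \<open>Membership in \<open>H12_0\<close> controls only the weight
      \<open>sqrt (lam i)\<close>; the bound
      \<open>sqrt (lam i + m\<^sup>2) \<le> sqrt (lam i) + m\<close> leaves a multiple of the L2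
      norm.\<close>
    have "summable (\<lambda>i. (?c i * (lam i + m\<^sup>2) powr (1/4))\<^sup>2)"
    proof (rule summable_comparison_test')
      show "summable (\<lambda>i. (?c i)\<^sup>2 * sqrt (lam i) + m * (?c i)\<^sup>2)"
        using v c2 by (intro summable_add summable_mult) (auto simp: H12_0_def)
      fix i
      have "(?c i * (lam i + m\<^sup>2) powr (1/4))\<^sup>2 = (?c i)\<^sup>2 * sqrt (lam i + m\<^sup>2)"
        unfolding power_mult_distrib by (simp only: power2_eq_square[of "_ powr _"] powr)
      also have "\<dots> \<le> (?c i)\<^sup>2 * (sqrt (lam i) + m)"
        using sqrt_add_le_add_sqrt[of "lam i" "m\<^sup>2"] lam[of i] m by (intro mult_left_mono) auto
      finally show "norm ((?c i * (lam i + m\<^sup>2) powr (1/4))\<^sup>2) \<le> (?c i)\<^sup>2 * sqrt (lam i) + m * (?c i)\<^sup>2"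
        by (simp add: algebra_simps)
    qed
    from riesz_fischer[OF \<phi>sq orth this]
    show "\<exists>w. L2_series_limit \<Omega> \<phi> (\<lambda>i. ?c i * (lam i + m\<^sup>2) powr (1/4)) w"
      by (simp add: L2_series_limit_iff)
  qed
  show "integrable ?M (\<lambda>x. quarter_op \<Omega> lam \<phi> m u x * quarter_op \<Omega> lam \<phi> m (\<phi> j) x)"
    using series[OF u] series[OF \<phi>H] by (intro sq_integrable_mult) (auto simp: L2_series_limit_iff)
  have "(\<lambda>i. L2int \<Omega> u (\<phi> i) * (lam i + m\<^sup>2) powr (1/4) * (L2int \<Omega> (\<phi> j) (\<phi> i) * (lam i + m\<^sup>2) powr (1/4)))
      sums ip ?M (quarter_op \<Omega> lam \<phi> m u) (quarter_op \<Omega> lam \<phi> m (\<phi> j))"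
    by (rule L2_series_limit_ip[OF \<phi>sq orth series[OF u] series[OF \<phi>H]])
  moreover have "(\<lambda>i. L2int \<Omega> u (\<phi> i) * (lam i + m\<^sup>2) powr (1/4) * (L2int \<Omega> (\<phi> j) (\<phi> i) * (lam i + m\<^sup>2) powr (1/4)))
      = (\<lambda>i. if i = j then sqrt (lam j + m\<^sup>2) * L2int \<Omega> u (\<phi> j) else 0)"
    using powr[of j] by (auto simp: fun_eq_iff L2orth mult_ac)
  ultimately show "(\<integral>x. quarter_op \<Omega> lam \<phi> m u x * quarter_op \<Omega> lam \<phi> m (\<phi> j) x \<partial>?M)
       = sqrt (lam j + m\<^sup>2) * L2int \<Omega> u (\<phi> j)"
    using sums_unique2[OF _ sums_single[of j "\<lambda>_. sqrt (lam j + m\<^sup>2) * L2int \<Omega> u (\<phi> j)"]]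
    by (simp add: ip_def)
qed

theorem theorem1p2:
  fixes \<Omega> :: "'a::euclidean_space set"
    and lam :: "nat \<Rightarrow> real" and \<phi> :: "nat \<Rightarrow> 'a \<Rightarrow> real"
    and p m :: real and u :: "'a \<Rightarrow> real"
  assumes "DIM('a) \<ge> 3"
    and "smooth_bounded_domain \<Omega>"
    and "star_shaped_origin \<Omega>"
    and "dirichlet_eigensystem \<Omega> lam \<phi>"
    and "p \<ge> (real DIM('a) + 2) / (real DIM('a) - 2)"
    and "m > 0"
    and "weak_solution_P \<Omega> lam \<phi> m p u"
    and "memLinf \<Omega> u"
  shows "AE x in lebesgue_on \<Omega>. u x = 0"
proof -
  note sys = assms(4) and m = assms(6)
  have \<Omega>: "open \<Omega>" "bounded \<Omega>" using assms(2) by (auto simp: smooth_bounded_domain_def)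
  let ?M = "lebesgue_on \<Omega>"
  define n where "n = real DIM('a)"
  have n: "n \<ge> 3" using assms(1) by (simp add: n_def)
  have p: "p \<ge> (n + 2) / (n - 2)" using assms(5) by (simp add: n_def)
  have "(n + 2) / (n - 2) > 1" using n by (simp add: less_divide_eq)
  with p have p1: "p > 1" by linarith
  \<comment> \<open>The exponent condition in the form in which it meets the integral of
    \<open>\<bar>u' x\<bar> powr (p + 1)\<close>.\<close>
  have p_crit: "2 * n / (p + 1) \<le> n - 2"
  proof -
    have "n + 2 \<le> p * (n - 2)" using p n by (simp add: pos_divide_le_eq)
    then have "2 * n \<le> (n - 2) * (p + 1)" by (simp add: algebra_simps)
    then show ?thesis using p1 by (simp add: pos_divide_le_eq)
  qed
  define e where "e j x = (if x \<in> \<Omega> then \<phi> j x else 0)" for j x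
  obtain D D2 where "dirichlet_system \<Omega> lam e D D2"
    using eigensystem_dirichlet_system[OF \<Omega> assms(3) sys] unfolding e_def by blast
  then interpret E: dirichlet_system \<Omega> lam e D D2 .
  obtain u' K where u'm: "u' \<in> borel_measurable borel" and K: "K > 0" "\<And>x. \<bar>u' x\<bar> \<le> K"
    and u'0: "\<And>x. x \<notin> \<Omega> \<Longrightarrow> u' x = 0" and uu': "AE x in ?M. u x = u' x"
    using memLinf_borel_representative[OF \<Omega>(1) assms(8)] by metis
  have [measurable]: "u' \<in> borel_measurable borel" by (rule u'm)
  define g where "g y = \<bar>y\<bar> powr (p - 1) * y" for y :: real
  \<comment> \<open>The mass term is moved to the right-hand side, so that the operator is the plain
    square root. Its primitive is \<open>Fn\<close>, and it is \<open>Fn\<close> that instantiates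
    the parameter \<open>fn\<close> of \<open>pohozaev_inequality\<close>.\<close>
  define fn where "fn y = m * y + g y" for y
  define Fn where "Fn y = m / 2 * y\<^sup>2 + \<bar>y\<bar> powr (p + 1) / (p + 1)" for y
  have [measurable]: "g \<in> borel_measurable borel" "fn \<in> borel_measurable borel" "Fn \<in> borel_measurable borel"
    unfolding g_def fn_def Fn_def by measurable
  have bdd: "\<exists>C. \<forall>x. \<bar>h (u' x)\<bar> \<le> C" if "continuous_on {-K..K} h" for h :: "real \<Rightarrow> real"
  proof -
    have "bounded (h ` {-K..K})" using that by (intro compact_imp_bounded compact_continuous_image) auto
    then obtain C where "\<forall>z\<in>h ` {-K..K}. norm z \<le> C" unfolding bounded_iff by blast
    moreover have "u' x \<in> {-K..K}" for x using K(2)[of x] by (auto simp: abs_le_iff)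
    ultimately show ?thesis by (metis image_eqI real_norm_def)
  qed
  \<comment> \<open>Because \<open>h 0 = 0\<close>, the composition still vanishes off the bounded
    domain, and it is bounded because \<open>u'\<close> takes values in a compact interval.\<close>
  have intg: "integrable lborel (\<lambda>x. h (u' x))"
    if h: "continuous_on {-K..K} h" "h \<in> borel_measurable borel" "h 0 = 0" for h :: "real \<Rightarrow> real"
  proof -
    obtain C where C: "\<And>x. \<bar>h (u' x)\<bar> \<le> C" using bdd[OF h(1)] by blast
    show ?thesis
      by (rule integrable_bounded_support[OF _ \<Omega>(2) _ C]) (use h u'0 in auto)
  qed
  have dg: "(g has_real_derivative p * \<bar>y\<bar> powr (p - 1)) (at y)" for y
    using DERIV_abs_powr_mult[of "p - 1" y] p1 by (simp add: g_def[abs_def])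
  have dfn: "(fn has_real_derivative m + p * \<bar>y\<bar> powr (p - 1)) (at y)" for y
    unfolding fn_def[abs_def] by (auto intro!: derivative_eq_intros dg)
  have dFn: "(Fn has_real_derivative fn y) (at y)" for y
  proof -
    have "((\<lambda>y. \<bar>y\<bar> powr (p + 1) / (p + 1)) has_real_derivative g y) (at y)"
      using DERIV_abs_powr[of "p - 1" y] p1 by (simp add: g_def add.commute)
    moreover have "((\<lambda>y. m / 2 * y\<^sup>2) has_real_derivative m * y) (at y)"
      by (auto intro!: derivative_eq_intros)
    ultimately show ?thesis
      unfolding Fn_def[abs_def] fn_def by (intro DERIV_add)
  qed
  have cont: "continuous_on A fn" "continuous_on A Fn" "continuous_on A g" for A
    using dfn dFn dg by (meson DERIV_isCont continuous_at_imp_continuous_on)+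
  have at0: "g 0 = 0" "fn 0 = 0" "Fn 0 = 0" by (auto simp: g_def fn_def Fn_def)
  define f where "f x = fn (u' x)" for x
  have u'sq: "sq_integrable lborel u'"
    using intg[of "\<lambda>y. y\<^sup>2"] by (simp add: sq_integrable_def continuous_intros)
  have gsq: "sq_integrable lborel (\<lambda>x. g (u' x))"
    using intg[of "\<lambda>y. (g y)\<^sup>2"] by (simp add: sq_integrable_def continuous_intros cont at0)
  have fsq: "sq_integrable lborel f"
    using intg[of "\<lambda>y. (fn y)\<^sup>2"] by (simp add: f_def[abs_def] sq_integrable_def continuous_intros cont at0)
  have f0: "f x = 0" if "x \<notin> \<Omega>" for x using u'0[OF that] by (simp add: f_def at0)
  have \<phi>m: "\<phi> j \<in> borel_measurable ?M" for j
    using sys by (simp add: dirichlet_eigensystem_def memLp_def)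
  have um: "u \<in> borel_measurable ?M" using assms(8) by (simp add: memLinf_def)
  have ip_\<phi>: "ip lborel h (e j) = (\<integral>x. h x * \<phi> j x \<partial>?M)" "integrable ?M (\<lambda>x. h x * \<phi> j x)"
    if "sq_integrable lborel h" "\<And>x. x \<notin> \<Omega> \<Longrightarrow> h x = 0" for h j
  proof -
    have eq: "(\<integral>x. h x * \<phi> j x \<partial>?M) = (\<integral>x. h x * e j x \<partial>?M)"
      by (rule Bochner_Integration.integral_cong) (auto simp: e_def)
    show "ip lborel h (e j) = (\<integral>x. h x * \<phi> j x \<partial>?M)"
      unfolding eq using lebesgue_on_ip[OF \<Omega>(1) sq_integrable_borel[OF that(1)] sq_integrable_borel[OF E.e_sq] that(2)]
      by (simp add: ip_def)
    show "integrable ?M (\<lambda>x. h x * \<phi> j x)"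
      using sys by (intro sq_integrable_mult lebesgue_on_sq_integrable[OF \<Omega>(1) that])
        (auto simp: dirichlet_eigensystem_def memLp_2_iff)
  qed
  have g0: "x \<notin> \<Omega> \<Longrightarrow> g (u' x) = 0" for x by (simp add: u'0 at0)
  define c where "c j = ip lborel u' (e j)" for j
  define s where "s j = sqrt (lam j + m\<^sup>2)" for j
  have uH: "u \<in> H12_0 \<Omega> lam \<phi>" using assms(7) by (simp add: weak_solution_P_def)
  have spec: "ip lborel f (e j) = s j * c j" for j
  proof -
    note Q = quarter_op_ip[OF sys E.lam_nonneg less_imp_le[OF m] uH, of j]
    let ?q = "\<lambda>x. quarter_op \<Omega> lam \<phi> m u x * quarter_op \<Omega> lam \<phi> m (\<phi> j) x"
    have "L2int \<Omega> u (\<phi> j) = (\<integral>x. u' x * \<phi> j x \<partial>?M)"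
      unfolding L2int_def
      by (intro integral_cong_AE borel_measurable_times um \<phi>m borel_measurable_lebesgue_onI u'm)
         (use uu' in auto)
    then have L: "L2int \<Omega> u (\<phi> j) = c j"
      using ip_\<phi>(1)[OF u'sq u'0, of j] by (simp add: c_def)
    have qm: "?q \<in> borel_measurable ?M" by (rule borel_measurable_integrable[OF Q(3)])
    have "0 = (\<integral>x. ?q x - m * u x * \<phi> j x - \<bar>u x\<bar> powr (p - 1) * u x * \<phi> j x \<partial>?M)"
      using assms(7) Q(1) by (simp add: weak_solution_P_def)
    also have "\<dots> = (\<integral>x. ?q x - m * (u' x * \<phi> j x) - g (u' x) * \<phi> j x \<partial>?M)"
    proof (rule integral_cong_AE)
      show "AE x in ?M. ?q x - m * u x * \<phi> j x - \<bar>u x\<bar> powr (p - 1) * u x * \<phi> j x =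
          ?q x - m * (u' x * \<phi> j x) - g (u' x) * \<phi> j x"
        using uu' by eventually_elim (simp add: g_def mult.assoc)
      show "(\<lambda>x. ?q x - m * u x * \<phi> j x - \<bar>u x\<bar> powr (p - 1) * u x * \<phi> j x) \<in> borel_measurable ?M"
        using qm um \<phi>m[of j] by measurable
      show "(\<lambda>x. ?q x - m * (u' x * \<phi> j x) - g (u' x) * \<phi> j x) \<in> borel_measurable ?M"
        using ip_\<phi>(2)[OF u'sq u'0, of j] ip_\<phi>(2)[OF gsq g0, of j] Q(3)
        by (intro borel_measurable_integrable) auto
    qed
    also have "\<dots> = s j * c j - m * c j - ip lborel (\<lambda>x. g (u' x)) (e j)"
      using ip_\<phi>[OF u'sq u'0, of j] ip_\<phi>[OF gsq g0, of j] Q(2,3) by (simp add: L c_def s_def)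
    finally have "ip lborel (\<lambda>x. g (u' x)) (e j) = s j * c j - m * c j" by simp
    moreover have "ip lborel f (e j) = m * c j + ip lborel (\<lambda>x. g (u' x)) (e j)"
      unfolding f_def[abs_def] fn_def
      by (subst ip_add_left[OF sq_integrable_cmult[OF u'sq] gsq E.e_sq]) (simp add: ip_cmult_left c_def)
    ultimately show ?thesis by simp
  qed
  note setting = m u'sq u'0 fsq f0 spec[unfolded s_def c_def]
  \<comment> \<open>A bound for the derivative of \<open>fn\<close> on the interval from
    \<open>-K\<close> to \<open>K\<close>, where all values of \<open>u'\<close> lie.\<close>
  define C where "C = m + p * K powr (p - 1)"
  have second: "Fn (u' y) - Fn (u' x) \<le> f x * (u' y - u' x) + C * (u' y - u' x)\<^sup>2" for x y
    unfolding f_def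
  proof (rule second_order_bound[OF dFn dfn, of "{-K..K}"])
    fix z assume "z \<in> {-K..K}"
    then have "\<bar>z\<bar> powr (p - 1) \<le> K powr (p - 1)" using p1 by (intro powr_mono2) auto
    then have "p * \<bar>z\<bar> powr (p - 1) \<le> p * K powr (p - 1)" using p1 by (intro mult_left_mono) auto
    moreover have "0 \<le> p * \<bar>z\<bar> powr (p - 1)" using p1 by simp
    ultimately show "\<bar>m + p * \<bar>z\<bar> powr (p - 1)\<bar> \<le> C" using m by (simp add: C_def)
  next
    show "u' x \<in> {-K..K}" "u' y \<in> {-K..K}" using K(2)[of x] K(2)[of y] by (auto simp: abs_le_iff)
  qed simp
  have C: "C \<ge> 0" using m p1 K by (simp add: C_def)
  define W where "W = (\<Sum>j. (c j)\<^sup>2 / s j)"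
  have poho: "(n - 1) * ip lborel f u' + m\<^sup>2 * W \<le> 2 * n * (\<integral>x. Fn (u' x) \<partial>lborel)"
    using E.pohozaev_inequality[OF setting second C intg[OF cont(2) _ at0(3)]]
    by (simp add: n_def W_def c_def s_def)
  define A B where "A = ip lborel u' u'" and "B = (\<integral>x. \<bar>u' x\<bar> powr (p + 1) \<partial>lborel)"
  have g_mult: "g y * y = \<bar>y\<bar> powr (p + 1)" for y
  proof (cases "y = 0")
    case False
    have "\<bar>y\<bar> powr (p + 1) = \<bar>y\<bar> powr (p - 1) * \<bar>y\<bar> powr 2"
      using powr_add[of "\<bar>y\<bar>" "p - 1" 2] by (simp add: algebra_simps)
    then show ?thesis using False by (simp add: g_def power2_eq_square)
  qed (simp add: g_def)
  have B_int: "integrable lborel (\<lambda>x. \<bar>u' x\<bar> powr (p + 1))"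
    using sq_integrable_mult[OF gsq u'sq] by (simp add: g_mult)
  have fu: "ip lborel f u' = m * A + B"
    unfolding f_def[abs_def] fn_def
    by (subst ip_add_left[OF sq_integrable_cmult[OF u'sq] gsq u'sq])
       (simp add: ip_cmult_left A_def, simp add: B_def ip_def g_mult)
  have F_eq: "(\<integral>x. Fn (u' x) \<partial>lborel) = m / 2 * A + B / (p + 1)"
    using B_int sq_integrable_mult[OF u'sq u'sq] by (simp add: Fn_def A_def B_def ip_def power2_eq_square)
  have "B \<ge> 0" by (simp add: B_def)
  then have "B * (2 * n / (p + 1)) \<le> B * (n - 2)" using p_crit by (rule mult_left_mono[rotated])
  then have "2 * n * (m / 2 * A + B / (p + 1)) \<le> n * m * A + (n - 2) * B"
    by (simp add: algebra_simps)
  \<comment> \<open>With \<open>ip lborel f u' = m * A + B\<close>, subtracting \<open>n - 2\<close>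
    times this quantity from both sides leaves one copy of it on the left and
    \<open>2 * m * A\<close> on the right; the terms with \<open>B\<close> on the right
    cancel.\<close>
  with poho have key: "ip lborel f u' + m\<^sup>2 * W - 2 * m * A \<le> 0"
    unfolding fu F_eq by (simp add: algebra_simps)
  have spos: "s j > 0" and s_gt: "s j > m" for j
  proof -
    show "s j > 0" using E.lam_pos[of j] m by (simp add: s_def add_pos_pos)
    show "s j > m" using E.lam_pos[of j] by (simp add: s_def real_less_rsqrt)
  qed
  have A_sums: "(\<lambda>j. (c j)\<^sup>2) sums A"
    using E.parseval[OF u'sq u'sq u'0 u'0] by (simp add: A_def c_def power2_eq_square)
  have "(\<lambda>j. s j * (c j)\<^sup>2 + m\<^sup>2 * ((c j)\<^sup>2 / s j) - 2 * m * (c j)\<^sup>2) sums (ip lborel f u' + m\<^sup>2 * W - 2 * m * A)"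
    unfolding W_def using E.sums_form[OF setting] E.summable_inverse_form[OF setting]
    by (intro sums_add sums_diff sums_mult summable_sums A_sums) (auto simp: s_def c_def)
  \<comment> \<open>In each mode the weight is \<open>s j + m\<^sup>2 / s j - 2 * m\<close>, a
    perfect square over \<open>s j\<close>. Hence a sum that is at most 0 must vanish term by
    term.\<close>
  moreover have "s j * (c j)\<^sup>2 + m\<^sup>2 * ((c j)\<^sup>2 / s j) - 2 * m * (c j)\<^sup>2 = (s j - m)\<^sup>2 / s j * (c j)\<^sup>2" for j
    using spos[of j] by (simp add: field_simps power2_eq_square)
  ultimately have sums0: "(\<lambda>j. (s j - m)\<^sup>2 / s j * (c j)\<^sup>2) sums (ip lborel f u' + m\<^sup>2 * W - 2 * m * A)"
    by simp
  have nonneg: "0 \<le> (s j - m)\<^sup>2 / s j * (c j)\<^sup>2" for j using spos[of j] by simp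
  have "(\<Sum>j. (s j - m)\<^sup>2 / s j * (c j)\<^sup>2) = 0"
    using sums_unique[OF sums0] key suminf_nonneg[OF sums_summable[OF sums0] nonneg] by linarith
  then have "(s j - m)\<^sup>2 / s j * (c j)\<^sup>2 = 0" for j
    using suminf_eq_zero_iff[OF sums_summable[OF sums0] nonneg] by blast
  \<comment> \<open>Strict positivity of the eigenvalues makes every weight nonzero.\<close>
  then have "c j = 0" for j using s_gt[of j] spos[of j] by (metis divide_eq_0_iff eq_iff_diff_eq_0 less_irrefl mult_eq_0_iff zero_eq_power2)
  then have "A = 0" using sums_unique[OF A_sums] by simp
  then have "(\<integral>x. (u' x)\<^sup>2 \<partial>lborel) = 0" by (simp add: A_def ip_def power2_eq_square)
  then have "AE x in lborel. (u' x)\<^sup>2 = 0"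
    using u'sq by (subst (asm) integral_nonneg_eq_0_iff_AE) (auto simp: sq_integrable_def)
  then have "AE x in lebesgue. u' x = 0" by (intro AE_completion) simp
  then have "AE x in ?M. u' x = 0"
    using \<Omega>(1) by (subst AE_restrict_space_iff) auto
  with uu' show ?thesis by eventually_elim simp
qed

end
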